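(* (The 3D-Trapping Theorem) Let $g^{(ij)}$ be a diagonal, generic three-dimensional contravariant metric tensor with analytic coefficients such that the diagonal elements of its Ricci curvature tensor are identically zero, and let $f$ be an analytic function. Then the flow of $\nabla(f)$ can never cross the locus of degeneracy of $g^{(ij)}$. More precisely, the trajectories of the flow of $\nabla(f)$ are either contained in the locus of degeneracy of $g^{(ij)}$, or never intersect it.
   Context: In local coordinates $(x^1,x^2,x^3)=(x,y,z)$ the contravariant metric is $g^{(ij)}=\mathrm{diag}(P,Q,R)$ with $P,Q,R$ real-analytic; it may be degenerate but not identically so, and its locus of degeneracy is $\{\det(g^{(ij)})=PQR=0\}$. Where it is non-degenerate, the inverse tensor is a pseudo-Riemannian metric, and its Ricci tensor is meant, with components taken in the frame $H^i=g^{ii}\frac{\partial}{\partial x^i}$. The gradient $\nabla(f)=\sum_i g^{ii}\frac{\partial f}{\partial x^i}\frac{\partial}{\partial x^i}$ is defined everywhere, including on the locus of degeneracy. The diagonal metric is called generic if, taking the (degenerate) point under consideration as origin, no two of $P,Q,R$ share a non-invertible factor in the ring of convergent power series at that point. *)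

theory Defs
  imports "HOL-Analysis.Analysis"
begin

definition real_analytic_at :: "(real^'n::finite \<Rightarrow> real) \<Rightarrow> real^'n \<Rightarrow> bool" where
  "real_analytic_at f p \<longleftrightarrow>
     (\<exists>c :: ('n \<Rightarrow> nat) \<Rightarrow> real. \<forall>\<^sub>F x in nhds p.
        ((\<lambda>\<alpha>. c \<alpha> * (\<Prod>i\<in>UNIV. (x $ i - p $ i) ^ \<alpha> i)) has_sum f x) UNIV)"

definition real_analytic_on :: "(real^'n::finite \<Rightarrow> real) \<Rightarrow> (real^'n) set \<Rightarrow> bool" where
  "real_analytic_on f U \<longleftrightarrow> (\<forall>p\<in>U. real_analytic_at f p)"

text \<open>The ring of convergent power series at \<open>p\<close> is represented by germs at \<open>p\<close> of real-analytic
  functions: each series is identified with its sum near \<open>p\<close>, and an equation between series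
  with the corresponding equation between functions on a neighbourhood of \<open>p\<close>.\<close>

definition germ_dvd :: "real^'n::finite \<Rightarrow> (real^'n \<Rightarrow> real) \<Rightarrow> (real^'n \<Rightarrow> real) \<Rightarrow> bool" where
  "germ_dvd p h f \<longleftrightarrow> (\<exists>k. real_analytic_at k p \<and> (\<forall>\<^sub>F x in nhds p. f x = h x * k x))"

definition germ_invertible :: "real^'n::finite \<Rightarrow> (real^'n \<Rightarrow> real) \<Rightarrow> bool" where
  "germ_invertible p h \<longleftrightarrow> (\<exists>k. real_analytic_at k p \<and> (\<forall>\<^sub>F x in nhds p. h x * k x = 1))"

definition share_noninvertible_factor ::
    "real^'n::finite \<Rightarrow> (real^'n \<Rightarrow> real) \<Rightarrow> (real^'n \<Rightarrow> real) \<Rightarrow> bool" where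
  "share_noninvertible_factor p f g \<longleftrightarrow>
     (\<exists>h. real_analytic_at h p \<and> \<not> germ_invertible p h \<and> germ_dvd p h f \<and> germ_dvd p h g)"

definition partial :: "'n::finite \<Rightarrow> (real^'n \<Rightarrow> real) \<Rightarrow> real^'n \<Rightarrow> real" where
  "partial i f x = deriv (\<lambda>t. f (x + t *\<^sub>R axis i 1)) 0"

text \<open>A contravariant metric is given by its matrix \<open>G x\<close> of components with upper indices.\<close>

definition diag_metric :: "(real^3 \<Rightarrow> real) \<Rightarrow> (real^3 \<Rightarrow> real) \<Rightarrow> (real^3 \<Rightarrow> real) \<Rightarrow> real^3 \<Rightarrow> real^3^3" where
  "diag_metric P Q R x = (\<chi> i j. if i = j then vector [P x, Q x, R x] $ i else 0)"

definition degeneracy_locus :: "(real^'n::finite \<Rightarrow> real^'n^'n) \<Rightarrow> (real^'n) set \<Rightarrow> (real^'n) set" where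
  "degeneracy_locus G U = {x \<in> U. det (G x) = 0}"

definition generic_on :: "(real^'n::finite \<Rightarrow> real^'n^'n) \<Rightarrow> (real^'n) set \<Rightarrow> bool" where
  "generic_on G U \<longleftrightarrow> (\<forall>p \<in> degeneracy_locus G U. \<forall>i j. i \<noteq> j \<longrightarrow>
     \<not> share_noninvertible_factor p (\<lambda>x. G x $ i $ i) (\<lambda>x. G x $ j $ j))"

definition grad :: "(real^'n::finite \<Rightarrow> real^'n^'n) \<Rightarrow> (real^'n \<Rightarrow> real) \<Rightarrow> real^'n \<Rightarrow> real^'n" where
  "grad G f x = (\<chi> i. \<Sum>j\<in>UNIV. G x $ i $ j * partial j f x)"

text \<open>Curvature of the pseudo-Riemannian metric \<open>matrix_inv (G x)\<close>. The following quantities are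
  meaningful only where \<open>G\<close> is non-degenerate. This set is open for continuous \<open>G\<close>, so the
  arbitrary values of \<open>matrix_inv\<close> elsewhere do not affect the partial derivatives in it.\<close>

definition christoffel :: "(real^'n::finite \<Rightarrow> real^'n^'n) \<Rightarrow> 'n \<Rightarrow> 'n \<Rightarrow> 'n \<Rightarrow> real^'n \<Rightarrow> real" where
  "christoffel G k i j x =
     (let g = (\<lambda>a b y. matrix_inv (G y) $ a $ b) in
      1/2 * (\<Sum>l\<in>UNIV. G x $ k $ l *
        (partial i (g j l) x + partial j (g i l) x - partial l (g i j) x)))"

definition ricci :: "(real^'n::finite \<Rightarrow> real^'n^'n) \<Rightarrow> 'n \<Rightarrow> 'n \<Rightarrow> real^'n \<Rightarrow> real" where
  "ricci G i j x =
     (\<Sum>k\<in>UNIV. partial k (christoffel G k i j) x - partial j (christoffel G k i k) x)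
     + (\<Sum>k\<in>UNIV. \<Sum>l\<in>UNIV. christoffel G k k l x * christoffel G l i j x
                           - christoffel G k j l x * christoffel G l i k x)"

text \<open>\<open>Ric (H\<^sup>i, H\<^sup>j)\<close> for the frame \<open>H\<^sup>i = \<Sum>\<^sub>a G\<^sup>i\<^sup>a \<partial>\<^sub>a\<close>, which is \<open>G\<^sup>i\<^sup>i \<partial>\<^sub>i\<close> for diagonal \<open>G\<close>.\<close>

definition ricci_frame :: "(real^'n::finite \<Rightarrow> real^'n^'n) \<Rightarrow> 'n \<Rightarrow> 'n \<Rightarrow> real^'n \<Rightarrow> real" where
  "ricci_frame G i j x = (\<Sum>a\<in>UNIV. \<Sum>b\<in>UNIV. G x $ i $ a * G x $ j $ b * ricci G a b x)"

definition trajectory_in ::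
    "(real^'n::finite) set \<Rightarrow> (real^'n \<Rightarrow> real^'n) \<Rightarrow> real set \<Rightarrow> (real \<Rightarrow> real^'n) \<Rightarrow> bool" where
  "trajectory_in U X I \<gamma> \<longleftrightarrow> is_interval I \<and>
     (\<forall>t\<in>I. \<gamma> t \<in> U \<and> (\<gamma> has_vector_derivative X (\<gamma> t)) (at t within I))"

end

theory Submission
  imports Defs
begin

text \<open>All sectional curvatures \<open>K\<^sub>i\<^sub>j\<close> of the coordinate planes of a diagonal three-dimensional metric vanish
  if the diagonal Ricci components do, as each diagonal component is a sum of two of the three.
  Write \<open>P\<close>, \<open>Q\<close>, \<open>R\<close> for the diagonal elements. After clearing
  denominators, \<open>K\<^sub>1\<^sub>2 = 0\<close> says that \<open>Q\<^sup>3 (2 P P\<^sub>y\<^sub>y - 3 P\<^sub>y\<^sup>2)\<close> plus terms divisible by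
  \<open>P P\<^sub>y\<close>, \<open>P\<^sup>2\<close> or \<open>P P\<^sub>z\<close> is zero. Comparing the multiplicities of a prime factor \<open>h\<close> of \<open>P\<close>, which by
  genericity does not divide \<open>Q\<close>, gives \<open>h dvd h\<^sub>y\<close> and hence \<open>P dvd P\<^sub>y\<close>. By symmetry each diagonal
  element divides its derivatives in the other two directions. Along a trajectory \<open>D = P Q R\<close> therefore satisfies
  \<open>\<bar>D'\<bar> \<le> C \<bar>D\<bar>\<close> near each of its zeros, so the zeros of \<open>D\<close> form an open and closed set of times.

  This needs unique factorization for convergent power series in three variables. It is derived from
  Weierstrass division, which is a Neumann series in weighted \<open>\<ell>\<^sup>1\<close>-norms, and from Gauss's lemma.\<close>

section \<open>Coefficient rings of convergent power series\<close>

text \<open>The bound on \<open>D'\<close> rests on one more observation. With \<open>q j\<close>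
  for the diagonal elements, \<open>D'\<close> is the sum over \<open>j\<close> of
  \<open>q j * partial j f * partial j D\<close>. Divisibility of the derivatives is known only in
  the other two directions: nothing relates \<open>P\<close> to its own derivative in
  \<open>x\<close>. The gap is closed by the gradient, whose component in direction \<open>j\<close>
  carries the factor \<open>q j\<close>; thus \<open>D\<close> divides
  \<open>q j * partial j D\<close> for every \<open>j\<close>. The curvature equations are available
  only off the locus, while multiplicities are compared at a point of it. They are therefore read as
  identities between germs: multiplied by \<open>D\<close> they hold on a full neighbourhood, and
  \<open>D\<close> cancels in the integral domain of germs. The estimate needs true divisibility of
  germs, not merely vanishing of derivatives on the zero set, and this is what prime factors with
  multiplicities provide. Factoriality is proved by induction on the number of variables, with
  nested series rings whose outermost variable is the distinguished one. Weierstrass division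
  requires a series that does not vanish identically on the axis of this variable; in three
  variables a linear shear arranges that.\<close>

lemma ennreal_suminf_swap:
  fixes f :: "nat \<Rightarrow> nat \<Rightarrow> ennreal"
  shows "(\<Sum>n. \<Sum>m. f n m) = (\<Sum>m. \<Sum>n. f n m)"
proof -
  have "(\<integral>\<^sup>+n. (\<Sum>m. f n m) \<partial>count_space UNIV) = (\<Sum>m. \<integral>\<^sup>+n. f n m \<partial>count_space UNIV)"
    by (rule nn_integral_suminf) simp
  then show ?thesis
    by (simp add: nn_integral_count_space_nat)
qed

lemma ennreal_suminf_le:
  fixes f :: "nat \<Rightarrow> ennreal"
  assumes "\<And>N. (\<Sum>n<N. f n) \<le> B"
  shows "suminf f \<le> B"
  unfolding suminf_eq_SUP using assms by (rule SUP_least)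

lemma ennreal_sum_le_suminf: "(\<Sum>n<N. f n) \<le> (suminf f :: ennreal)"
  unfolding suminf_eq_SUP by (rule SUP_upper) simp

lemma ennreal_term_le_suminf: "f n \<le> (suminf f :: ennreal)"
proof -
  have "f n \<le> (\<Sum>i<Suc n. f i)"
    by (simp add: add_increasing)
  then show ?thesis
    using ennreal_sum_le_suminf[of f "Suc n"] by (rule order_trans)
qed

lemma ennreal_suminf_mono:
  "(\<And>n. f n \<le> g n) \<Longrightarrow> suminf f \<le> (suminf g :: ennreal)"
  by (intro suminf_le summableI) auto

lemma ennreal_suminf_add: "(\<Sum>n. f n + g n) = suminf f + (suminf g :: ennreal)"
  by (intro suminf_add[symmetric] summableI)

text \<open>The pairs with sum below \<open>N\<close> form a triangle inside the square of pairs
  below \<open>N\<close>. The estimate yields submultiplicativity of the norms.\<close>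

lemma ennreal_Cauchy_product_le:
  fixes f g :: "nat \<Rightarrow> ennreal"
  shows "(\<Sum>n. \<Sum>i\<le>n. f i * g (n - i)) \<le> suminf f * suminf g"
proof (rule ennreal_suminf_le)
  fix N
  have "(\<Sum>n<N. \<Sum>i\<le>n. f i * g (n - i)) = (\<Sum>(i, j)\<in>{(i, j). i + j < N}. f i * g j)"
    by (rule sum.triangle_reindex[symmetric])
  also have "\<dots> \<le> (\<Sum>(i, j)\<in>{..<N} \<times> {..<N}. f i * g j)"
    by (intro sum_mono2) auto
  also have "\<dots> = (\<Sum>i<N. f i) * (\<Sum>j<N. g j)"
    by (simp add: sum_product sum.cartesian_product)
  also have "\<dots> \<le> suminf f * suminf g"
    by (intro mult_mono ennreal_sum_le_suminf) auto
  finally show "(\<Sum>n<N. \<Sum>i\<le>n. f i * g (n - i)) \<le> suminf f * suminf g" .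
qed

lemma ennreal_suminf_tail_tendsto_0:
  fixes f :: "nat \<Rightarrow> ennreal"
  assumes "suminf f < top"
  shows "(\<lambda>N. \<Sum>n. f (n + N)) \<longlonglongrightarrow> 0"
proof -
  have fin: "f n < top" for n
    using ennreal_term_le_suminf[of f n] assms by order
  define h where "h n = enn2real (f n)" for n
  have f_eq: "f n = ennreal (h n)" for n
    using fin[of n] by (simp add: h_def)
  have h0: "h n \<ge> 0" for n by (simp add: h_def)
  have sm: "summable h"
    using assms by (intro summable_suminf_not_top h0) (simp add: f_eq[symmetric])
  have "(\<lambda>N. \<Sum>n. h (n + N)) \<longlonglongrightarrow> 0"
    by (rule suminf_exist_split2[OF sm])
  then have "(\<lambda>N. ennreal (\<Sum>n. h (n + N))) \<longlonglongrightarrow> ennreal 0"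
    by (rule tendsto_ennrealI)
  moreover have "ennreal (\<Sum>n. h (n + N)) = (\<Sum>n. f (n + N))" for N
    unfolding f_eq using sm h0 by (intro suminf_ennreal2[symmetric]) auto
  ultimately show ?thesis by simp
qed

text \<open>In each variable power series are given by their coefficients in the remaining variables.
  The class collects what such an iteration has to carry along: \<open>nm r\<close> is the weighted
  \<open>\<ell>\<^sup>1\<close>-norm on the polydisc of radius \<open>r\<close>, and \<open>ev v\<close> is evaluation at the point with coordinates
  \<open>v 0, v 1, \<dots>\<close>, of which only the first \<open>nvars\<close> matter. The elements need not converge.\<close>

class analytic_coeff = idom +
  fixes cst :: "real \<Rightarrow> 'a"
    and nm :: "real \<Rightarrow> 'a \<Rightarrow> ennreal"
    and ev :: "(nat \<Rightarrow> real) \<Rightarrow> 'a \<Rightarrow> real"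
    and dv :: "nat \<Rightarrow> 'a \<Rightarrow> 'a"
    and nvars :: "'a itself \<Rightarrow> nat"
  assumes cst_1: "cst 1 = 1"
    and cst_add: "cst (c + d) = cst c + cst d"
    and nm_cst: "nm r (cst c) = ennreal \<bar>c\<bar>"
    and nm_zero: "nm r 0 = 0"
    and nm_eq_0D: "0 < r \<Longrightarrow> nm r a = 0 \<Longrightarrow> a = 0"
    and nm_add: "nm r (a + b) \<le> nm r a + nm r b"
    and nm_minus: "nm r (- a) = nm r a"
    and nm_mult: "0 < r \<Longrightarrow> nm r (a * b) \<le> nm r a * nm r b"
    and nm_mono: "0 < r \<Longrightarrow> r \<le> s \<Longrightarrow> nm r a \<le> nm s a"
    and nm_small: "0 < r \<Longrightarrow> r \<le> s \<Longrightarrow> ev (\<lambda>_. 0) a = 0 \<Longrightarrow> nm r a \<le> ennreal (r / s) * nm s a"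
    and nm_complete: "0 < r \<Longrightarrow> (\<Sum>n. nm r (f n)) < top \<Longrightarrow>
           \<exists>s. \<forall>N. nm r (s - (\<Sum>n<N. f n)) \<le> (\<Sum>n. nm r (f (n + N)))"
    and nm_dv: "0 < r \<Longrightarrow> r < s \<Longrightarrow> nm r (dv i a) \<le> ennreal (1 / (s - r)) * nm s a"
    and ev_le_nm: "0 < r \<Longrightarrow> (\<And>i. \<bar>v i\<bar> \<le> r) \<Longrightarrow> ennreal \<bar>ev v a\<bar> \<le> nm r a"
    and ev_cst: "ev v (cst c) = c"
    and ev_add: "0 < r \<Longrightarrow> (\<And>i. \<bar>v i\<bar> \<le> r) \<Longrightarrow> nm r a < top \<Longrightarrow> nm r b < top \<Longrightarrow> ev v (a + b) = ev v a + ev v b"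
    and ev_mult: "0 < r \<Longrightarrow> (\<And>i. \<bar>v i\<bar> \<le> r) \<Longrightarrow> nm r a < top \<Longrightarrow> nm r b < top \<Longrightarrow> ev v (a * b) = ev v a * ev v b"
    and ev_eq_0D: "0 < r \<Longrightarrow> nm r a < top \<Longrightarrow> (\<And>v. (\<And>i. \<bar>v i\<bar> \<le> r) \<Longrightarrow> ev v a = 0) \<Longrightarrow> a = 0"
    and ev0_add: "ev (\<lambda>_. 0) (a + b) = ev (\<lambda>_. 0) a + ev (\<lambda>_. 0) b"
    and ev0_mult: "ev (\<lambda>_. 0) (a * b) = ev (\<lambda>_. 0) a * ev (\<lambda>_. 0) b"
    and dv_add: "dv i (a + b) = dv i a + dv i b"
    and dv_mult: "dv i (a * b) = dv i a * b + a * dv i b"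
    and ev_curve: "0 < r \<Longrightarrow> r < s \<Longrightarrow> nm s a < top \<Longrightarrow> convex J \<Longrightarrow>
        (\<And>i t. t \<in> J \<Longrightarrow> \<bar>p t i\<bar> \<le> r) \<Longrightarrow> (\<And>i t. t \<in> J \<Longrightarrow> \<bar>p' t i\<bar> \<le> M) \<Longrightarrow>
        (\<And>i t. t \<in> J \<Longrightarrow> ((\<lambda>t. p t i) has_field_derivative p' t i) (at t within J)) \<Longrightarrow> t \<in> J \<Longrightarrow>
        ((\<lambda>t. ev (p t) a) has_field_derivative
           (\<Sum>i<nvars TYPE('a). p' t i * ev (p t) (dv i a))) (at t within J)"

text \<open>Base of the iteration: numbers are power series in no variables, so evaluation ignores
  the point and all derivatives are zero.\<close>

instantiation real :: analytic_coeff
begin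

definition cst_real :: "real \<Rightarrow> real" where "cst_real c = c"
definition nm_real :: "real \<Rightarrow> real \<Rightarrow> ennreal" where "nm_real r c = ennreal \<bar>c\<bar>"
definition ev_real :: "(nat \<Rightarrow> real) \<Rightarrow> real \<Rightarrow> real" where "ev_real v c = c"
definition dv_real :: "nat \<Rightarrow> real \<Rightarrow> real" where "dv_real i c = 0"
definition nvars_real :: "real itself \<Rightarrow> nat" where "nvars_real _ = 0"

instance
proof
  fix r :: real and f :: "nat \<Rightarrow> real"
  assume "0 < r" and "(\<Sum>n. nm r (f n)) < top"
  then have abs: "summable (\<lambda>n. \<bar>f n\<bar>)"
    by (intro summable_suminf_not_top) (auto simp: nm_real_def)
  have "nm r (suminf f - (\<Sum>n<N. f n)) \<le> (\<Sum>n. nm r (f (n + N)))" for N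
  proof -
    have "summable f" using abs by (rule summable_rabs_cancel)
    then have "suminf f - (\<Sum>n<N. f n) = (\<Sum>n. f (n + N))"
      by (simp add: suminf_split_initial_segment[of f N])
    moreover have "\<bar>\<Sum>n. f (n + N)\<bar> \<le> (\<Sum>n. \<bar>f (n + N)\<bar>)"
      using abs by (intro summable_rabs) (subst summable_iff_shift[of "\<lambda>n. \<bar>f n\<bar>"])
    moreover have "(\<Sum>n. ennreal \<bar>f (n + N)\<bar>) = ennreal (\<Sum>n. \<bar>f (n + N)\<bar>)"
      using abs by (intro suminf_ennreal2) (auto simp: summable_iff_shift[of "\<lambda>n. \<bar>f n\<bar>"])
    ultimately show ?thesis
      by (simp add: nm_real_def ennreal_leI)
  qed
  then show "\<exists>s. \<forall>N. nm r (s - (\<Sum>n<N. f n)) \<le> (\<Sum>n. nm r (f (n + N)))" by blast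
next
  fix r :: real and a :: real
  assume "0 < r" and "\<And>v. (\<And>i. \<bar>v i\<bar> \<le> r) \<Longrightarrow> ev v a = 0"
  from this(2)[of "\<lambda>_. 0"] \<open>0 < r\<close> show "a = 0" by (simp add: ev_real_def)
qed (auto simp: cst_real_def nm_real_def ev_real_def dv_real_def nvars_real_def abs_mult
        ennreal_mult'' ennreal_plus[symmetric] simp del: ennreal_plus intro!: ennreal_leI)

end

unbundle no vec_syntax
unbundle fps_syntax

context analytic_coeff
begin

lemma cst_0: "cst 0 = 0"
  using cst_add[of 0 0] by simp

lemma cst_of_nat: "cst (of_nat n) = of_nat n"
  by (induction n) (simp_all add: cst_0 cst_1 cst_add)

lemma nm_diff: "nm r (a - b) \<le> nm r a + nm r b"
  using nm_add[of r a "- b"] by (simp add: nm_minus)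

lemma nm_sum: "nm r (sum f A) \<le> (\<Sum>i\<in>A. nm r (f i))"
proof (induction A rule: infinite_finite_induct)
  case (insert x F)
  then show ?case
    using nm_add[of r "f x" "sum f F"] by (auto intro: order_trans add_left_mono)
qed (auto simp: nm_zero)

lemma nm_of_nat_mult: "0 < r \<Longrightarrow> nm r (of_nat n * a) \<le> ennreal (real n) * nm r a"
  using nm_mult[of r "of_nat n" a] nm_cst[of r "of_nat n"] by (simp add: cst_of_nat)

lemma nm_sum_finite: "(\<And>i. i \<in> A \<Longrightarrow> nm r (f i) < top) \<Longrightarrow> nm r (sum f A) < top"
  by (induction A rule: infinite_finite_induct)
     (auto simp: nm_zero intro: le_less_trans[OF nm_add] simp: less_top)

lemma nm_mult_finite: "0 < r \<Longrightarrow> nm r a < top \<Longrightarrow> nm r b < top \<Longrightarrow> nm r (a * b) < top"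
  by (rule le_less_trans[OF nm_mult]) (auto simp: ennreal_mult_less_top)

lemma ev_0: "ev v 0 = 0"
  using ev_cst[of v 0] by (simp add: cst_0)

lemma ev_1: "ev v 1 = 1"
  using ev_cst[of v 1] by (simp add: cst_1)

lemma ev_sum:
  assumes "0 < r" "\<And>i. \<bar>v i\<bar> \<le> r" "\<And>i. i \<in> A \<Longrightarrow> nm r (f i) < top"
  shows "ev v (sum f A) = (\<Sum>i\<in>A. ev v (f i))"
  using assms(3)
proof (induction A rule: infinite_finite_induct)
  case (insert x F)
  then show ?case
    using ev_add[of r v "f x" "sum f F"] nm_sum_finite[of F r f] assms(1,2) by auto
qed (auto simp: ev_0)

lemma ev_minus:
  assumes "0 < r" "\<And>i. \<bar>v i\<bar> \<le> r" "nm r a < top"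
  shows "ev v (- a) = - ev v a"
  using ev_add[of r v a "- a"] assms by (simp add: ev_0 nm_minus)

lemma ev_diff:
  assumes "0 < r" "\<And>i. \<bar>v i\<bar> \<le> r" "nm r a < top" "nm r b < top"
  shows "ev v (a - b) = ev v a - ev v b"
  using ev_add[of r v a "- b"] ev_minus[of r v b] assms by (simp add: nm_minus)

lemma ev0_sum: "ev (\<lambda>_. 0) (sum f A) = (\<Sum>i\<in>A. ev (\<lambda>_. 0) (f i))"
  by (induction A rule: infinite_finite_induct) (auto simp: ev_0 ev0_add)

end

text \<open>The outer radius \<rho> and the inner radius \<open>r\<close> are kept apart because
  Weierstrass division shrinks \<open>r\<close> while \<rho> stays fixed. For equal radii this is
  the norm of the next ring in the iteration.\<close>

definition nm2 :: "real \<Rightarrow> real \<Rightarrow> 'a::analytic_coeff fps \<Rightarrow> ennreal" where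
  "nm2 \<rho> r F = (\<Sum>n. nm r (F $ n) * ennreal \<rho> ^ n)"

lemma nm2_zero: "nm2 \<rho> r 0 = 0"
  by (simp add: nm2_def nm_zero)

lemma nm2_coeff_le: "nm r (F $ n) * ennreal \<rho> ^ n \<le> nm2 \<rho> r F"
  unfolding nm2_def by (rule ennreal_term_le_suminf)

lemma nm2_coeff_finite:
  assumes "0 < \<rho>" "nm2 \<rho> r F < top"
  shows "nm r (F $ n) < top"
  using nm2_coeff_le[of r F n \<rho>] assms
  by (cases "nm r (F $ n) = top") (auto simp: less_top ennreal_top_mult top_unique ennreal_power)

lemma nm2_eq_0D:
  assumes "0 < \<rho>" "0 < r" "nm2 \<rho> r F = 0"
  shows "F = 0"
proof (rule fps_ext)
  fix n
  have "nm r (F $ n) * ennreal \<rho> ^ n = 0"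
    using nm2_coeff_le[of r F n \<rho>] assms(3) by simp
  then have "nm r (F $ n) = 0" using assms(1) by (auto simp: ennreal_power)
  then show "F $ n = 0 $ n" using assms(2) by (auto dest: nm_eq_0D)
qed

lemma nm2_add: "nm2 \<rho> r (F + G) \<le> nm2 \<rho> r F + nm2 \<rho> r G"
  unfolding nm2_def ennreal_suminf_add[symmetric] distrib_right[symmetric]
  by (intro ennreal_suminf_mono mult_right_mono) (auto simp: nm_add)

lemma nm2_minus: "nm2 \<rho> r (- F) = nm2 \<rho> r F"
  by (simp add: nm2_def nm_minus)

lemma nm2_mult:
  assumes "0 < r"
  shows "nm2 \<rho> r (F * G) \<le> nm2 \<rho> r F * nm2 \<rho> r G"
proof -
  have "nm2 \<rho> r (F * G) \<le>
    (\<Sum>n. \<Sum>i\<le>n. (nm r (F $ i) * ennreal \<rho> ^ i) * (nm r (G $ (n - i)) * ennreal \<rho> ^ (n - i)))"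
    unfolding nm2_def
  proof (rule ennreal_suminf_mono)
    fix n
    have "nm r ((F * G) $ n) * ennreal \<rho> ^ n \<le> (\<Sum>i\<le>n. nm r (F $ i) * nm r (G $ (n - i))) * ennreal \<rho> ^ n"
      unfolding fps_mult_nth atLeast0AtMost
      by (intro mult_right_mono order_trans[OF nm_sum] sum_mono nm_mult assms) auto
    also have "\<dots> = (\<Sum>i\<le>n. (nm r (F $ i) * ennreal \<rho> ^ i) * (nm r (G $ (n - i)) * ennreal \<rho> ^ (n - i)))"
      unfolding sum_distrib_right
    proof (rule sum.cong[OF refl])
      fix i assume "i \<in> {..n}"
      then have "ennreal \<rho> ^ n = ennreal \<rho> ^ i * ennreal \<rho> ^ (n - i)"
        by (simp add: power_add[symmetric])
      then show "nm r (F $ i) * nm r (G $ (n - i)) * ennreal \<rho> ^ n =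
          (nm r (F $ i) * ennreal \<rho> ^ i) * (nm r (G $ (n - i)) * ennreal \<rho> ^ (n - i))"
        by (simp only: mult_ac)
    qed
    finally show "nm r ((F * G) $ n) * ennreal \<rho> ^ n \<le>
      (\<Sum>i\<le>n. (nm r (F $ i) * ennreal \<rho> ^ i) * (nm r (G $ (n - i)) * ennreal \<rho> ^ (n - i)))" .
  qed
  also have "\<dots> \<le> nm2 \<rho> r F * nm2 \<rho> r G"
    unfolding nm2_def by (rule ennreal_Cauchy_product_le)
  finally show ?thesis .
qed

lemma nm2_mono: "0 < r \<Longrightarrow> r \<le> s \<Longrightarrow> \<rho> \<le> \<sigma> \<Longrightarrow> nm2 \<rho> r F \<le> nm2 \<sigma> s F"
  unfolding nm2_def by (intro ennreal_suminf_mono mult_mono nm_mono power_mono ennreal_leI) auto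

text \<open>The sum is formed coefficientwise. The tail bounds of the coefficients, weighted by
  powers of \<rho>, add up to the required bound once the two summations are exchanged; this is why
  completeness is stated with explicit tails.\<close>

lemma nm2_complete:
  fixes f :: "nat \<Rightarrow> 'a::analytic_coeff fps"
  assumes "0 < \<rho>" "0 < r" and fin: "(\<Sum>k. nm2 \<rho> r (f k)) < top"
  shows "\<exists>S. \<forall>N. nm2 \<rho> r (S - (\<Sum>k<N. f k)) \<le> (\<Sum>k. nm2 \<rho> r (f (k + N)))"
proof -
  have "(\<Sum>k. nm r (f k $ n)) < top" for n
  proof -
    have "(\<Sum>k. nm r (f k $ n)) * ennreal \<rho> ^ n \<le> (\<Sum>k. nm2 \<rho> r (f k))"
      unfolding ennreal_suminf_multc[symmetric] by (intro ennreal_suminf_mono nm2_coeff_le)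
    then show ?thesis using fin assms(1)
      by (cases "(\<Sum>k. nm r (f k $ n)) = top")
         (auto simp: less_top ennreal_top_mult top_unique ennreal_power)
  qed
  then have "\<forall>n. \<exists>s. \<forall>N. nm r (s - (\<Sum>k<N. f k $ n)) \<le> (\<Sum>k. nm r (f (k + N) $ n))"
    by (intro allI nm_complete[OF assms(2)])
  then obtain s where s: "nm r (s n - (\<Sum>k<N. f k $ n)) \<le> (\<Sum>k. nm r (f (k + N) $ n))" for n N
    by metis
  have "nm2 \<rho> r (Abs_fps s - (\<Sum>k<N. f k)) \<le> (\<Sum>k. nm2 \<rho> r (f (k + N)))" for N
  proof -
    have "nm2 \<rho> r (Abs_fps s - (\<Sum>k<N. f k)) \<le> (\<Sum>n. (\<Sum>k. nm r (f (k + N) $ n)) * ennreal \<rho> ^ n)"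
      unfolding nm2_def by (intro ennreal_suminf_mono mult_right_mono) (auto simp: fps_sum_nth s)
    also have "\<dots> = (\<Sum>k. nm2 \<rho> r (f (k + N)))"
      unfolding nm2_def ennreal_suminf_multc[symmetric] by (rule ennreal_suminf_swap)
    finally show ?thesis .
  qed
  then show ?thesis by blast
qed

text \<open>Each of the \<open>Suc n\<close> terms \<open>r ^ n\<close> is at most
  \<open>r ^ (n - i) * s ^ i\<close>, and these add up to
  \<open>(s ^ Suc n - r ^ Suc n) / (s - r)\<close>. This is the source of the constant
  \<open>1 / (s - r)\<close> in \<open>nm_dv\<close>.\<close>

lemma of_nat_mult_power_le:
  fixes r s :: real
  assumes "0 < r" "r < s"
  shows "real (Suc n) * r ^ n \<le> s ^ Suc n / (s - r)"
proof -
  have "real (Suc n) * r ^ n = (\<Sum>i<Suc n. r ^ n)" by simp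
  also have "\<dots> \<le> (\<Sum>i<Suc n. r ^ (n - i) * s ^ i)"
  proof (rule sum_mono)
    fix i assume "i \<in> {..<Suc n}"
    then have "r ^ n = r ^ (n - i) * r ^ i" by (simp add: power_add[symmetric])
    also have "\<dots> \<le> r ^ (n - i) * s ^ i"
      using assms by (intro mult_left_mono power_mono) auto
    finally show "r ^ n \<le> r ^ (n - i) * s ^ i" .
  qed
  finally have "(s - r) * (real (Suc n) * r ^ n) \<le> (s - r) * (\<Sum>i<Suc n. r ^ (n - i) * s ^ i)"
    using assms by (intro mult_left_mono) auto
  also have "\<dots> = s ^ Suc n - r ^ Suc n"
    unfolding power_diff_sumr2[of s "Suc n" r] by simp
  also have "\<dots> \<le> s ^ Suc n" using assms by simp
  finally show ?thesis using assms by (simp add: field_simps)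
qed

text \<open>Once all lower coefficients vanish, the series can be divided by \<open>x ^ n\<close>
  away from 0, and its limit at 0 is the coefficient of index \<open>n\<close>.\<close>

lemma real_powser_eq_0D:
  fixes a :: "nat \<Rightarrow> real"
  assumes "0 < r" "\<And>x. \<bar>x\<bar> \<le> r \<Longrightarrow> (\<lambda>n. a n * x ^ n) sums 0"
  shows "a n = 0"
proof (induction n rule: less_induct)
  case (less n)
  have "(\<lambda>i. a (i + n) * x ^ i) sums 0" if "x \<noteq> 0" "norm x < r" for x
  proof -
    have "(\<lambda>i. a (i + n) * x ^ (i + n)) sums 0"
      using assms(2)[of x] that less.IH by (subst sums_zero_iff_shift) auto
    then have "(\<lambda>i. x ^ n * (a (i + n) * x ^ i)) sums (x ^ n * 0)"
      by (simp add: power_add mult_ac)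
    then show ?thesis using that by (subst (asm) sums_mult_iff) auto
  qed
  then have "((\<lambda>_. 0) \<longlongrightarrow> a (0 + n)) (at (0::real))"
    using assms(1) by (intro powser_limit_0_strong[of r "\<lambda>i. a (i + n)"]) auto
  then show ?case by (auto dest: tendsto_unique[OF _ tendsto_const, rotated])
qed

section \<open>Adding one variable: power series over a coefficient ring\<close>

instantiation fps :: (analytic_coeff) analytic_coeff
begin

definition cst_fps :: "real \<Rightarrow> 'a fps" where "cst_fps c = fps_const (cst c)"
definition nm_fps :: "real \<Rightarrow> 'a fps \<Rightarrow> ennreal" where "nm_fps r F = nm2 r r F"
definition ev_fps :: "(nat \<Rightarrow> real) \<Rightarrow> 'a fps \<Rightarrow> real" where
  "ev_fps v F = (\<Sum>n. ev (\<lambda>i. v (Suc i)) (F $ n) * v 0 ^ n)"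
definition dv_fps :: "nat \<Rightarrow> 'a fps \<Rightarrow> 'a fps" where
  "dv_fps i F = (case i of 0 \<Rightarrow> fps_deriv F | Suc j \<Rightarrow> Abs_fps (\<lambda>n. dv j (F $ n)))"
definition nvars_fps :: "'a fps itself \<Rightarrow> nat" where "nvars_fps _ = Suc (nvars TYPE('a))"

lemma ev0_fps: "ev (\<lambda>_. 0) (F :: 'a fps) = ev (\<lambda>_. 0) (F $ 0)"
  unfolding ev_fps_def by simp

lemma ev_fps_term_le:
  fixes F :: "'a fps"
  assumes "0 < r" "\<And>i. \<bar>v i\<bar> \<le> r"
  shows "ennreal \<bar>ev (\<lambda>i. v (Suc i)) (F $ n) * v 0 ^ n\<bar> \<le> nm r (F $ n) * ennreal r ^ n"
proof -
  have "ennreal \<bar>ev (\<lambda>i. v (Suc i)) (F $ n)\<bar> \<le> nm r (F $ n)"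
    using assms by (intro ev_le_nm) auto
  moreover have "ennreal (\<bar>v 0\<bar> ^ n) \<le> ennreal r ^ n"
    using assms by (simp add: ennreal_power ennreal_leI power_mono)
  ultimately show ?thesis
    by (simp add: abs_mult power_abs ennreal_mult mult_mono)
qed

lemma ev_fps_summable:
  fixes F :: "'a fps"
  assumes "0 < r" "\<And>i. \<bar>v i\<bar> \<le> r" "nm r F < top"
  shows "summable (\<lambda>n. \<bar>ev (\<lambda>i. v (Suc i)) (F $ n) * v 0 ^ n\<bar>)"
proof (rule summable_suminf_not_top)
  have "(\<Sum>n. ennreal \<bar>ev (\<lambda>i. v (Suc i)) (F $ n) * v 0 ^ n\<bar>) \<le> nm r F"
    unfolding nm_fps_def nm2_def by (intro ennreal_suminf_mono ev_fps_term_le assms(1,2))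
  with assms(3) show "(\<Sum>n. ennreal \<bar>ev (\<lambda>i. v (Suc i)) (F $ n) * v 0 ^ n\<bar>) \<noteq> top"
    by (auto simp: less_top top_unique)
qed auto

lemma nm_fps_nth_finite: "0 < r \<Longrightarrow> nm r (F :: 'a fps) < top \<Longrightarrow> nm r (F $ n) < top"
  unfolding nm_fps_def by (rule nm2_coeff_finite)

text \<open>The coefficient norms become a real sequence, the majorant for termwise
  differentiation.\<close>

lemma nm_fps_real:
  assumes "0 < r" "nm r (F :: 'a fps) < top"
  obtains h where "\<And>n. 0 \<le> h n" "\<And>n. nm r (F $ n) = ennreal (h n)" "summable (\<lambda>n. h n * r ^ n)"
proof
  let ?h = "\<lambda>n. enn2real (nm r (F $ n))"
  show h: "nm r (F $ n) = ennreal (?h n)" for n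
    using nm_fps_nth_finite[OF assms, of n] by simp
  show "summable (\<lambda>n. ?h n * r ^ n)"
  proof (rule summable_suminf_not_top)
    have "ennreal (?h n * r ^ n) = nm r (F $ n) * ennreal r ^ n" for n
      using assms(1) by (simp add: h[symmetric] ennreal_mult ennreal_power)
    then show "(\<Sum>n. ennreal (?h n * r ^ n)) \<noteq> top"
      using assms(2) by (simp add: nm_fps_def nm2_def less_top)
  qed (use assms(1) in auto)
qed auto

text \<open>Termwise differentiation: the coefficients obey the same chain rule in fewer variables,
  the powers of the outer variable the ordinary one, and a Weierstrass majorant permits summation.
  Curves on a convex \<open>J\<close>, with derivatives within \<open>J\<close>, cover coordinate
  lines as well as trajectories with endpoints.\<close>

lemma ev_fps_curve:
  fixes F :: "'a fps" and p p' :: "real \<Rightarrow> nat \<Rightarrow> real"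
  assumes rs: "0 < r" "r < s" and F: "nm s F < top" and J: "convex J"
    and p: "\<And>i t. t \<in> J \<Longrightarrow> \<bar>p t i\<bar> \<le> r" and p': "\<And>i t. t \<in> J \<Longrightarrow> \<bar>p' t i\<bar> \<le> M"
    and der: "\<And>i t. t \<in> J \<Longrightarrow> ((\<lambda>t. p t i) has_field_derivative p' t i) (at t within J)"
    and t: "t \<in> J"
  shows "((\<lambda>t. ev (p t) F) has_field_derivative
           (\<Sum>i<nvars TYPE('a fps). p' t i * ev (p t) (dv i F))) (at t within J)"
proof -
  have s0: "0 < s" using rs by simp
  have M0: "0 \<le> M" using p'[OF t, of 0] by simp
  obtain h where h0: "\<And>n. 0 \<le> h n" and h: "\<And>n. nm s (F $ n) = ennreal (h n)"
    and hs: "summable (\<lambda>n. h n * s ^ n)"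
    using nm_fps_real[OF s0 F] by metis
  define q where "q = (\<lambda>t i. p t (Suc i))"
  define N where "N = nvars TYPE('a)"
  define f where "f = (\<lambda>n t. ev (q t) (F $ n) * p t 0 ^ n)"
  define f' where "f' = (\<lambda>n t. (\<Sum>i<N. p' t (Suc i) * ev (q t) (dv i (F $ n))) * p t 0 ^ n
      + ev (q t) (F $ n) * (real n * p t 0 ^ (n - 1) * p' t 0))"
  have q: "\<bar>q t i\<bar> \<le> r" if "t \<in> J" for t i
    using p[OF that] by (simp add: q_def)
  have evF: "\<bar>ev (q t) (F $ n)\<bar> \<le> h n" if "t \<in> J" for t n
  proof -
    have "ennreal \<bar>ev (q t) (F $ n)\<bar> \<le> nm s (F $ n)"
      using q[OF that] rs by (intro order_trans[OF ev_le_nm[OF rs(1)] nm_mono]) auto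
    then show ?thesis by (simp add: h h0)
  qed
  have evd: "\<bar>ev (q t) (dv i (F $ n))\<bar> \<le> h n / (s - r)" if "t \<in> J" for t n i
  proof -
    have "ennreal \<bar>ev (q t) (dv i (F $ n))\<bar> \<le> ennreal (1 / (s - r)) * nm s (F $ n)"
      using q[OF that] rs by (intro order_trans[OF ev_le_nm[OF rs(1)] nm_dv]) auto
    then show ?thesis using rs h0 by (simp add: h ennreal_mult[symmetric])
  qed
  have pw: "\<bar>p t 0 ^ n\<bar> \<le> s ^ n" if "t \<in> J" for t n
    using p[OF that, of 0] rs by (simp add: power_abs power_mono)
  have npw: "\<bar>real n * p t 0 ^ (n - 1)\<bar> \<le> s ^ n / (s - r)" if "t \<in> J" for t n
  proof (cases n)
    case (Suc m)
    have "\<bar>real n * p t 0 ^ (n - 1)\<bar> = real (Suc m) * \<bar>p t 0\<bar> ^ m"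
      by (simp add: Suc abs_mult power_abs)
    also have "\<dots> \<le> real (Suc m) * r ^ m"
      using p[OF that] by (intro mult_left_mono power_mono) auto
    also have "\<dots> \<le> s ^ Suc m / (s - r)" by (rule of_nat_mult_power_le[OF rs])
    finally show ?thesis by (simp add: Suc)
  qed (use rs in auto)
  \<comment> \<open>Each of the \<open>N\<close> inner directions and the outer one contributes at
    most \<open>M / (s - r)\<close> times \<open>h n * s ^ n\<close>, hence the factor
    \<open>Suc N\<close>.\<close>
  have f'_bound: "\<bar>f' n t\<bar> \<le> (real (Suc N) * M / (s - r)) * (h n * s ^ n)" if "t \<in> J" for t n
  proof -
    have "\<bar>\<Sum>i<N. p' t (Suc i) * ev (q t) (dv i (F $ n))\<bar> \<le> (\<Sum>i<N. M * (h n / (s - r)))"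
      unfolding abs_mult using p'[OF that] evd[OF that] M0
      by (intro order_trans[OF sum_abs] sum_mono) (simp only: abs_mult, intro mult_mono, auto)
    then have "\<bar>(\<Sum>i<N. p' t (Suc i) * ev (q t) (dv i (F $ n))) * p t 0 ^ n\<bar>
        \<le> (\<Sum>i<N. M * (h n / (s - r))) * s ^ n"
      unfolding abs_mult using pw[OF that] M0 h0 rs
      by (intro mult_mono) (auto intro!: sum_nonneg)
    moreover have "\<bar>ev (q t) (F $ n) * (real n * p t 0 ^ (n - 1) * p' t 0)\<bar> \<le> h n * (s ^ n / (s - r) * M)"
      unfolding abs_mult[of "ev (q t) (F $ n)"] abs_mult[of "real n * p t 0 ^ (n - 1)"]
      using evF[OF that] npw[OF that] p'[OF that] M0 h0 rs
      by (intro mult_mono) auto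
    ultimately have "\<bar>f' n t\<bar> \<le> (\<Sum>i<N. M * (h n / (s - r))) * s ^ n + h n * (s ^ n / (s - r) * M)"
      unfolding f'_def by linarith
    also have "\<dots> = (real (Suc N) * M / (s - r)) * (h n * s ^ n)"
      by (simp add: divide_inverse algebra_simps)
    finally show ?thesis .
  qed
  have f_der: "(f n has_field_derivative f' n t) (at t within J)" if "t \<in> J" for t n
  proof -
    have "nm s (F $ n) < top" using h by simp
    then have "((\<lambda>t. ev (q t) (F $ n)) has_field_derivative
        (\<Sum>i<N. p' t (Suc i) * ev (q t) (dv i (F $ n)))) (at t within J)"
      unfolding N_def using rs J q p' der that
      by (intro ev_curve[of r s "F $ n" J q "\<lambda>t i. p' t (Suc i)" M]) (auto simp: q_def)
    then show ?thesis
      unfolding f_def f'_def by (auto intro!: derivative_eq_intros der[OF that])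
  qed
  have unif: "uniform_limit J (\<lambda>n t. \<Sum>i<n. f' i t) (\<lambda>t. suminf (\<lambda>i. f' i t)) sequentially"
    using f'_bound hs by (intro Weierstrass_m_test_ev[of _ _ "\<lambda>n. (real (Suc N) * M / (s - r)) * (h n * s ^ n)"])
      (auto intro: summable_mult)
  have sumf: "summable (\<lambda>n. f n t)" if "t \<in> J" for t
  proof -
    have "\<bar>p t i\<bar> \<le> s" for i using p[OF that, of i] rs by simp
    then show ?thesis
      using ev_fps_summable[OF s0 _ F, of "p t"] unfolding f_def q_def by (blast intro: summable_rabs_cancel)
  qed
  obtain g where g: "\<And>u. u \<in> J \<Longrightarrow> (\<lambda>n. f n u) sums g u"
      "\<And>u. u \<in> J \<Longrightarrow> (g has_field_derivative suminf (\<lambda>i. f' i u)) (at u within J)"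
    using has_field_derivative_series[OF J f_der unif t sumf[OF t]] by blast
  have ev_eq: "ev (p u) F = g u" if "u \<in> J" for u
    using g(1)[OF that] unfolding ev_fps_def f_def q_def by (simp add: sums_iff)
  have "((\<lambda>t. ev (p t) F) has_field_derivative suminf (\<lambda>i. f' i t)) (at t within J)"
    using g(2)[OF t] t by (rule has_field_derivative_transform_within[OF _ zero_less_one]) (simp_all add: ev_eq)
  moreover have "suminf (\<lambda>i. f' i t) = (\<Sum>i<nvars TYPE('a fps). p' t i * ev (p t) (dv i F))"
  proof -
    have d0: "(\<lambda>n. ev (q t) (F $ n) * (real n * p t 0 ^ (n - 1))) sums ev (p t) (dv 0 F)"
    proof -
      have "summable (\<lambda>n. ev (q t) (F $ n) * (real n * p t 0 ^ (n - 1)))"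
      proof (rule summable_comparison_test')
        show "summable (\<lambda>n. (1 / (s - r)) * (h n * s ^ n))" using hs by (rule summable_mult)
        show "norm (ev (q t) (F $ n) * (real n * p t 0 ^ (n - 1))) \<le> (1 / (s - r)) * (h n * s ^ n)" for n
          using mult_mono[OF evF[OF t, of n] npw[OF t, of n]] h0 by (simp add: abs_mult)
      qed
      then have "(\<lambda>n. ev (q t) (F $ n) * (real n * p t 0 ^ (n - 1))) sums
          (\<Sum>n. ev (q t) (F $ Suc n) * (real (Suc n) * p t 0 ^ n))"
        using suminf_split_head[of "\<lambda>n. ev (q t) (F $ n) * (real n * p t 0 ^ (n - 1))"]
        by (simp add: sums_iff del: of_nat_Suc)
      \<comment> \<open>The factor \<open>of_nat (Suc n)\<close> of \<open>fps_deriv\<close> lies in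
        the coefficient ring; written as \<open>cst\<close> it evaluates to the number
        itself.\<close>
      moreover have "ev (q t) (of_nat (Suc n) * F $ Suc n) = real (Suc n) * ev (q t) (F $ Suc n)" for n
      proof -
        have "ev (q t) (cst (real (Suc n)) * F $ Suc n) = ev (q t) (cst (real (Suc n)) :: 'a) * ev (q t) (F $ Suc n)"
        proof (rule ev_mult[OF s0])
          show "\<bar>q t i\<bar> \<le> s" for i using q[OF t, of i] rs by simp
        qed (simp_all add: h nm_cst)
        then show ?thesis by (simp only: ev_cst) (simp only: cst_of_nat)
      qed
      ultimately show ?thesis
        unfolding ev_fps_def dv_fps_def by (simp add: q_def mult_ac del: of_nat_Suc)
    qed
    have di: "(\<lambda>n. ev (q t) (dv i (F $ n)) * p t 0 ^ n) sums ev (p t) (dv (Suc i) F)" for i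
    proof -
      have "summable (\<lambda>n. ev (q t) (dv i (F $ n)) * p t 0 ^ n)"
      proof (rule summable_comparison_test')
        show "summable (\<lambda>n. (1 / (s - r)) * (h n * s ^ n))" using hs by (rule summable_mult)
        show "norm (ev (q t) (dv i (F $ n)) * p t 0 ^ n) \<le> (1 / (s - r)) * (h n * s ^ n)" for n
          using mult_mono[OF evd[OF t, of i n] pw[OF t, of n]] h0 rs by (simp add: abs_mult)
      qed
      then show ?thesis
        unfolding ev_fps_def dv_fps_def by (simp add: q_def summable_sums)
    qed
    have "(\<lambda>n. f' n t) sums ((\<Sum>i<N. p' t (Suc i) * ev (p t) (dv (Suc i) F)) + p' t 0 * ev (p t) (dv 0 F))"
    proof -
      have "f' n t = (\<Sum>i<N. p' t (Suc i) * (ev (q t) (dv i (F $ n)) * p t 0 ^ n))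
          + p' t 0 * (ev (q t) (F $ n) * (real n * p t 0 ^ (n - 1)))" for n
        unfolding f'_def sum_distrib_right by (simp only: mult_ac)
      then show ?thesis
        by (simp only:) (intro sums_add sums_sum sums_mult di d0)
    qed
    then show ?thesis
      by (simp add: sums_iff nvars_fps_def N_def sum.lessThan_Suc_shift add.commute del: sum.lessThan_Suc)
  qed
  ultimately show ?thesis by simp
qed

instance
proof
  fix c d r s \<rho> :: real and a b F G :: "'a fps" and v :: "nat \<Rightarrow> real" and i :: nat
    and f :: "nat \<Rightarrow> 'a fps"
  show "nm r (cst c :: 'a fps) = ennreal \<bar>c\<bar>"
  proof -
    have "(\<Sum>n. nm r ((cst c :: 'a fps) $ n) * ennreal r ^ n) = (\<Sum>n\<in>{0}. nm r ((cst c :: 'a fps) $ n) * ennreal r ^ n)"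
      by (rule suminf_finite) (auto simp: cst_fps_def nm_zero)
    then show ?thesis by (simp add: nm_fps_def nm2_def cst_fps_def nm_cst)
  qed
  \<comment> \<open>From degree 1 on, the power of the outer radius already gains
    \<open>r / s\<close>. The coefficient of degree 0 carries the constant term and is covered by
    the same law in the coefficient ring.\<close>
  show "nm r a \<le> ennreal (r / s) * nm s a" if r: "0 < r" "r \<le> s" and a0: "ev (\<lambda>_. 0) a = 0"
  proof -
    have s: "0 < s" using r by simp
    have "nm r (a $ n) * ennreal r ^ n \<le> ennreal (r / s) * (nm s (a $ n) * ennreal s ^ n)" for n
    proof (cases n)
      case 0
      then show ?thesis using nm_small[OF r, of "a $ 0"] a0 by (simp add: ev0_fps)
    next
      case (Suc m)
      have "r ^ Suc m \<le> r / s * s ^ Suc m"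
        using r s power_mono[of r s m] by (simp add: field_simps)
      then have "ennreal r ^ Suc m \<le> ennreal (r / s) * ennreal s ^ Suc m"
        using r s by (simp add: ennreal_power ennreal_mult[symmetric] ennreal_leI del: power_Suc)
      then have "nm r (a $ n) * ennreal r ^ n \<le> nm s (a $ n) * (ennreal (r / s) * ennreal s ^ n)"
        using nm_mono[OF r, of "a $ n"] Suc by (intro mult_mono) auto
      then show ?thesis by (simp only: mult_ac)
    qed
    then show ?thesis
      unfolding nm_fps_def nm2_def ennreal_suminf_cmult[symmetric] by (rule ennreal_suminf_mono)
  qed
  show "nm r (dv i a) \<le> ennreal (1 / (s - r)) * nm s a" if r: "0 < r" "r < s"
  proof (cases i)
    case 0
    have "nm r (fps_deriv a $ n) * ennreal r ^ n \<le> ennreal (1 / (s - r)) * (nm s (a $ Suc n) * ennreal s ^ Suc n)" for n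
    proof -
      have "nm r (fps_deriv a $ n) \<le> ennreal (real (Suc n)) * nm s (a $ Suc n)"
        using order_trans[OF nm_of_nat_mult[OF r(1), of "Suc n" "a $ Suc n"]
            mult_left_mono[OF nm_mono[of r s "a $ Suc n"]]] r
        by (simp del: of_nat_Suc)
      then have "nm r (fps_deriv a $ n) * ennreal r ^ n \<le> (ennreal (real (Suc n)) * nm s (a $ Suc n)) * ennreal r ^ n"
        by (rule mult_right_mono) simp
      also have "\<dots> = ennreal (real (Suc n) * r ^ n) * nm s (a $ Suc n)"
        using r by (simp add: ennreal_mult ennreal_power mult_ac del: of_nat_Suc)
      also have "\<dots> \<le> ennreal (s ^ Suc n / (s - r)) * nm s (a $ Suc n)"
        by (intro mult_right_mono ennreal_leI of_nat_mult_power_le r) auto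
      also have "ennreal (s ^ Suc n / (s - r)) = ennreal (1 / (s - r)) * ennreal s ^ Suc n"
        using r by (simp add: ennreal_mult[symmetric] ennreal_power del: power_Suc)
      finally show ?thesis by (simp only: mult_ac)
    qed
    then have "nm r (fps_deriv a) \<le> ennreal (1 / (s - r)) * (\<Sum>n. nm s (a $ Suc n) * ennreal s ^ Suc n)"
      unfolding nm_fps_def nm2_def ennreal_suminf_cmult[symmetric] by (rule ennreal_suminf_mono)
    also have "(\<Sum>n. nm s (a $ Suc n) * ennreal s ^ Suc n) \<le> nm s a"
      unfolding nm_fps_def nm2_def
      by (subst (2) suminf_offset[where i = 1]) (auto intro: summableI simp: add_increasing)
    finally show ?thesis using 0 by (simp add: dv_fps_def mult_left_mono)
  next
    case (Suc j)
    have "nm r (dv j (a $ n)) * ennreal r ^ n \<le> ennreal (1 / (s - r)) * (nm s (a $ n) * ennreal s ^ n)" for n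
      unfolding mult.assoc[symmetric] using r by (intro mult_mono nm_dv power_mono ennreal_leI) auto
    then show ?thesis
      unfolding Suc nm_fps_def nm2_def dv_fps_def ennreal_suminf_cmult[symmetric]
      by (simp del: ennreal_suminf_cmult add: ennreal_suminf_mono)
  qed
  show "ennreal \<bar>ev v a\<bar> \<le> nm r a" if r: "0 < r" and v: "\<And>i. \<bar>v i\<bar> \<le> r"
  proof (cases "nm r a < top")
    case True
    have sm: "summable (\<lambda>n. \<bar>ev (\<lambda>i. v (Suc i)) (a $ n) * v 0 ^ n\<bar>)"
      by (rule ev_fps_summable[OF r _ True]) (rule v)
    have "\<bar>ev v a\<bar> \<le> (\<Sum>n. \<bar>ev (\<lambda>i. v (Suc i)) (a $ n) * v 0 ^ n\<bar>)"
      unfolding ev_fps_def by (rule summable_rabs[OF sm])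
    then have "ennreal \<bar>ev v a\<bar> \<le> (\<Sum>n. ennreal \<bar>ev (\<lambda>i. v (Suc i)) (a $ n) * v 0 ^ n\<bar>)"
      using sm by (subst suminf_ennreal2) (auto intro: ennreal_leI)
    also have "\<dots> \<le> nm r a"
      unfolding nm_fps_def nm2_def by (intro ennreal_suminf_mono ev_fps_term_le r v)
    finally show ?thesis .
  qed (simp add: less_top[symmetric])
  show "ev v (cst c :: 'a fps) = c"
  proof -
    have "ev v (cst c :: 'a fps) = (\<Sum>n\<in>{0}. ev (\<lambda>i. v (Suc i)) ((cst c :: 'a fps) $ n) * v 0 ^ n)"
      unfolding ev_fps_def by (rule suminf_finite) (auto simp: cst_fps_def ev_0)
    then show ?thesis by (simp add: cst_fps_def ev_cst)
  qed
  show "ev v (a + b) = ev v a + ev v b"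
    if r: "0 < r" and v: "\<And>i. \<bar>v i\<bar> \<le> r" and fin: "nm r a < top" "nm r b < top"
  proof -
    have "ev (\<lambda>i. v (Suc i)) ((a + b) $ n) = ev (\<lambda>i. v (Suc i)) (a $ n) + ev (\<lambda>i. v (Suc i)) (b $ n)" for n
      unfolding fps_add_nth using v nm_fps_nth_finite[OF r fin(1)] nm_fps_nth_finite[OF r fin(2)]
      by (intro ev_add[OF r]) auto
    moreover have "summable (\<lambda>n. ev (\<lambda>i. v (Suc i)) (a $ n) * v 0 ^ n)"
        "summable (\<lambda>n. ev (\<lambda>i. v (Suc i)) (b $ n) * v 0 ^ n)"
      by (rule summable_rabs_cancel[OF ev_fps_summable[OF r _ fin(1)]], rule v,
          rule summable_rabs_cancel[OF ev_fps_summable[OF r _ fin(2)]], rule v)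
    ultimately show ?thesis
      by (simp add: ev_fps_def distrib_right suminf_add)
  qed
  show "ev v (a * b) = ev v a * ev v b"
    if r: "0 < r" and v: "\<And>i. \<bar>v i\<bar> \<le> r" and fin: "nm r a < top" "nm r b < top"
  proof -
    let ?w = "\<lambda>i. v (Suc i)"
    have coeff: "ev ?w ((a * b) $ n) * v 0 ^ n =
        (\<Sum>i\<le>n. (ev ?w (a $ i) * v 0 ^ i) * (ev ?w (b $ (n - i)) * v 0 ^ (n - i)))" for n
    proof -
      have "ev ?w ((a * b) $ n) = (\<Sum>i\<le>n. ev ?w (a $ i) * ev ?w (b $ (n - i)))"
        unfolding fps_mult_nth atLeast0AtMost
      proof (subst ev_sum[OF r])
        show "\<bar>v (Suc i)\<bar> \<le> r" for i by (rule v)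
        show "nm r (a $ i * b $ (n - i)) < top" for i
          by (intro nm_mult_finite r nm_fps_nth_finite fin)
        show "(\<Sum>i\<le>n. ev ?w (a $ i * b $ (n - i))) = (\<Sum>i\<le>n. ev ?w (a $ i) * ev ?w (b $ (n - i)))"
          by (intro sum.cong refl ev_mult[OF r] v nm_fps_nth_finite[OF r] fin)
      qed
      then have "ev ?w ((a * b) $ n) * v 0 ^ n = (\<Sum>i\<le>n. ev ?w (a $ i) * ev ?w (b $ (n - i)) * v 0 ^ n)"
        by (simp only: sum_distrib_right)
      also have "\<dots> = (\<Sum>i\<le>n. (ev ?w (a $ i) * v 0 ^ i) * (ev ?w (b $ (n - i)) * v 0 ^ (n - i)))"
      proof (rule sum.cong[OF refl])
        fix i assume "i \<in> {..n}"
        then have "v 0 ^ n = v 0 ^ i * v 0 ^ (n - i)"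
          by (simp add: power_add[symmetric])
        then show "ev ?w (a $ i) * ev ?w (b $ (n - i)) * v 0 ^ n =
            (ev ?w (a $ i) * v 0 ^ i) * (ev ?w (b $ (n - i)) * v 0 ^ (n - i))"
          by (simp only: mult_ac)
      qed
      finally show ?thesis .
    qed
    have "(\<lambda>n. \<Sum>i\<le>n. (ev ?w (a $ i) * v 0 ^ i) * (ev ?w (b $ (n - i)) * v 0 ^ (n - i))) sums (ev v a * ev v b)"
      unfolding ev_fps_def real_norm_def
      by (intro Cauchy_product_sums; unfold real_norm_def;
          (rule ev_fps_summable[OF r _ fin(1)] | rule ev_fps_summable[OF r _ fin(2)]); rule v)
    then show ?thesis unfolding ev_fps_def[of v "a * b"] coeff by (simp add: sums_iff)
  qed
  show "a = 0" if r: "0 < r" and fin: "nm r a < top" and z: "\<And>v. (\<And>i. \<bar>v i\<bar> \<le> r) \<Longrightarrow> ev v a = 0"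
  proof (rule fps_ext)
    fix n
    have "a $ n = 0"
    proof (rule ev_eq_0D[OF r])
      show "nm r (a $ n) < top" by (rule nm_fps_nth_finite[OF r fin])
      fix w :: "nat \<Rightarrow> real" assume w: "\<bar>w i\<bar> \<le> r" for i
      have "(\<lambda>n. ev w (a $ n) * x ^ n) sums 0" if x: "\<bar>x\<bar> \<le> r" for x
      proof -
        \<comment> \<open>\<open>case_nat x w\<close> puts the outer coordinate \<open>x\<close> in
          front of the inner coordinates \<open>w\<close>. For fixed \<open>w\<close> this leaves a
          one-variable series in \<open>x\<close> that vanishes identically.\<close>
        have b: "\<bar>case_nat x w i\<bar> \<le> r" for i using w x by (simp split: nat.split)
        have "summable (\<lambda>n. ev w (a $ n) * x ^ n)"
          using summable_rabs_cancel[OF ev_fps_summable[OF r _ fin, of "case_nat x w"]] b by simp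
        moreover have "(\<Sum>n. ev w (a $ n) * x ^ n) = 0"
          using z[of "case_nat x w"] b by (simp add: ev_fps_def)
        ultimately show ?thesis by (simp add: sums_iff)
      qed
      then show "ev w (a $ n) = 0" by (rule real_powser_eq_0D[OF r])
    qed
    then show "a $ n = 0 $ n" by simp
  qed
  show "dv i (a + b) = dv i a + dv i b"
    by (auto simp: dv_fps_def fps_eq_iff dv_add split: nat.split)
  show "dv i (a * b) = dv i a * b + a * dv i b"
  proof (cases i)
    case 0 then show ?thesis by (simp add: dv_fps_def mult_ac)
  next
    case (Suc j)
    have "dv j (sum g A) = (\<Sum>x\<in>A. dv j (g x))" for g :: "nat \<Rightarrow> 'a" and A
    proof -
      have "dv j (0::'a) = 0" using dv_add[of j "0::'a" 0] by (metis add.right_neutral add_left_cancel)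
      then show ?thesis
        by (induction A rule: infinite_finite_induct) (auto simp: dv_add)
    qed
    then show ?thesis
      by (simp add: Suc dv_fps_def fps_eq_iff fps_mult_nth dv_mult sum.distrib)
  qed
qed ((rule nm2_add[of r r for r, folded nm_fps_def] ev_fps_curve
      nm2_eq_0D[of r r for r, folded nm_fps_def] nm2_mult[of r r for r, folded nm_fps_def]
      nm2_mono[of r s r s for r s, folded nm_fps_def] nm2_complete[of r r for r, folded nm_fps_def]; assumption)
    | simp add: cst_fps_def cst_1 cst_add nm_fps_def nm2_zero nm2_minus ev0_fps ev0_add ev0_mult)+

end

section \<open>Neumann series and inverses\<close>

abbreviation ev0 :: "'a::analytic_coeff \<Rightarrow> real" where
  "ev0 a \<equiv> ev (\<lambda>_. 0) a"

text \<open>Both norms in use are instances of this locale, so that the Neumann-series argument below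
  serves for inverses as well as for Weierstrass division.\<close>

locale complete_norm =
  fixes N :: "'a::ab_group_add \<Rightarrow> ennreal"
  assumes N_zero: "N 0 = 0"
    and N_eq_0D: "N a = 0 \<Longrightarrow> a = 0"
    and N_add: "N (a + b) \<le> N a + N b"
    and N_minus: "N (- a) = N a"
    and N_complete: "(\<Sum>n. N (f n)) < top \<Longrightarrow> \<exists>s. \<forall>k. N (s - (\<Sum>n<k. f n)) \<le> (\<Sum>n. N (f (n + k)))"
begin

lemma fixpoint:
  assumes add: "\<And>a b. T (a - b) = T a - T b"
    and contr: "\<And>a. N (T a) \<le> ennreal (1 / 2) * N a"
    and fin: "N f < top"
  obtains F where "F = f + T F" "N F < top"
proof -
  have T0: "T 0 = 0" using add[of 0 0] by simp
  have T_add: "T (a + b) = T a + T b" for a b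
    using add[of "a + b" b] by simp
  have T_sum: "T (\<Sum>n<k. g n) = (\<Sum>n<k. T (g n))" for g and k :: nat
    by (induction k) (simp_all add: T0 T_add)
  define g where "g n = (T ^^ n) f" for n
  have g_le: "N (g n) \<le> ennreal ((1 / 2) ^ n) * N f" for n
  proof (induction n)
    case (Suc n)
    have "N (g (Suc n)) \<le> ennreal (1 / 2) * N (g n)" using contr[of "g n"] by (simp add: g_def)
    also have "\<dots> \<le> ennreal (1 / 2) * (ennreal ((1 / 2) ^ n) * N f)"
      using Suc by (rule mult_left_mono) simp
    also have "\<dots> = ennreal ((1 / 2) ^ Suc n) * N f"
      by (simp add: ennreal_mult[symmetric] mult.assoc[symmetric] del: ennreal_half)
    finally show ?case .
  qed (simp add: g_def)
  have gfin: "(\<Sum>n. N (g n)) < top"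
  proof -
    have "(\<Sum>n. N (g n)) \<le> (\<Sum>n. ennreal ((1 / 2) ^ n)) * N f"
      unfolding ennreal_suminf_multc[symmetric] by (rule ennreal_suminf_mono[OF g_le])
    also have "(\<Sum>n. ennreal ((1 / 2 :: real) ^ n)) = ennreal (\<Sum>n. (1 / 2) ^ n)"
      by (intro suminf_ennreal2) auto
    also have "ennreal (\<Sum>n. (1 / 2) ^ n) * N f < top"
      using fin by (simp add: ennreal_mult_less_top)
    finally show ?thesis .
  qed
  obtain F where F: "\<And>k. N (F - (\<Sum>n<k. g n)) \<le> (\<Sum>n. N (g (n + k)))"
    using N_complete[OF gfin] by blast
  define tail where "tail k = (\<Sum>n. N (g (n + k)))" for k
  \<comment> \<open>Each partial sum is \<open>f\<close> plus \<open>T\<close> of the preceding one,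
    so the defect of the limit is bounded by two consecutive tails, and these tend to zero.\<close>
  have bound: "N (F - (f + T F)) \<le> tail (Suc k) + tail k" for k
  proof -
    have "(\<Sum>n<Suc k. g n) = f + T (\<Sum>n<k. g n)"
      unfolding T_sum sum.lessThan_Suc_shift by (simp add: g_def)
    then have "F - (f + T F) = (F - (\<Sum>n<Suc k. g n)) + - T (F - (\<Sum>n<k. g n))"
      unfolding add by (simp add: algebra_simps)
    then have "N (F - (f + T F)) \<le> N (F - (\<Sum>n<Suc k. g n)) + N (T (F - (\<Sum>n<k. g n)))"
      using N_add[of "F - (\<Sum>n<Suc k. g n)" "- T (F - (\<Sum>n<k. g n))"] by (simp only: N_minus)
    also have "\<dots> \<le> tail (Suc k) + tail k"
    proof (rule add_mono)
      show "N (F - (\<Sum>n<Suc k. g n)) \<le> tail (Suc k)" unfolding tail_def by (rule F)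
      have "N (T (F - (\<Sum>n<k. g n))) \<le> 1 * N (F - (\<Sum>n<k. g n))"
        by (intro order_trans[OF contr] mult_right_mono) (auto simp del: ennreal_half)
      then show "N (T (F - (\<Sum>n<k. g n))) \<le> tail k"
        unfolding tail_def mult_1 using F by (rule order_trans)
    qed
    finally show ?thesis .
  qed
  have "tail \<longlonglongrightarrow> 0"
    unfolding tail_def by (rule ennreal_suminf_tail_tendsto_0[OF gfin])
  then have "(\<lambda>k. tail (Suc k) + tail k) \<longlonglongrightarrow> 0 + 0"
    by (intro tendsto_add LIMSEQ_Suc)
  then have "N (F - (f + T F)) \<le> 0 + 0"
    by (rule LIMSEQ_le_const) (use bound in blast)
  then have "F = f + T F"
    using N_eq_0D[of "F - (f + T F)"] by simp
  moreover have "N F < top"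
    using F[of 0] gfin by (auto simp: less_top intro: le_less_trans)
  ultimately show thesis using that by blast
qed

end

lemma complete_norm_nm: "0 < r \<Longrightarrow> complete_norm (nm r :: 'a::analytic_coeff \<Rightarrow> ennreal)"
  by unfold_locales (auto simp: nm_zero nm_add nm_minus intro: nm_eq_0D nm_complete)

lemma complete_norm_nm2: "0 < r \<Longrightarrow> 0 < \<rho> \<Longrightarrow> complete_norm (nm2 \<rho> r)"
  by unfold_locales (auto simp: nm2_zero nm2_add nm2_minus intro: nm2_eq_0D nm2_complete)

definition converges :: "'a::analytic_coeff \<Rightarrow> bool" where
  "converges a \<longleftrightarrow> (\<exists>r>0. nm r a < top)"

lemma convergesI: "0 < r \<Longrightarrow> nm r a < top \<Longrightarrow> converges a"
  by (auto simp: converges_def)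

lemma nm_finite_mono: "0 < r \<Longrightarrow> r \<le> s \<Longrightarrow> nm s a < top \<Longrightarrow> nm r a < top"
  by (rule le_less_trans[OF nm_mono])

lemma converges_common:
  assumes "finite A" "\<And>a. a \<in> A \<Longrightarrow> converges a"
  obtains r where "0 < r" "\<And>a. a \<in> A \<Longrightarrow> nm r a < top"
  using assms
proof (induction A arbitrary: thesis rule: finite_induct)
  case empty then show ?case using zero_less_one by blast
next
  case (insert a A)
  obtain r where r: "0 < r" "\<And>b. b \<in> A \<Longrightarrow> nm r b < top"
    using insert.IH insert.prems(2) by blast
  obtain s where s: "0 < s" "nm s a < top"
    using insert.prems(2) by (auto simp: converges_def)
  show ?case
  proof (rule insert.prems(1))
    show "0 < min r s" using r s by simp
    show "nm (min r s) b < top" if "b \<in> insert a A" for b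
    proof (cases "b = a")
      case True
      show ?thesis unfolding True using r(1) s by (intro nm_finite_mono[OF _ _ s(2)]) auto
    next
      case False
      then have "b \<in> A" using that by simp
      then show ?thesis using r s(1) by (intro nm_finite_mono[OF _ _ r(2)]) auto
    qed
  qed
qed

lemma converges_common2:
  fixes a b :: "'a::analytic_coeff"
  assumes "converges a" "converges b"
  obtains r where "0 < r" "nm r a < top" "nm r b < top"
proof (rule converges_common[of "{a, b}"])
  show "converges x" if "x \<in> {a, b}" for x using that assms by auto
qed (use that in auto)

lemma converges_mult: "converges a \<Longrightarrow> converges b \<Longrightarrow> converges (a * b)"
  by (erule (1) converges_common2) (rule convergesI, assumption, rule nm_mult_finite)

lemma converges_add: "converges a \<Longrightarrow> converges b \<Longrightarrow> converges (a + b)"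
  by (erule (1) converges_common2)
     (rule convergesI, assumption, rule le_less_trans[OF nm_add], simp add: less_top)

lemma converges_minus: "converges (- a) \<longleftrightarrow> converges a"
  by (simp add: converges_def nm_minus)

lemma converges_cst: "converges (cst c)"
  by (rule convergesI[of 1]) (auto simp: nm_cst)

lemma converges_nth: "converges F \<Longrightarrow> converges (F $ n)"
  unfolding converges_def using nm_fps_nth_finite by blast

lemma converges_dv:
  assumes "converges a" shows "converges (dv i a)"
proof -
  obtain s where s: "0 < s" "nm s a < top" using assms by (auto simp: converges_def)
  have "nm (s / 2) (dv i a) \<le> ennreal (1 / (s - s / 2)) * nm s a"
    using s by (intro nm_dv) auto
  also have "\<dots> < top" using s by (simp add: ennreal_mult_less_top)
  finally show ?thesis using s by (intro convergesI[of "s / 2"]) auto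
qed

text \<open>Scaling by the constant term turns \<open>a\<close> into \<open>1 - e\<close> with
  \<open>ev0 e = 0\<close>. On a small polydisc \<open>e\<close> has norm at most 1/2, and the
  inverse is the geometric series in \<open>e\<close>, found as the solution of
  \<open>y = 1 + e * y\<close>.\<close>

lemma convergent_inverse:
  fixes a :: "'a::analytic_coeff"
  assumes conv: "converges a" and nz: "ev0 a \<noteq> 0"
  obtains b where "a * b = 1" "converges b"
proof -
  define c where "c = ev0 a"
  define e where "e = 1 - cst (1 / c) * a"
  have c0: "c \<noteq> 0" using nz by (simp add: c_def)
  have "ev0 (- (cst (1 / c) * a)) = - 1"
    using ev0_add[of "cst (1 / c) * a" "- (cst (1 / c) * a)"] c0
    by (simp add: ev0_mult ev_cst ev_0 c_def)
  then have e0: "ev0 e = 0"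
    using ev0_add[of 1 "- (cst (1 / c) * a)"] by (simp add: e_def ev_1)
  obtain s where s: "0 < s" "nm s a < top" using conv by (auto simp: converges_def)
  have "nm s e < top"
  proof -
    have "nm s (1::'a) < top" using nm_cst[of s 1, where ?'a = 'a] by (simp add: cst_1)
    then show ?thesis
      unfolding e_def using s by (intro le_less_trans[OF nm_diff]) (use nm_mult_finite[OF s(1), of "cst (1 / c)" a] s(2) in \<open>auto simp: less_top nm_cst\<close>)
  qed
  then have K: "nm s e = ennreal (enn2real (nm s e))" "0 \<le> enn2real (nm s e)"
    by simp_all
  define K where "K = enn2real (nm s e)"
  note K = K[folded K_def]
  \<comment> \<open>By \<open>nm_small\<close> the norm of \<open>e\<close> at radius
    \<open>r\<close> is at most \<open>r / s * K\<close>, which this choice makes at most 1/2;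
    \<open>K + 1\<close> avoids a zero denominator.\<close>
  define r where "r = min s (s / (2 * (K + 1)))"
  have r: "0 < r" "r \<le> s" using s K by (auto simp: r_def)
  have "r * K \<le> s / 2"
  proof -
    have "r * K \<le> (s / (2 * (K + 1))) * K"
      using K by (intro mult_right_mono) (auto simp: r_def)
    also have "\<dots> \<le> s / 2" using s K by (simp add: field_simps)
    finally show ?thesis .
  qed
  then have "r / s * K \<le> 1 / 2" using s by (simp add: field_simps)
  have small: "nm r e \<le> ennreal (1 / 2)"
  proof -
    have "nm r e \<le> ennreal (r / s * K)"
      using nm_small[OF r e0] K r s by (subst ennreal_mult) auto
    also have "\<dots> \<le> ennreal (1 / 2)" using \<open>r / s * K \<le> 1 / 2\<close> by (rule ennreal_leI)
    finally show ?thesis .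
  qed
  interpret complete_norm "nm r :: 'a \<Rightarrow> ennreal" by (rule complete_norm_nm[OF r(1)])
  have 1: "e * (x - y) = e * x - e * y" for x y by (simp add: algebra_simps)
  have 2: "nm r (e * x) \<le> ennreal (1 / 2) * nm r x" for x
    by (rule order_trans[OF nm_mult[OF r(1)] mult_right_mono[OF small]]) simp
  have 3: "nm r (cst 1 :: 'a) < top" by (simp add: nm_cst)
  obtain y where y: "y = cst 1 + e * y" "nm r y < top"
    using fixpoint[OF 1 2 3] by blast
  then have "a * (cst (1 / c) * y) = 1"
    by (simp add: e_def cst_1 algebra_simps)
  moreover have "converges (cst (1 / c) * y)"
    using convergesI[OF r(1) y(2)] by (intro converges_mult converges_cst)
  ultimately show thesis using that by blast
qed

section \<open>Weierstrass division\<close>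

lemma nm2_shift_le: "nm2 \<rho> r (fps_shift m F) * ennreal \<rho> ^ m \<le> nm2 \<rho> r F"
proof -
  have "nm2 \<rho> r (fps_shift m F) * ennreal \<rho> ^ m = (\<Sum>n. nm r (F $ (n + m)) * ennreal \<rho> ^ (n + m))"
    unfolding nm2_def ennreal_suminf_multc[symmetric] by (simp add: power_add mult_ac)
  also have "\<dots> \<le> nm2 \<rho> r F"
    unfolding nm2_def by (subst (2) suminf_offset[where i = m]) (auto intro: summableI simp: add_increasing)
  finally show ?thesis .
qed

lemma convergent_fps_shift:
  assumes "converges F" shows "converges (fps_shift m F)"
proof -
  obtain r where r: "0 < r" "nm r F < top" using assms by (auto simp: converges_def)
  have "nm r (fps_shift m F) * ennreal r ^ m < top"
    using nm2_shift_le[of r r m F] r(2) by (auto simp: nm_fps_def intro: le_less_trans)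
  then have "nm r (fps_shift m F) \<noteq> top"
    using r(1) by (auto simp: ennreal_top_mult ennreal_power)
  then show ?thesis using r(1) by (intro convergesI[of r]) (auto simp: less_top)
qed

lemma convergent_fps_finite:
  assumes "\<And>n. converges (F $ n)" "\<And>n. n \<ge> m \<Longrightarrow> F $ n = 0"
  shows "converges F"
proof -
  obtain r where r: "0 < r" "\<And>a. a \<in> (\<lambda>n. F $ n) ` {..<m} \<Longrightarrow> nm r a < top"
    using converges_common[of "(\<lambda>n. F $ n) ` {..<m}"] assms(1) by blast
  have "nm r F = (\<Sum>n\<in>{..<m}. nm r (F $ n) * ennreal r ^ n)"
    unfolding nm_fps_def nm2_def by (rule suminf_finite) (auto simp: assms(2) nm_zero)
  also have "\<dots> < top"
    using r by (auto simp: ennreal_mult_less_top ennreal_power)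
  finally show ?thesis using r(1) by (rule convergesI[rotated])
qed

lemma convergent_fps_cutoff: "converges F \<Longrightarrow> converges (fps_cutoff m F)"
  by (rule convergent_fps_finite[of _ m])
     (auto simp: converges_nth converges_cst[of 0, unfolded cst_0])

text \<open>Only the inner radius shrinks. The outer powers agree on both sides, so the gain
  \<open>r / s\<close> has to come from each coefficient separately, which is why every coefficient
  must lack a constant term.\<close>

lemma nm2_small:
  assumes "0 < r" "r \<le> s" "\<And>n. ev0 (F $ n) = 0"
  shows "nm2 \<rho> r F \<le> ennreal (r / s) * nm2 \<rho> s F"
  unfolding nm2_def ennreal_suminf_cmult[symmetric] mult.assoc[symmetric]
  using assms by (intro ennreal_suminf_mono mult_right_mono nm_small) auto

text \<open>\<open>G\<close> is \<open>fps_X ^ m\<close> times a unit plus the terms below degree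
  \<open>m\<close>. Multiplied by the inverse of the unit it becomes a perturbation of
  \<open>fps_X ^ m\<close>, small wherever the inner variables are small.\<close>

lemma regular_normal_form:
  fixes G :: "'a::analytic_coeff fps"
  assumes conv: "converges G" and low: "\<And>i. i < m \<Longrightarrow> ev0 (G $ i) = 0"
    and nz: "ev0 (G $ m) \<noteq> 0"
  obtains u b e where "u * b = 1" "converges u" "converges b" "converges e"
    "G * b = fps_X ^ m + e" "\<And>n. ev0 (e $ n) = 0"
proof -
  define u where "u = fps_shift m G"
  have u: "converges u" unfolding u_def by (rule convergent_fps_shift[OF conv])
  moreover have "ev0 u \<noteq> 0" using nz by (simp add: ev0_fps u_def)
  ultimately obtain b where b: "u * b = 1" "converges b"
    using convergent_inverse by blast
  define e where "e = fps_cutoff m G * b"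
  have "G = u * fps_X ^ m + fps_cutoff m G"
    unfolding u_def by (simp add: fps_shift_cutoff)
  then have "G * b = (u * fps_X ^ m + fps_cutoff m G) * b" by simp
  also have "\<dots> = (u * b) * fps_X ^ m + e" by (simp add: e_def algebra_simps)
  finally have "G * b = fps_X ^ m + e" using b by simp
  moreover have "ev0 (e $ n) = 0" for n
    by (auto simp: e_def fps_mult_nth ev0_sum ev0_mult low ev_0 intro!: sum.neutral)
  moreover have "converges e"
    unfolding e_def by (intro converges_mult convergent_fps_cutoff conv b)
  ultimately show thesis using that u b by blast
qed

text \<open>Dividing by \<open>fps_X ^ m\<close> can enlarge the norm by the inverse of
  \<open>s ^ m\<close>, see \<open>nm2_shift_le\<close>. A contraction thus requires
  \<open>e\<close> to be at most half of \<open>s ^ m\<close>, which is reached by shrinking the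
  inner radius alone.\<close>

lemma small_inner_radius:
  fixes e F :: "'a::analytic_coeff fps"
  assumes "converges e" "\<And>n. ev0 (e $ n) = 0" "converges F"
  obtains s r where "0 < r" "r \<le> s" "nm2 s r F < top" "nm2 s r e \<le> ennreal (1 / 2) * ennreal s ^ m"
proof -
  obtain s where s: "0 < s" "nm s e < top" "nm s F < top"
    using converges_common2[OF assms(1,3)] .
  define K where "K = enn2real (nm s e)"
  have K: "nm s e = ennreal K" "0 \<le> K" using s by (simp_all add: K_def)
  \<comment> \<open>One power of \<open>s\<close> cancels the denominator in
    \<open>r / s * K\<close>; the other \<open>m\<close> powers make up the target
    \<open>s ^ m\<close>.\<close>
  define r where "r = min s (s ^ Suc m / (2 * (K + 1)))"
  have r: "0 < r" "r \<le> s" using s K by (auto simp: r_def)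
  have "r * K \<le> (s ^ Suc m / (2 * (K + 1))) * K"
    using K by (intro mult_right_mono) (auto simp: r_def)
  also have "\<dots> \<le> s ^ Suc m / 2" using s K by (simp add: field_simps)
  finally have rK: "r / s * K \<le> 1 / 2 * s ^ m" using s by (simp add: field_simps)
  have "nm2 s r e \<le> ennreal (r / s * K)"
    using nm2_small[OF r assms(2), of s] K r s by (subst ennreal_mult) (auto simp: nm_fps_def)
  also have "\<dots> \<le> ennreal (1 / 2 * s ^ m)" using rK by (rule ennreal_leI)
  also have "\<dots> = ennreal (1 / 2) * ennreal s ^ m" using s by (subst ennreal_mult) (auto simp: ennreal_power)
  finally have "nm2 s r e \<le> ennreal (1 / 2) * ennreal s ^ m" .
  moreover have "nm2 s r F < top"
    using nm2_mono[of r s s s F] r s by (auto simp: nm_fps_def intro: le_less_trans)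
  ultimately show thesis using that r by blast
qed

text \<open>Division by \<open>fps_X ^ m\<close> itself is \<open>fps_shift\<close> with remainder
  \<open>fps_cutoff\<close>. For \<open>fps_X ^ m + e\<close> one solves
  \<open>H = F - e * fps_shift m H\<close>; then
  \<open>F = fps_shift m H * (fps_X ^ m + e) + fps_cutoff m H\<close>, and
  \<open>fps_X ^ m + e\<close> is \<open>G * b\<close>.\<close>

lemma weierstrass_division_fps:
  fixes F G :: "'a::analytic_coeff fps"
  assumes G: "converges G" "\<And>i. i < m \<Longrightarrow> ev0 (G $ i) = 0" "ev0 (G $ m) \<noteq> 0"
    and F: "converges F"
  obtains Q R where "F = Q * G + R" "converges Q" "converges R" "\<And>n. n \<ge> m \<Longrightarrow> R $ n = 0"
proof -
  obtain u b e where ube: "u * b = 1" "converges u" "converges b" "converges e"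
    "G * b = fps_X ^ m + e" "\<And>n. ev0 (e $ n) = 0"
    using regular_normal_form[OF G] by blast
  obtain s r where sr: "0 < r" "r \<le> s" "nm2 s r F < top" "nm2 s r e \<le> ennreal (1 / 2) * ennreal s ^ m"
    using small_inner_radius[OF ube(4) ube(6) F] .
  have s: "0 < s" using sr by simp
  define T where "T a = - (e * fps_shift m a)" for a
  interpret complete_norm "nm2 s r :: 'a fps \<Rightarrow> ennreal"
    by (rule complete_norm_nm2[OF sr(1) s])
  have T_diff: "T (a - c) = T a - T c" for a c
    unfolding T_def by (simp add: fps_shift_diff algebra_simps)
  have contr: "nm2 s r (T a) \<le> ennreal (1 / 2) * nm2 s r a" for a
  proof -
    have "nm2 s r (T a) \<le> nm2 s r e * nm2 s r (fps_shift m a)"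
      unfolding T_def N_minus by (rule nm2_mult[OF sr(1)])
    also have "\<dots> \<le> (ennreal (1 / 2) * ennreal s ^ m) * nm2 s r (fps_shift m a)"
      by (intro mult_right_mono sr) simp
    also have "\<dots> = ennreal (1 / 2) * (nm2 s r (fps_shift m a) * ennreal s ^ m)"
      by (simp only: mult_ac)
    also have "\<dots> \<le> ennreal (1 / 2) * nm2 s r a"
      by (intro mult_left_mono nm2_shift_le) simp
    finally show ?thesis .
  qed
  obtain H where H: "H = F + T H" "nm2 s r H < top"
    using fixpoint[OF T_diff contr sr(3)] .
  have Hc: "converges H"
  proof (rule convergesI[OF sr(1)])
    have "nm r H \<le> nm2 s r H" unfolding nm_fps_def using sr by (intro nm2_mono) auto
    then show "nm r H < top" using H(2) by (rule le_less_trans)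
  qed
  have "F = H - T H" using H(1) by (simp add: eq_diff_eq)
  also have "\<dots> = H + e * fps_shift m H" by (simp add: T_def)
  also have "\<dots> = (fps_shift m H * fps_X ^ m + fps_cutoff m H) + e * fps_shift m H"
    by (simp add: fps_shift_cutoff)
  also have "\<dots> = fps_shift m H * (G * b) + fps_cutoff m H" unfolding ube(5) by (simp add: algebra_simps)
  finally have "F = (fps_shift m H * b) * G + fps_cutoff m H" by (simp add: mult_ac)
  then show thesis
    by (rule that) (auto intro!: converges_mult convergent_fps_shift convergent_fps_cutoff Hc ube)
qed

text \<open>For \<open>P = Q * u\<close> the hypothesis on the coefficients reads
  \<open>P = - fps_shift m (P * e)\<close>. On a thin polydisc the right side has at most half the
  norm of \<open>P\<close>; that norm is finite, hence zero.\<close>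

lemma weierstrass_division_fps_unique:
  fixes G Q :: "'a::analytic_coeff fps"
  assumes G: "converges G" "\<And>i. i < m \<Longrightarrow> ev0 (G $ i) = 0" "ev0 (G $ m) \<noteq> 0"
    and Q: "converges Q" "\<And>n. n \<ge> m \<Longrightarrow> (Q * G) $ n = 0"
  shows "Q = 0"
proof -
  obtain u b e where ube: "u * b = 1" "converges u" "converges b" "converges e"
    "G * b = fps_X ^ m + e" "\<And>n. ev0 (e $ n) = 0"
    using regular_normal_form[OF G] by blast
  define P where "P = Q * u"
  have P: "converges P" unfolding P_def by (intro converges_mult Q ube)
  have Q_eq: "Q = P * b" unfolding P_def using ube(1) by (simp add: mult.assoc)
  obtain s r where sr: "0 < r" "r \<le> s" "nm2 s r P < top" "nm2 s r e \<le> ennreal (1 / 2) * ennreal s ^ m"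
    using small_inner_radius[OF ube(4) ube(6) P] .
  have s: "0 < s" using sr by simp
  have QG: "Q * G = P * fps_X ^ m + P * e"
    unfolding Q_eq by (simp add: mult.assoc mult.commute[of b] ube(5) distrib_left)
  have "P $ n = - (fps_shift m (P * e)) $ n" for n
    using Q(2)[of "n + m"] unfolding QG by (simp add: fps_X_power_mult_right_nth eq_neg_iff_add_eq_0)
  then have "P = - fps_shift m (P * e)" by (simp add: fps_eq_iff)
  then have "nm2 s r P = nm2 s r (fps_shift m (P * e))" by (metis nm2_minus)
  then have "nm2 s r P * ennreal s ^ m \<le> nm2 s r (P * e)" by (simp add: nm2_shift_le)
  also have "\<dots> \<le> nm2 s r P * nm2 s r e" by (rule nm2_mult[OF sr(1)])
  also have "\<dots> \<le> nm2 s r P * (ennreal (1 / 2) * ennreal s ^ m)" by (intro mult_left_mono sr) simp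
  finally have le: "nm2 s r P * ennreal s ^ m \<le> nm2 s r P * (ennreal (1 / 2) * ennreal s ^ m)" .
  define x where "x = enn2real (nm2 s r P)"
  have x: "nm2 s r P = ennreal x" "0 \<le> x" using sr(3) by (simp_all add: x_def)
  have "ennreal (x * s ^ m) \<le> ennreal (x * (1 / 2 * s ^ m))"
    using le x s by (simp add: ennreal_power ennreal_mult[symmetric] mult_ac del: ennreal_half times_divide_eq_right times_divide_eq_left)
  then have "x * s ^ m \<le> x * (1 / 2 * s ^ m)"
    using x s by (subst (asm) ennreal_le_iff) auto
  then have "x * s ^ m \<le> 0" by simp
  then have "x \<le> 0" using zero_less_power[OF s, of m] by (simp add: mult_le_0_iff)
  then have "nm2 s r P = 0" using x by simp
  then have "P = 0" using nm2_eq_0D[OF s sr(1)] by blast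
  then show ?thesis using Q_eq by simp
qed

section \<open>Germs\<close>

text \<open>A germ over \<open>'a fps\<close> has one radius for all its coefficients together.
  Formal power series over \<open>'a germ\<close> would instead allow these radii to shrink to
  zero.\<close>

typedef (overloaded) 'a germ = "{a :: 'a::analytic_coeff. converges a}"
  morphisms series Germ
  using converges_cst by blast

setup_lifting type_definition_germ

instantiation germ :: (analytic_coeff) idom
begin

lift_definition zero_germ :: "'a germ" is 0
  using converges_cst[of 0] by (simp add: cst_0)
lift_definition one_germ :: "'a germ" is 1
  using converges_cst[of 1] by (simp add: cst_1)
lift_definition plus_germ :: "'a germ \<Rightarrow> 'a germ \<Rightarrow> 'a germ" is "(+)"
  by (rule converges_add)
lift_definition times_germ :: "'a germ \<Rightarrow> 'a germ \<Rightarrow> 'a germ" is "(*)"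
  by (rule converges_mult)
lift_definition uminus_germ :: "'a germ \<Rightarrow> 'a germ" is uminus
  by (simp add: converges_minus)
lift_definition minus_germ :: "'a germ \<Rightarrow> 'a germ \<Rightarrow> 'a germ" is "(-)"
  using converges_add converges_minus by (metis diff_conv_add_uminus)

instance
  by (standard; transfer) (auto simp: algebra_simps)

end

lemma series_sum: "series (sum f A) = (\<Sum>x\<in>A. series (f x))"
  by (induction A rule: infinite_finite_induct) (simp_all add: zero_germ.rep_eq plus_germ.rep_eq)

lemma convergent_series: "converges (series a)"
  using series[of a] by simp

abbreviation const_term :: "'a::analytic_coeff germ \<Rightarrow> real" where
  "const_term a \<equiv> ev0 (series a)"

lemma germ_dvd_1_iff: "(a :: 'a::analytic_coeff germ) dvd 1 \<longleftrightarrow> const_term a \<noteq> 0"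
proof
  assume "a dvd 1"
  then obtain b where "1 = a * b" by (rule dvdE)
  then have "const_term a * const_term b = 1"
    by (metis ev0_mult ev_1 one_germ.rep_eq times_germ.rep_eq)
  then show "const_term a \<noteq> 0" by auto
next
  assume "const_term a \<noteq> 0"
  then obtain b where b: "series a * b = 1" "converges b"
    using convergent_inverse[OF convergent_series] by blast
  then have "a * Germ b = 1"
    by (metis (mono_tags, lifting) Germ_inverse mem_Collect_eq one_germ.rep_eq series_inject times_germ.rep_eq)
  then show "a dvd 1" by (metis dvdI)
qed

section \<open>Prime factorization of monic polynomials\<close>

text \<open>The factors are prime and not merely irreducible, so a factorization is automatically
  unique up to order and units. Over an integral domain, \<open>prime_product\<close> for all
  nonzero elements is therefore factoriality.\<close>

inductive prime_product :: "'a::comm_semiring_1 \<Rightarrow> bool" where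
  unit: "u dvd 1 \<Longrightarrow> prime_product u"
| step: "prime_elem p \<Longrightarrow> prime_product a \<Longrightarrow> prime_product (p * a)"

lemma prime_product_unit_mult: "prime_product a \<Longrightarrow> u dvd 1 \<Longrightarrow> prime_product (u * a)"
proof (induction rule: prime_product.induct)
  case (unit v)
  then show ?case using mult_dvd_mono[of u 1 v 1] by (auto intro: prime_product.unit)
next
  case (step p a)
  then show ?case using prime_product.step[of p "u * a"] by (simp add: mult_ac)
qed

lemma prime_product_prod_list:
  "(\<And>p. p \<in> set ps \<Longrightarrow> prime_elem p) \<Longrightarrow> prime_product (prod_list ps)"
  by (induction ps) (auto intro: prime_product.intros)

lemma smult_cancel_left:
  fixes f :: "'b::idom poly"
  shows "smult c f = smult c g \<Longrightarrow> c \<noteq> 0 \<Longrightarrow> f = g"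
  using smult_eq_0_iff[of c "f - g"] by (simp add: smult_diff_right)

text \<open>A prime constant stays prime among the polynomials and cannot divide the monic
  \<open>f\<close>. It therefore divides the cofactor and cancels; the prime factors of
  \<open>c\<close> go one at a time.\<close>

lemma smult_prime_product_dvd:
  fixes f :: "'b::idom poly"
  assumes "prime_product c" "f dvd smult c h" "lead_coeff f = 1"
  shows "f dvd h"
  using assms(1,2)
proof (induction rule: prime_product.induct)
  case (unit u)
  then obtain v where v: "1 = u * v" by (elim dvdE)
  have "f dvd smult v (smult u h)" using unit.prems by (rule dvd_smult)
  then show ?case using v by (simp add: mult.commute)
next
  case (step p a)
  have p: "prime_elem [:p:]" using step.hyps(1) by (rule lift_prime_elem_poly)
  have "\<not> p dvd lead_coeff f"
    using assms(3) step.hyps(1) by (simp add: prime_elem_def)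
  then have "\<not> [:p:] dvd f" unfolding const_poly_dvd_iff by blast
  obtain q where q: "smult (p * a) h = f * q" using step.prems by (rule dvdE)
  have "f * q = [:p:] * smult a h" using q by (simp add: mult.commute)
  then have "[:p:] dvd f * q" by (rule dvdI)
  with p \<open>\<not> [:p:] dvd f\<close> have "[:p:] dvd q" by (simp add: prime_elem_dvd_mult_iff)
  then obtain q' where q': "q = [:p:] * q'" by (rule dvdE)
  have "smult p (smult a h) = smult p (f * q')" using q q' by simp
  moreover have "p \<noteq> 0" using step.hyps(1) by auto
  ultimately have "smult a h = f * q'" by (rule smult_cancel_left)
  then show ?case by (intro step.IH) simp
qed

text \<open>Each prime factor of \<open>c\<close> divides \<open>q\<close> or \<open>d\<close> and
  is cancelled there; \<open>e\<close> collects what is taken from \<open>d\<close>, and a unit goes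
  into \<open>q'\<close>. This does the work of passing to primitive parts.\<close>

lemma smult_prime_product_eq_mult:
  fixes f :: "'b::idom poly"
  assumes "prime_product c" "smult c f = q * d"
  shows "\<exists>e q' d'. f = q' * d' \<and> d = smult e d'"
  using assms
proof (induction arbitrary: q d rule: prime_product.induct)
  case (unit u)
  then obtain v where "1 = u * v" by (elim dvdE)
  have "f = smult v (smult u f)" using \<open>1 = u * v\<close> by (simp add: mult.commute)
  also have "\<dots> = smult v q * d" using unit.prems by simp
  finally have "f = smult v q * d" .
  then show ?case by (intro exI[of _ 1] exI[of _ "smult v q"] exI[of _ d]) simp
next
  case (step p a)
  have p: "prime_elem [:p:]" using step.hyps(1) by (rule lift_prime_elem_poly)
  have p0: "p \<noteq> 0" using step.hyps(1) by auto
  have "q * d = [:p:] * smult a f" using step.prems by (simp add: mult.commute)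
  then have "[:p:] dvd q * d" by (rule dvdI)
  with p have "[:p:] dvd q \<or> [:p:] dvd d" by (simp add: prime_elem_dvd_mult_iff)
  then show ?case
  proof
    assume "[:p:] dvd q"
    then obtain q1 where q1: "q = [:p:] * q1" by (rule dvdE)
    have "smult p (smult a f) = smult p (q1 * d)" using step.prems q1 by simp
    then have "smult a f = q1 * d" using p0 by (rule smult_cancel_left)
    then show ?case by (rule step.IH)
  next
    assume "[:p:] dvd d"
    then obtain d1 where d1: "d = [:p:] * d1" by (rule dvdE)
    have "smult p (smult a f) = smult p (q * d1)" using step.prems d1 by simp
    then have "smult a f = q * d1" using p0 by (rule smult_cancel_left)
    then obtain e q' d' where "f = q' * d'" "d1 = smult e d'" using step.IH by blast
    moreover from this d1 have "d = smult (p * e) d'" by (simp add: mult.commute)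
    ultimately show ?case by blast
  qed
qed

text \<open>Gauss's lemma without a fraction field: pseudo-division by an element \<open>d\<close> of least degree in
  the ideal generated by \<open>f\<close> and \<open>g\<close> replaces the Euclidean algorithm.\<close>

lemma monic_irreducible_imp_prime_elem:
  fixes f :: "'b::idom poly"
  assumes fact: "\<And>b::'b. b \<noteq> 0 \<Longrightarrow> prime_product b"
    and irr: "irreducible f" and monic: "lead_coeff f = 1"
  shows "prime_elem f"
proof (rule prime_elemI)
  show "f \<noteq> 0" "\<not> f dvd 1" using irr by (auto simp: irreducible_def)
  fix g h assume fgh: "f dvd g * h"
  show "f dvd g \<or> f dvd h"
  proof (rule disjCI)
    assume "\<not> f dvd h"
    define J where "J = {d. d \<noteq> 0 \<and> (\<exists>a b. d = a * f + b * g)}"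
    have "f \<in> J" using \<open>f \<noteq> 0\<close> unfolding J_def mem_Collect_eq by (intro conjI exI[of _ 1] exI[of _ 0]) simp_all
    then obtain d where d: "d \<in> J" and d_min: "\<And>d'. d' \<in> J \<Longrightarrow> degree d \<le> degree d'"
      using arg_min_nat_lemma[of "\<lambda>d. d \<in> J" f degree] by blast
    then obtain a b where d0: "d \<noteq> 0" and ab: "d = a * f + b * g" unfolding J_def by blast
    \<comment> \<open>The remainder of pseudo-division by \<open>d\<close> again lies in the ideal,
      and a nonzero one would have smaller degree than \<open>d\<close>. The price is the constant
      \<open>c\<close>, a power of the leading coefficient of \<open>d\<close>.\<close>
    have multiple: "\<exists>c q. c \<noteq> 0 \<and> smult c k = q * d" if k: "k = a' * f + b' * g" for k a' b'
    proof -
      obtain q r where qr: "pseudo_divmod k d = (q, r)" by force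
      define c where "c = lead_coeff d ^ (Suc (degree k) - degree d)"
      have c: "smult c k = d * q + r" "r = 0 \<or> degree r < degree d"
        using pseudo_divmod[OF d0 qr] by (auto simp: c_def)
      have "r = ([:c:] * a' - q * a) * f + ([:c:] * b' - q * b) * g"
      proof -
        have "r = [:c:] * k - d * q" using c(1) by simp
        then show ?thesis unfolding ab k by (simp only: algebra_simps)
      qed
      then have "r \<noteq> 0 \<Longrightarrow> r \<in> J" unfolding J_def by blast
      then have "r = 0" using c(2) d_min[of r] by (cases "r = 0") auto
      moreover have "c \<noteq> 0" using d0 by (simp add: c_def)
      ultimately show ?thesis using c(1) by (auto simp: mult.commute)
    qed
    obtain c q where cq: "c \<noteq> 0" "smult c f = q * d"
      using multiple[of f 1 0] by auto
    obtain e q' d' where e: "f = q' * d'" "d = smult e d'"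
      using smult_prime_product_eq_mult[OF fact[OF cq(1)] cq(2)] by blast
    \<comment> \<open>If \<open>q'\<close> is a unit, \<open>f\<close> divides \<open>d\<close> and
      so a constant multiple of \<open>g\<close>. If \<open>d'\<close> is a unit, \<open>d\<close>
      is the constant \<open>e\<close> up to a unit, and \<open>e\<close> times \<open>h\<close>
      lies in the ideal generated by \<open>f\<close> and \<open>g * h\<close>. Either constant can
      be removed because \<open>f\<close> is monic.\<close>
    from irr e(1) have "q' dvd 1 \<or> d' dvd 1" by (auto dest: irreducibleD)
    then show "f dvd g"
    proof
      assume "q' dvd 1"
      then obtain v where v: "1 = q' * v" by (elim dvdE)
      have "d' = f * v" unfolding e(1) using v by (metis mult.assoc mult.commute mult_1)
      then have "f dvd d'" by (rule dvdI)
      then have "f dvd d" using e(2) by (simp add: dvd_smult)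
      obtain c2 q2 where c2: "c2 \<noteq> 0" "smult c2 g = q2 * d"
        using multiple[of g 0 1] by auto
      have "f dvd smult c2 g" using c2(2) \<open>f dvd d\<close> by simp
      then show ?thesis using smult_prime_product_dvd[OF fact[OF c2(1)]] monic by blast
    next
      assume "d' dvd 1"
      then obtain w where w: "1 = d' * w" by (elim dvdE)
      have e0: "e \<noteq> 0" using d0 e(2) by auto
      have "smult e h = (w * h) * d"
      proof -
        have "(w * h) * d = smult e ((d' * w) * h)" unfolding e(2) by (simp add: mult_ac)
        then show ?thesis by (simp add: w[symmetric])
      qed
      also have "\<dots> = (w * h * a) * f + (w * b) * (g * h)" unfolding ab by (simp only: algebra_simps)
      finally have "f dvd smult e h" using fgh by simp
      then have "f dvd h" using smult_prime_product_dvd[OF fact[OF e0]] monic by blast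
      with \<open>\<not> f dvd h\<close> show ?thesis by contradiction
    qed
  qed
qed

lemma monic_prime_factorization:
  fixes f :: "'b::idom poly"
  assumes fact: "\<And>b::'b. b \<noteq> 0 \<Longrightarrow> prime_product b" and "lead_coeff f = 1"
  shows "\<exists>ps. (\<forall>p\<in>set ps. prime_elem p \<and> lead_coeff p = 1) \<and> f = prod_list ps"
  using assms(2)
proof (induction "degree f" arbitrary: f rule: less_induct)
  case less
  have monic_unit: "p = 1" if "lead_coeff p = 1" "degree p = 0" for p :: "'b poly"
    using that by (auto elim!: degree_eq_zeroE simp: one_pCons)
  have f0: "f \<noteq> 0" using less.prems by auto
  consider "degree f = 0" | "irreducible f" | "degree f \<noteq> 0" "\<not> irreducible f" by blast
  then show ?case
  proof cases
    case 1
    then show ?thesis using monic_unit[OF less.prems] by (intro exI[of _ "[]"]) simp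
  next
    case 2
    then show ?thesis using monic_irreducible_imp_prime_elem[OF fact _ less.prems] less.prems
      by (intro exI[of _ "[f]"]) simp
  next
    case 3
    have "\<not> f dvd 1"
    proof
      assume "f dvd 1"
      then obtain k where k: "1 = f * k" by (elim dvdE)
      then have "k \<noteq> 0" by auto
      then have "degree f + degree k = 0" using k f0 degree_mult_eq[of f k] by (metis degree_1)
      then show False using 3 by simp
    qed
    then obtain a b where ab: "f = a * b" "\<not> a dvd 1" "\<not> b dvd 1"
      using 3 f0 unfolding irreducible_def by blast
    \<comment> \<open>The leading coefficients are inverse to each other, so exchanging them makes
      both factors monic and leaves the product unchanged.\<close>
    define a' b' where "a' = smult (lead_coeff b) a" and "b' = smult (lead_coeff a) b"
    have lc: "lead_coeff a * lead_coeff b = 1"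
      using less.prems ab(1) by (simp add: lead_coeff_mult)
    have f_eq: "f = a' * b'" unfolding ab a'_def b'_def using lc by (simp add: mult.commute)
    have monic: "lead_coeff a' = 1" "lead_coeff b' = 1"
      unfolding a'_def b'_def lead_coeff_smult using lc by (simp_all add: mult.commute)
    have "a dvd a'" "b dvd b'" unfolding a'_def b'_def by (auto intro: dvd_smult)
    then have "a' \<noteq> 1" "b' \<noteq> 1" using ab(2,3) by auto
    then have deg: "degree a' \<noteq> 0" "degree b' \<noteq> 0"
      using monic_unit[OF monic(1)] monic_unit[OF monic(2)] by blast+
    have "a' \<noteq> 0" "b' \<noteq> 0" using monic by auto
    then have "degree f = degree a' + degree b'" unfolding f_eq by (rule degree_mult_eq)
    then have "degree a' < degree f" "degree b' < degree f" using deg by auto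
    then obtain ps qs where
      "\<forall>p\<in>set ps. prime_elem p \<and> lead_coeff p = 1" "a' = prod_list ps"
      "\<forall>p\<in>set qs. prime_elem p \<and> lead_coeff p = 1" "b' = prod_list qs"
      using less.hyps[of a'] less.hyps[of b'] monic by blast
    then show ?thesis by (intro exI[of _ "ps @ qs"]) (auto simp: f_eq)
  qed
qed

section \<open>Factoriality\<close>

lift_definition germ_of_poly :: "'a::analytic_coeff germ poly \<Rightarrow> 'a fps germ"
  is "\<lambda>p. Abs_fps (\<lambda>n. series (coeff p n))"
proof (rule convergent_fps_finite)
  fix p :: "'a germ poly" and n
  show "converges (Abs_fps (\<lambda>n. series (coeff p n)) $ n)"
    by (simp add: convergent_series)
  show "Abs_fps (\<lambda>n. series (coeff p n)) $ n = 0" if "n \<ge> Suc (degree p)"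
    using that by (simp add: coeff_eq_0 zero_germ.rep_eq)
qed

lemma germ_of_poly_nth: "series (germ_of_poly p) $ n = series (coeff p n)"
  by (simp add: germ_of_poly.rep_eq)

lemma germ_eqI: "(\<And>n. series f $ n = series g $ n) \<Longrightarrow> f = (g :: 'a::analytic_coeff fps germ)"
  by (simp add: series_inject[symmetric] fps_eq_iff)

lemma germ_of_poly_add: "germ_of_poly (p + q) = germ_of_poly p + germ_of_poly q"
  by (rule germ_eqI) (simp add: germ_of_poly_nth plus_germ.rep_eq)

lemma germ_of_poly_mult: "germ_of_poly (p * q) = germ_of_poly p * germ_of_poly q"
  by (rule germ_eqI)
     (simp add: germ_of_poly_nth times_germ.rep_eq fps_mult_nth coeff_mult series_sum atLeast0AtMost)

lemma germ_of_poly_1: "germ_of_poly 1 = (1 :: 'a::analytic_coeff fps germ)"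
proof (rule germ_eqI)
  fix n
  have "series (coeff 1 n) = (1 :: 'a fps) $ n" for n
    by (cases n) (simp_all add: one_germ.rep_eq zero_germ.rep_eq)
  then show "series (germ_of_poly 1) $ n = series (1 :: 'a fps germ) $ n"
    by (simp add: germ_of_poly_nth one_germ.rep_eq)
qed

lemma germ_of_poly_eq_0D: "germ_of_poly p = 0 \<Longrightarrow> p = 0"
proof (rule poly_eqI)
  fix n assume "germ_of_poly p = 0"
  then have "series (coeff p n) = series 0"
    using germ_of_poly_nth[of p n] by (simp add: zero_germ.rep_eq)
  then show "coeff p n = coeff 0 n" by (simp add: series_inject)
qed

text \<open>On the axis of the outer variable, where all inner variables are 0, such a series starts
  in degree exactly \<open>m\<close>.\<close>

definition regular :: "nat \<Rightarrow> 'a::analytic_coeff fps germ \<Rightarrow> bool" where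
  "regular m g \<longleftrightarrow> (\<forall>i<m. ev0 (series g $ i) = 0) \<and> ev0 (series g $ m) \<noteq> 0"

lemma weierstrass_division:
  assumes "regular m g"
  obtains q r where "f = q * g + germ_of_poly r" "\<And>n. n \<ge> m \<Longrightarrow> coeff r n = 0"
proof -
  obtain Q R where QR: "series f = Q * series g + R" "converges Q" "converges R"
    "\<And>n. n \<ge> m \<Longrightarrow> R $ n = 0"
    using weierstrass_division_fps[of "series g" m "series f"] assms convergent_series
    unfolding regular_def by blast
  define r where "r = Poly (map (\<lambda>n. Germ (R $ n)) [0..<m])"
  have r: "coeff r n = (if n < m then Germ (R $ n) else 0)" for n
    by (simp add: r_def nth_default_def)
  have "series (germ_of_poly r) = R"
    using QR(3,4) by (auto simp: fps_eq_iff germ_of_poly_nth r Germ_inverse converges_nth zero_germ.rep_eq)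
  then have "series f = series (Germ Q * g + germ_of_poly r)"
    using QR(1,2) by (simp add: plus_germ.rep_eq times_germ.rep_eq Germ_inverse)
  then have "f = Germ Q * g + germ_of_poly r" by (simp add: series_inject)
  then show thesis using that r by auto
qed

lemma weierstrass_division_unique:
  assumes "regular m g" "q * g = germ_of_poly r" "\<And>n. n \<ge> m \<Longrightarrow> coeff r n = 0"
  shows "q = 0"
proof -
  have "(series q * series g) $ n = 0" if "n \<ge> m" for n
    using assms(2) assms(3)[OF that] germ_of_poly_nth[of r n]
    by (metis times_germ.rep_eq zero_germ.rep_eq)
  then have "series q = 0"
    using assms(1) unfolding regular_def
    by (intro weierstrass_division_fps_unique[of "series g" m "series q"]) (auto simp: convergent_series)
  then show ?thesis by (simp add: series_inject[symmetric] zero_germ.rep_eq)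
qed

definition weierstrass_poly :: "'a::analytic_coeff germ poly \<Rightarrow> bool" where
  "weierstrass_poly W \<longleftrightarrow> lead_coeff W = 1 \<and> (\<forall>i<degree W. const_term (coeff W i) = 0)"

lemma regular_weierstrass_poly: "weierstrass_poly W \<Longrightarrow> regular (degree W) (germ_of_poly W)"
  by (simp add: weierstrass_poly_def regular_def germ_of_poly_nth one_germ.rep_eq ev_1)

text \<open>Setting the inner variables to 0 is a ring homomorphism to real polynomials, called
  \<theta> here. It sends the product to a power of the variable; comparing degrees with orders at 0
  forces the image of each factor to be a power as well.\<close>

lemma weierstrass_poly_factor:
  fixes U V :: "'a::analytic_coeff germ poly"
  assumes W: "weierstrass_poly (U * V)" and U: "lead_coeff U = 1" and V: "lead_coeff V = 1"
  shows "weierstrass_poly U"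
proof -
  define \<theta> where "\<theta> p = map_poly const_term p" for p :: "'a germ poly"
  have c0: "const_term (0 :: 'a germ) = 0" by (simp add: zero_germ.rep_eq ev_0)
  have \<theta>: "coeff (\<theta> p) n = const_term (coeff p n)" for p n
    by (simp add: \<theta>_def coeff_map_poly c0)
  have nz: "U \<noteq> 0" "V \<noteq> 0" using U V by auto
  have top1: "const_term (1 :: 'a germ) = 1" by (simp add: one_germ.rep_eq ev_1)
  have deg: "degree (\<theta> p) = degree p" if "lead_coeff p = 1" for p
  proof (rule antisym)
    show "degree (\<theta> p) \<le> degree p" by (rule degree_le) (simp add: \<theta> coeff_eq_0 c0)
    show "degree p \<le> degree (\<theta> p)" using that top1 by (intro le_degree) (simp add: \<theta>)
  qed
  have prod: "\<theta> U * \<theta> V = monom 1 (degree U + degree V)"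
  proof (rule poly_eqI)
    fix n
    have "coeff (\<theta> U * \<theta> V) n = const_term (coeff (U * V) n)"
      by (simp add: coeff_mult \<theta> series_sum ev0_sum times_germ.rep_eq ev0_mult)
    also have "\<dots> = coeff (monom 1 (degree U + degree V)) n"
    proof (cases n "degree U + degree V" rule: linorder_cases)
      case less
      then show ?thesis using W nz by (simp add: weierstrass_poly_def degree_mult_eq)
    next
      case equal
      then show ?thesis using U V by (simp add: coeff_mult_degree_sum top1)
    next
      case greater
      then show ?thesis using nz by (simp add: coeff_eq_0 degree_mult_eq c0)
    qed
    finally show "coeff (\<theta> U * \<theta> V) n = coeff (monom 1 (degree U + degree V)) n" .
  qed
  then have \<theta>nz: "\<theta> U \<noteq> 0" "\<theta> V \<noteq> 0" by auto
  have "order 0 (\<theta> U) + order 0 (\<theta> V) = degree U + degree V"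
    using order_mult[of "\<theta> U" "\<theta> V" 0] unfolding prod by (simp add: order_0_monom)
  moreover have "order 0 (\<theta> U) \<le> degree U" "order 0 (\<theta> V) \<le> degree V"
    using order_degree[OF \<theta>nz(1), of 0] order_degree[OF \<theta>nz(2), of 0] deg U V by auto
  ultimately have "order 0 (\<theta> U) = degree U" by simp
  then have "monom 1 (degree U) dvd \<theta> U" using \<theta>nz by (simp add: monom_1_dvd_iff)
  then show ?thesis using U unfolding weierstrass_poly_def monom_1_dvd_iff' by (simp add: \<theta>)
qed

text \<open>Weierstrass division replaces both factors by polynomials of degree below that of
  \<open>W\<close>. Dividing their product by \<open>W\<close> among polynomials leaves a remainder
  of low degree that is a multiple of \<open>W\<close> among germs, so by uniqueness of Weierstrass
  division it is zero and primality of \<open>W\<close> among polynomials applies.\<close>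

lemma prime_elem_germ_of_poly:
  fixes W :: "'a::analytic_coeff germ poly"
  assumes prime: "prime_elem W" and W: "weierstrass_poly W"
  shows "prime_elem (germ_of_poly W)"
proof (rule prime_elemI)
  have reg: "regular (degree W) (germ_of_poly W)" by (rule regular_weierstrass_poly[OF W])
  have monic: "lead_coeff W = 1" using W by (simp add: weierstrass_poly_def)
  show "germ_of_poly W \<noteq> 0" using prime germ_of_poly_eq_0D[of W] by (auto simp: prime_elem_def)
  show "\<not> germ_of_poly W dvd 1"
  proof (cases "degree W = 0")
    case True
    then have "W = 1" using monic by (auto elim!: degree_eq_zeroE simp: one_pCons)
    then show ?thesis using prime by (auto simp: prime_elem_def)
  next
    case False
    then show ?thesis using W by (simp add: germ_dvd_1_iff ev0_fps germ_of_poly_nth weierstrass_poly_def)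
  qed
  fix f g assume "germ_of_poly W dvd f * g"
  then obtain k where k: "f * g = germ_of_poly W * k" by (rule dvdE)
  obtain q1 r1 where 1: "f = q1 * germ_of_poly W + germ_of_poly r1" "\<And>n. n \<ge> degree W \<Longrightarrow> coeff r1 n = 0"
    using weierstrass_division[OF reg] by blast
  obtain q2 r2 where 2: "g = q2 * germ_of_poly W + germ_of_poly r2" "\<And>n. n \<ge> degree W \<Longrightarrow> coeff r2 n = 0"
    using weierstrass_division[OF reg] by blast
  obtain q r where qr: "pseudo_divmod (r1 * r2) W = (q, r)" by force
  have W0: "W \<noteq> 0" using prime by (auto simp: prime_elem_def)
  have div: "r1 * r2 = W * q + r" "r = 0 \<or> degree r < degree W"
    using pseudo_divmod[OF W0 qr] monic by simp_all
  define k' where "k' = k - q1 * q2 * germ_of_poly W - q1 * germ_of_poly r2 - q2 * germ_of_poly r1 - germ_of_poly q"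
  have "germ_of_poly r = germ_of_poly (r1 * r2) - germ_of_poly W * germ_of_poly q"
    by (simp add: div(1) germ_of_poly_add germ_of_poly_mult)
  also have "\<dots> = k' * germ_of_poly W"
  proof -
    have r: "germ_of_poly r1 = f - q1 * germ_of_poly W" "germ_of_poly r2 = g - q2 * germ_of_poly W"
      using 1(1) 2(1) by simp_all
    show ?thesis
      unfolding germ_of_poly_mult k'_def r using k by (simp add: algebra_simps)
  qed
  finally have "k' * germ_of_poly W = germ_of_poly r" by simp
  moreover have "coeff r n = 0" if "n \<ge> degree W" for n
    using div(2) that by (auto intro: coeff_eq_0)
  ultimately have "k' = 0" by (rule weierstrass_division_unique[OF reg])
  with \<open>k' * germ_of_poly W = germ_of_poly r\<close> have "r = 0" using germ_of_poly_eq_0D by auto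
  then have "W dvd r1 * r2" using div(1) by simp
  then have "W dvd r1 \<or> W dvd r2" using prime by (simp add: prime_elem_dvd_mult_iff)
  then have "germ_of_poly W dvd germ_of_poly r1 \<or> germ_of_poly W dvd germ_of_poly r2"
    by (auto elim!: dvdE simp: germ_of_poly_mult)
  then show "germ_of_poly W dvd f \<or> germ_of_poly W dvd g"
    unfolding 1(1) 2(1) by auto
qed

lemma germ_of_poly_prod_list: "germ_of_poly (prod_list ps) = prod_list (map germ_of_poly ps)"
  by (induction ps) (simp_all add: germ_of_poly_1 germ_of_poly_mult)

lemma weierstrass_poly_prod_list:
  assumes "weierstrass_poly (prod_list ps)" "\<forall>p\<in>set ps. lead_coeff p = 1" "p \<in> set ps"
  shows "weierstrass_poly p"
proof -
  obtain qs rs where ps: "ps = qs @ p # rs" using split_list[OF assms(3)] by blast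
  have monic: "lead_coeff (prod_list xs) = 1" if "\<forall>p\<in>set xs. lead_coeff p = 1" for xs :: "'a germ poly list"
    using that by (induction xs) (auto simp: lead_coeff_mult)
  have "lead_coeff (prod_list qs * prod_list rs) = 1"
    using monic[of qs] monic[of rs] assms(2) ps by (simp add: lead_coeff_mult)
  moreover have "weierstrass_poly (p * (prod_list qs * prod_list rs))"
    using assms(1) ps by (simp add: mult_ac)
  ultimately show ?thesis
    using weierstrass_poly_factor[of p "prod_list qs * prod_list rs"] assms(2,3) by blast
qed

text \<open>Dividing the power of degree \<open>m\<close> by \<open>g\<close> and moving the
  remainder to the left gives \<open>W\<close>. On the outer axis the coefficient of degree
  \<open>m\<close> reads \<open>1 = q 0 * g m\<close> for the constant terms, so the quotient is a
  unit.\<close>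

lemma weierstrass_preparation:
  assumes "regular m g"
  obtains q W where "q dvd 1" "weierstrass_poly W" "germ_of_poly W = q * g"
proof -
  obtain q r where qr: "germ_of_poly (monom 1 m) = q * g + germ_of_poly r" "\<And>n. n \<ge> m \<Longrightarrow> coeff r n = 0"
    using weierstrass_division[OF assms] by blast
  define W where "W = monom 1 m - r"
  have W_eq: "germ_of_poly W = q * g"
  proof -
    have "germ_of_poly (monom 1 m) = germ_of_poly (W + r)" by (simp add: W_def)
    then show ?thesis using qr(1) by (simp add: germ_of_poly_add)
  qed
  have cW: "coeff W n = (if n = m then 1 else 0)" if "n \<ge> m" for n
    using qr(2)[OF that] by (simp add: W_def)
  have deg: "degree W = m"
    by (rule antisym) (auto intro!: degree_le le_degree simp: cW)
  have prod: "const_term (coeff W n) = (\<Sum>i\<le>n. ev0 (series q $ i) * ev0 (series g $ (n - i)))" for n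
    using arg_cong[OF W_eq, of "\<lambda>f. ev0 (series f $ n)"]
    by (simp add: germ_of_poly_nth times_germ.rep_eq fps_mult_nth ev0_sum ev0_mult atLeast0AtMost)
  have g_low: "ev0 (series g $ i) = 0" if "i < m" for i
    using assms that by (simp add: regular_def)
  have low: "const_term (coeff W n) = 0" if "n < m" for n
    unfolding prod using that by (auto intro!: sum.neutral simp: g_low)
  have "(\<Sum>i\<le>m. ev0 (series q $ i) * ev0 (series g $ (m - i)))
      = (\<Sum>i\<in>{0}. ev0 (series q $ i) * ev0 (series g $ (m - i)))"
    by (rule sum.mono_neutral_right) (auto simp: g_low)
  then have "const_term (1 :: 'a germ) = ev0 (series q $ 0) * ev0 (series g $ m)"
    using prod[of m] by (simp add: cW)
  then have "q dvd 1" by (auto simp: germ_dvd_1_iff ev0_fps one_germ.rep_eq ev_1)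
  moreover have "weierstrass_poly W" using low by (simp add: weierstrass_poly_def deg cW)
  ultimately show thesis using that W_eq by blast
qed

text \<open>The induction step on the number of variables, for regular germs: up to a unit
  \<open>g\<close> is a Weierstrass polynomial over a factorial ring, and its monic prime factors
  remain prime as germs.\<close>

lemma prime_product_regular:
  fixes g :: "'a::analytic_coeff fps germ"
  assumes fact: "\<And>b :: 'a germ. b \<noteq> 0 \<Longrightarrow> prime_product b" and nz: "ev0 (series g $ n) \<noteq> 0"
  shows "prime_product g"
proof -
  obtain m where reg: "regular m g"
    unfolding regular_def using exists_least_iff[of "\<lambda>m. ev0 (series g $ m) \<noteq> 0"] nz by blast
  obtain q W where W: "q dvd 1" "weierstrass_poly W" "germ_of_poly W = q * g"
    using weierstrass_preparation[OF reg] .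
  have "lead_coeff W = 1" using W(2) by (simp add: weierstrass_poly_def)
  then obtain ps where ps: "\<forall>p\<in>set ps. prime_elem p \<and> lead_coeff p = 1" "W = prod_list ps"
    using monic_prime_factorization[OF fact] by blast
  have "prime_product (germ_of_poly W)"
    unfolding ps(2) germ_of_poly_prod_list
  proof (rule prime_product_prod_list)
    fix p assume "p \<in> set (map germ_of_poly ps)"
    then obtain p' where p': "p' \<in> set ps" "p = germ_of_poly p'" by auto
    then have "weierstrass_poly p'" using weierstrass_poly_prod_list[of ps p'] W(2) ps by auto
    then show "prime_elem p" using p' ps(1) by (auto intro: prime_elem_germ_of_poly)
  qed
  moreover obtain u where u: "1 = q * u" using W(1) by (rule dvdE)
  then have "u dvd 1" by (metis dvd_triv_right)
  ultimately have "prime_product (u * germ_of_poly W)" by (intro prime_product_unit_mult)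
  moreover have "u * germ_of_poly W = g" using u W(3) by (metis mult.assoc mult.commute mult_1)
  ultimately show ?thesis by simp
qed

lemma prime_product_real_germ: "(b :: real germ) \<noteq> 0 \<Longrightarrow> prime_product b"
  by (intro prime_product.unit)
     (auto simp: germ_dvd_1_iff ev_real_def series_inject[symmetric] zero_germ.rep_eq)

text \<open>In one variable there are no inner variables, so every nonzero germ is regular.\<close>

lemma prime_product_real_fps_germ:
  assumes "(b :: real fps germ) \<noteq> 0" shows "prime_product b"
proof -
  have "series b \<noteq> 0" using assms by (metis series_inject zero_germ.rep_eq)
  then obtain m where "ev0 (series b $ m) \<noteq> 0" by (auto simp: fps_eq_iff ev_real_def)
  with prime_product_real_germ show ?thesis by (rule prime_product_regular)
qed

lemma convergent_fps_const: "converges a \<Longrightarrow> converges (fps_const a)"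
  by (rule convergent_fps_finite[of _ 1]) (use converges_cst[of 0] in \<open>auto simp: cst_0\<close>)

lemma convergent_fps_X: "converges (fps_X :: 'a::analytic_coeff fps)"
  by (rule convergent_fps_finite[of _ 2])
     (use converges_cst[of 0, where 'a = 'a] converges_cst[of 1, where 'a = 'a]
       in \<open>auto simp: cst_0 cst_1 fps_X_def\<close>)

lift_definition inner_var :: "'a::analytic_coeff fps fps germ" is "fps_const fps_X"
  by (rule convergent_fps_const[OF convergent_fps_X])

lemma inner_var_dvd:
  fixes f :: "'a::analytic_coeff fps fps germ"
  assumes "\<And>n. series f $ n $ 0 = 0"
  obtains g where "f = inner_var * g" "\<And>n k. series g $ n $ k = series f $ n $ Suc k"
proof -
  define G where "G = Abs_fps (\<lambda>n. fps_shift 1 (series f $ n))"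
  obtain r where r: "0 < r" "nm r (series f) < top"
    using convergent_series[of f] by (auto simp: converges_def)
  have "nm r (G $ n) * ennreal r ^ n * ennreal r \<le> nm r (series f $ n) * ennreal r ^ n" for n
  proof -
    have "nm r (fps_shift 1 (series f $ n)) * ennreal r ^ 1 \<le> nm r (series f $ n)"
      unfolding nm_fps_def[where 'a = 'a] by (rule nm2_shift_le)
    then have "(nm r (G $ n) * ennreal r) * ennreal r ^ n \<le> nm r (series f $ n) * ennreal r ^ n"
      unfolding G_def by (intro mult_right_mono) auto
    then show ?thesis by (simp only: mult_ac)
  qed
  then have "nm r G * ennreal r \<le> nm r (series f)"
    unfolding nm_fps_def[where 'a = "'a fps"] nm2_def ennreal_suminf_multc[symmetric] by (intro ennreal_suminf_mono)
  then have "nm r G \<noteq> top" using r by (auto simp: ennreal_top_mult top_unique)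
  then have G: "converges G" using r(1) by (intro convergesI[of r]) (auto simp: less_top)
  have "series f = fps_const fps_X * G"
    unfolding fps_eq_iff using assms by (auto simp: G_def fps_X_mult_nth)
  then have "series f = series (inner_var * Germ G)"
    using G by (simp add: times_germ.rep_eq Germ_inverse inner_var.rep_eq)
  then show thesis
    using G by (intro that[of "Germ G"]) (auto simp: series_inject Germ_inverse G_def)
qed

text \<open>Setting the first inner variable to 0 is the ring homomorphism \<psi> into an integral
  domain, and its kernel consists of the multiples of \<open>inner_var\<close>.\<close>

lemma prime_elem_inner_var: "prime_elem (inner_var :: 'a::analytic_coeff fps fps germ)"
proof -
  define \<psi> where "\<psi> f = Abs_fps (\<lambda>n. series f $ n $ 0)" for f :: "'a fps fps germ"
  have \<psi>_mult: "\<psi> (f * g) = \<psi> f * \<psi> g" for f g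
    by (simp add: \<psi>_def fps_eq_iff times_germ.rep_eq fps_mult_nth fps_sum_nth)
  have \<psi>_var: "\<psi> inner_var = 0"
    by (simp add: \<psi>_def fps_eq_iff inner_var.rep_eq)
  have dvd_iff: "inner_var dvd f \<longleftrightarrow> \<psi> f = 0" for f
  proof
    assume "\<psi> f = 0"
    then have "series f $ n $ 0 = 0" for n by (simp add: \<psi>_def fps_eq_iff)
    then show "inner_var dvd f" using inner_var_dvd[of f] by (metis dvdI)
  qed (auto elim!: dvdE simp: \<psi>_mult \<psi>_var)
  show ?thesis
  proof (rule prime_elemI)
    have "fps_const fps_X \<noteq> (0 :: 'a fps fps)" by simp
    then show "inner_var \<noteq> (0 :: 'a fps fps germ)"
      by (metis inner_var.rep_eq zero_germ.rep_eq)
    show "\<not> inner_var dvd (1 :: 'a fps fps germ)"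
      unfolding dvd_iff by (auto simp: \<psi>_def fps_eq_iff one_germ.rep_eq fps_one_nth intro!: exI[of _ 0])
    show "inner_var dvd f \<or> inner_var dvd g" if "inner_var dvd f * g" for f g :: "'a fps fps germ"
      using that unfolding dvd_iff \<psi>_mult by simp
  qed
qed

text \<open>With a single inner variable, a nonzero series vanishes on the outer axis only if that
  variable divides it, so splitting off the variable finitely often makes it regular. With two inner
  variables this fails: their sum vanishes on the outer axis without being divisible by
  either.\<close>

lemma prime_product_real_fps_fps_germ:
  assumes "(b :: real fps fps germ) \<noteq> 0" shows "prime_product b"
proof -
  have "series b \<noteq> 0" using assms by (metis series_inject zero_germ.rep_eq)
  then obtain n where "series b $ n \<noteq> 0" by (auto simp: fps_eq_iff)
  then obtain k where "series b $ n $ k \<noteq> 0" unfolding fps_eq_iff[of "series b $ n"] by auto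
  then show ?thesis
  proof (induction k arbitrary: b)
    case (0 b)
    then have "ev0 (series b $ n) \<noteq> 0" by (simp add: ev0_fps ev_real_def)
    with prime_product_real_fps_germ show ?case by (rule prime_product_regular)
  next
    case (Suc k b)
    show ?case
    proof (cases "\<exists>m. series b $ m $ 0 \<noteq> 0")
      case True
      then obtain m where "ev0 (series b $ m) \<noteq> 0" by (auto simp: ev0_fps ev_real_def)
      with prime_product_real_fps_germ show ?thesis by (rule prime_product_regular)
    next
      case False
      then obtain g where g: "b = inner_var * g" "\<And>n k. series g $ n $ k = series b $ n $ Suc k"
        using inner_var_dvd[of b] by blast
      then have "prime_product g" using Suc by simp
      then show ?thesis unfolding g(1) by (intro prime_product.step prime_elem_inner_var)
    qed
  qed
qed

section \<open>Germs as functions on small polydiscs\<close>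

definition near_0 :: "(nat \<Rightarrow> real) filter" where
  "near_0 = (INF r\<in>{0<..}. principal {v. \<forall>i. \<bar>v i\<bar> \<le> r})"

text \<open>All coordinates are bounded by the same radius, as the evaluation laws demand;
  neighbourhoods in the product topology would restrict only finitely many of them.\<close>

lemma eventually_near_0: "eventually P near_0 \<longleftrightarrow> (\<exists>r>0. \<forall>v. (\<forall>i. \<bar>v i\<bar> \<le> r) \<longrightarrow> P v)"
  unfolding near_0_def
proof (subst eventually_INF_base)
  show "\<exists>x\<in>{0<..}. principal {v. \<forall>i. \<bar>v i\<bar> \<le> x} \<le>
      inf (principal {v. \<forall>i. \<bar>v i\<bar> \<le> a}) (principal {v. \<forall>i. \<bar>v i\<bar> \<le> b})"
    if "a \<in> {0<..}" "b \<in> {0<..}" for a b :: real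
    using that by (intro bexI[of _ "min a b"]) auto
qed (auto simp: eventually_principal)

abbreviation gev :: "(nat \<Rightarrow> real) \<Rightarrow> 'a::analytic_coeff germ \<Rightarrow> real" where
  "gev v f \<equiv> ev v (series f)"

lemma gev_add: "\<forall>\<^sub>F v in near_0. gev v (f + g) = gev v f + gev v g"
proof -
  obtain r where "0 < r" "nm r (series f) < top" "nm r (series g) < top"
    using converges_common2[OF convergent_series convergent_series] .
  then show ?thesis
    unfolding eventually_near_0 plus_germ.rep_eq by (intro exI[of _ r] conjI allI impI ev_add[of r]) auto
qed

lemma gev_mult: "\<forall>\<^sub>F v in near_0. gev v (f * g) = gev v f * gev v g"
proof -
  obtain r where "0 < r" "nm r (series f) < top" "nm r (series g) < top"
    using converges_common2[OF convergent_series convergent_series] .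
  then show ?thesis
    unfolding eventually_near_0 times_germ.rep_eq by (intro exI[of _ r] conjI allI impI ev_mult[of r]) auto
qed

lemma gev_0: "gev v 0 = 0"
  by (simp add: zero_germ.rep_eq ev_0)

lemma gev_1: "gev v 1 = 1"
  by (simp add: one_germ.rep_eq ev_1)

lemma gev_minus: "\<forall>\<^sub>F v in near_0. gev v (- f) = - gev v f"
  using gev_add[of f "- f"] by eventually_elim (simp add: gev_0)

lemma germ_eq_0I:
  assumes "\<forall>\<^sub>F v in near_0. gev v f = 0" shows "f = 0"
proof -
  obtain s where s: "0 < s" "\<And>v. (\<And>i. \<bar>v i\<bar> \<le> s) \<Longrightarrow> gev v f = 0"
    using assms unfolding eventually_near_0 by blast
  obtain t where t: "0 < t" "nm t (series f) < top"
    using convergent_series[of f] by (auto simp: converges_def)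
  have "series f = 0"
  proof (rule ev_eq_0D)
    show "0 < min s t" using s t by simp
    show "nm (min s t) (series f) < top"
      using s(1) t by (intro nm_finite_mono[OF _ _ t(2)]) auto
  qed (auto intro: s(2))
  then show ?thesis by (metis series_inject zero_germ.rep_eq)
qed

lemma germ_eqI_near_0:
  assumes "\<forall>\<^sub>F v in near_0. gev v f = gev v g" shows "f = g"
proof -
  have "\<forall>\<^sub>F v in near_0. gev v (f + - g) = 0"
    using assms gev_add[of f "- g"] gev_minus[of g] by eventually_elim simp
  then show ?thesis using germ_eq_0I[of "f + - g"] by simp
qed

section \<open>Linear substitutions\<close>

text \<open>Elements \<open>w i\<close> of norm at most \<rho> may be put in place of the variables
  of any \<open>a\<close> with finite norm at \<rho>, without increasing the norm. It is a predicate
  on types because the induction runs over the variables of \<open>a\<close>, with the target ring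
  fixed.\<close>

definition substitutable :: "'a::analytic_coeff itself \<Rightarrow> 'k::analytic_coeff itself \<Rightarrow> bool" where
  "substitutable _ _ \<longleftrightarrow> (\<forall>(w :: nat \<Rightarrow> 'k) r \<rho> (a :: 'a). 0 < r \<longrightarrow> 0 < \<rho> \<longrightarrow>
     (\<forall>i. nm r (w i) \<le> ennreal \<rho>) \<longrightarrow> nm \<rho> a < top \<longrightarrow>
     (\<exists>b :: 'k. nm r b \<le> nm \<rho> a \<and> (\<forall>v. (\<forall>i. \<bar>v i\<bar> \<le> r) \<longrightarrow> ev v b = ev (\<lambda>i. ev v (w i)) a)))"

lemma substitutable_real: "substitutable TYPE(real) TYPE('k::analytic_coeff)"
  unfolding substitutable_def
proof (intro allI impI)
  fix r \<rho> a :: real and w :: "nat \<Rightarrow> 'k"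
  show "\<exists>b :: 'k. nm r b \<le> nm \<rho> a \<and> (\<forall>v. (\<forall>i. \<bar>v i\<bar> \<le> r) \<longrightarrow> ev v b = ev (\<lambda>i. ev v (w i)) a)"
    by (intro exI[of _ "cst a"]) (simp add: nm_cst ev_cst nm_real_def ev_real_def)
qed

lemma nm_power_le:
  assumes "0 < r" "nm r a \<le> B" shows "nm r (a ^ n) \<le> B ^ n"
proof (induction n)
  case 0
  have "nm r (cst 1 :: 'a) = 1" by (simp add: nm_cst)
  then show ?case by (simp add: cst_1)
next
  case (Suc n)
  have "nm r (a * a ^ n) \<le> nm r a * nm r (a ^ n)" by (rule nm_mult[OF assms(1)])
  also have "\<dots> \<le> B * B ^ n" using Suc assms by (intro mult_mono) auto
  finally show ?case by simp
qed

lemma ev_power: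
  assumes "0 < r" "\<And>i. \<bar>v i\<bar> \<le> r" "nm r a < top"
  shows "ev v (a ^ n) = ev v a ^ n"
proof (induction n)
  case (Suc n)
  have "nm r (a ^ n) < top"
    using nm_power_le[OF assms(1), of a "nm r a" n] assms(3)
    by (auto simp: less_top[symmetric] power_eq_top_ennreal top_unique)
  then have "ev v (a * a ^ n) = ev v a * ev v (a ^ n)" using assms by (intro ev_mult[of r]) auto
  then show ?case by (simp add: Suc)
qed (simp add: ev_1)

text \<open>The composite is the sum of \<open>b n * w 0 ^ n\<close>, where \<open>b n\<close> comes
  from substitution in the coefficients. It exists by completeness, and evaluation passes to the
  limit since it is dominated by the norm.\<close>

lemma substitutable_fps:
  assumes "substitutable TYPE('a::analytic_coeff) TYPE('k::analytic_coeff)"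
  shows "substitutable TYPE('a fps) TYPE('k)"
  unfolding substitutable_def
proof (intro allI impI)
  fix r \<rho> :: real and w :: "nat \<Rightarrow> 'k" and F :: "'a fps"
  assume r: "0 < r" and \<rho>: "0 < \<rho>" and w: "\<forall>i. nm r (w i) \<le> ennreal \<rho>" and F: "nm \<rho> F < top"
  have "\<exists>b :: 'k. nm r b \<le> nm \<rho> (F $ n) \<and>
      (\<forall>v. (\<forall>i. \<bar>v i\<bar> \<le> r) \<longrightarrow> ev v b = ev (\<lambda>i. ev v (w (Suc i))) (F $ n))" for n
    using assms[unfolded substitutable_def, rule_format, of r \<rho> "\<lambda>i. w (Suc i)" "F $ n"]
      r \<rho> w nm_fps_nth_finite[OF \<rho> F] by simp
  then obtain b :: "nat \<Rightarrow> 'k" where b: "\<And>n. nm r (b n) \<le> nm \<rho> (F $ n)"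
    "\<And>n v. (\<And>i. \<bar>v i\<bar> \<le> r) \<Longrightarrow> ev v (b n) = ev (\<lambda>i. ev v (w (Suc i))) (F $ n)"
    by metis
  define g where "g n = b n * w 0 ^ n" for n
  have b_fin: "nm r (b n) < top" for n
    using b(1) nm_fps_nth_finite[OF \<rho> F, of n] by (rule le_less_trans)
  have w_fin: "nm r (w 0) < top" using w by (auto intro: le_less_trans)
  have wp_fin: "nm r (w 0 ^ n) < top" for n
  proof -
    have "nm r (w 0 ^ n) \<le> ennreal \<rho> ^ n" using w by (intro nm_power_le[OF r]) simp
    then show ?thesis using \<rho> by (auto simp: ennreal_power intro: le_less_trans)
  qed
  have g_fin: "nm r (g n) < top" for n
    unfolding g_def by (rule nm_mult_finite[OF r b_fin wp_fin])
  have g_le: "nm r (g n) \<le> nm \<rho> (F $ n) * ennreal \<rho> ^ n" for n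
    unfolding g_def using w b(1)
    by (intro order_trans[OF nm_mult[OF r]] mult_mono nm_power_le[OF r]) auto
  have sum_le: "(\<Sum>n. nm r (g n)) \<le> nm \<rho> F"
    unfolding nm_fps_def nm2_def by (rule ennreal_suminf_mono[OF g_le])
  then have fin: "(\<Sum>n. nm r (g n)) < top" using F by (rule le_less_trans)
  obtain s where s: "\<And>N. nm r (s - (\<Sum>n<N. g n)) \<le> (\<Sum>n. nm r (g (n + N)))"
    using nm_complete[OF r fin] by blast
  have s_le: "nm r s \<le> nm \<rho> F" using s[of 0] sum_le by simp
  then have s_fin: "nm r s < top" using F by (rule le_less_trans)
  have "ev v s = ev (\<lambda>i. ev v (w i)) F" if v: "\<forall>i. \<bar>v i\<bar> \<le> r" for v
  proof -
    have partial_sum: "ennreal \<bar>ev v s - (\<Sum>n<N. ev v (g n))\<bar> \<le> (\<Sum>n. nm r (g (n + N)))" for N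
    proof -
      have "nm r (\<Sum>n<N. g n) < top" by (rule nm_sum_finite) (rule g_fin)
      then have "ev v s - (\<Sum>n<N. ev v (g n)) = ev v (s - (\<Sum>n<N. g n))"
        using v r g_fin s_fin by (subst ev_diff[of r]) (auto simp: ev_sum[of r])
      then show ?thesis using ev_le_nm[of r v "s - (\<Sum>n<N. g n)"] s[of N] v r by simp
    qed
    have "(\<lambda>N. ennreal \<bar>ev v s - (\<Sum>n<N. ev v (g n))\<bar>) \<longlonglongrightarrow> 0"
      by (rule tendsto_sandwich[OF _ _ tendsto_const ennreal_suminf_tail_tendsto_0[OF fin]])
         (intro always_eventually allI partial_sum zero_le)+
    then have "(\<lambda>N. \<bar>ev v s - (\<Sum>n<N. ev v (g n))\<bar>) \<longlonglongrightarrow> 0"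
      by (subst (asm) ennreal_0[symmetric], subst (asm) tendsto_ennreal_iff) auto
    then have "(\<lambda>N. ev v s - (\<Sum>n<N. ev v (g n))) \<longlonglongrightarrow> 0" by (simp add: tendsto_rabs_zero_iff)
    then have "(\<lambda>N. ev v s - (ev v s - (\<Sum>n<N. ev v (g n)))) \<longlonglongrightarrow> ev v s - 0"
      by (intro tendsto_diff tendsto_const)
    then have "(\<lambda>n. ev v (g n)) sums ev v s" by (simp add: sums_def)
    moreover have "ev v (g n) = ev (\<lambda>i. ev v (w (Suc i))) (F $ n) * ev v (w 0) ^ n" for n
    proof -
      have "ev v (g n) = ev v (b n) * ev v (w 0 ^ n)"
        unfolding g_def using v by (intro ev_mult[OF r] b_fin wp_fin) auto
      also have "ev v (w 0 ^ n) = ev v (w 0) ^ n"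
        using v by (intro ev_power[OF r] w_fin) auto
      finally show ?thesis using b(2)[of v n] v by simp
    qed
    ultimately show ?thesis unfolding ev_fps_def by (simp add: sums_iff)
  qed
  then show "\<exists>b :: 'k. nm r b \<le> nm \<rho> F \<and> (\<forall>v. (\<forall>i. \<bar>v i\<bar> \<le> r) \<longrightarrow> ev v b = ev (\<lambda>i. ev v (w i)) F)"
    using s_le by blast
qed

type_synonym series3 = "real fps fps fps"

lemma substitutable_series3: "substitutable TYPE(series3) TYPE('k::analytic_coeff)"
  by (intro substitutable_fps substitutable_real)

lemma ev_fps_const: "ev v (fps_const a :: 'a::analytic_coeff fps) = ev (\<lambda>i. v (Suc i)) a"
proof -
  have "ev v (fps_const a) = (\<Sum>n\<in>{0}. ev (\<lambda>i. v (Suc i)) (fps_const a $ n) * v 0 ^ n)"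
    unfolding ev_fps_def by (rule suminf_finite) (auto simp: ev_0)
  then show ?thesis by simp
qed

lemma ev_fps_X: "ev v (fps_X :: 'a::analytic_coeff fps) = v 0"
proof -
  have "ev v (fps_X :: 'a fps) = (\<Sum>n\<in>{1}. ev (\<lambda>i. v (Suc i)) ((fps_X :: 'a fps) $ n) * v 0 ^ n)"
    unfolding ev_fps_def by (rule suminf_finite) (auto simp: ev_0)
  then show ?thesis by (simp add: ev_1)
qed

lemma nm_fps_const: "nm r (fps_const a :: 'a::analytic_coeff fps) = nm r a"
proof -
  have "nm r (fps_const a) = (\<Sum>n\<in>{0}. nm r (fps_const a $ n) * ennreal r ^ n)"
    unfolding nm_fps_def nm2_def by (rule suminf_finite) (auto simp: nm_zero)
  then show ?thesis by simp
qed

lemma nm_fps_X: "nm r (fps_X :: 'a::analytic_coeff fps) = ennreal r"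
proof -
  have "nm r (fps_X :: 'a fps) = (\<Sum>n\<in>{1}. nm r ((fps_X :: 'a fps) $ n) * ennreal r ^ n)"
    unfolding nm_fps_def nm2_def by (rule suminf_finite) (auto simp: nm_zero)
  moreover have "nm r (1 :: 'a) = 1" using nm_cst[of r 1, where 'a = 'a] by (simp add: cst_1)
  ultimately show ?thesis by simp
qed

lemma ev_series3_cong:
  fixes F :: series3
  assumes "v 0 = w 0" "v 1 = w 1" "v 2 = w 2"
  shows "ev v F = ev w F"
  using assms by (simp add: ev_fps_def ev_real_def numeral_2_eq_2)

lemma shear_radius:
  fixes \<rho> a b :: real
  defines "r \<equiv> \<rho> / (1 + \<bar>a\<bar> + \<bar>b\<bar>)"
  assumes "0 < \<rho>"
  shows "0 < r" "\<rho> = r + \<bar>a\<bar> * r + \<bar>b\<bar> * r"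
proof -
  have d: "0 < 1 + \<bar>a\<bar> + \<bar>b\<bar>" by linarith
  show "0 < r" unfolding r_def using assms(2) d by (rule divide_pos_pos)
  have "\<rho> = r * (1 + \<bar>a\<bar> + \<bar>b\<bar>)" using d by (simp add: r_def)
  then show "\<rho> = r + \<bar>a\<bar> * r + \<bar>b\<bar> * r" by (simp add: algebra_simps)
qed

text \<open>A linear change of coordinates that carries the outer axis to the line in direction
  \<open>(1, a, b)\<close>.\<close>

definition shear :: "real \<Rightarrow> real \<Rightarrow> (nat \<Rightarrow> real) \<Rightarrow> nat \<Rightarrow> real" where
  "shear a b v = (\<lambda>i. if i = 0 then v 0 else if i = 1 then v 1 + a * v 0
      else if i = 2 then v 2 + b * v 0 else 0)"

lemma shear_bound:
  assumes "0 < \<rho>" "\<And>i. \<bar>v i\<bar> \<le> \<rho> / (1 + \<bar>a\<bar> + \<bar>b\<bar>)"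
  shows "\<bar>shear a b v i\<bar> \<le> \<rho>"
proof -
  define r where "r = \<rho> / (1 + \<bar>a\<bar> + \<bar>b\<bar>)"
  note r = shear_radius[OF assms(1), of a b, folded r_def]
  have v: "\<bar>v i\<bar> \<le> r" for i using assms(2) by (simp add: r_def)
  have "\<bar>c * v 0\<bar> \<le> \<bar>c\<bar> * r" for c unfolding abs_mult using v by (intro mult_left_mono) auto
  note this[of a] this[of b]
  moreover have "0 \<le> \<bar>a\<bar> * r" "0 \<le> \<bar>b\<bar> * r" using r(1) by auto
  moreover note v[of 0] v[of 1] v[of 2] r
  ultimately have "\<bar>v 0\<bar> \<le> \<rho>" "\<bar>v 1 + a * v 0\<bar> \<le> \<rho>" "\<bar>v 2 + b * v 0\<bar> \<le> \<rho>" "0 \<le> \<rho>"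
    by linarith+
  then show ?thesis by (simp add: shear_def)
qed

lemma shear_filterlim: "filterlim (shear a b) near_0 near_0"
  unfolding filterlim_iff
proof (intro allI impI)
  fix P assume "eventually P near_0"
  then obtain \<rho> where \<rho>: "0 < \<rho>" "\<And>v. (\<And>i. \<bar>v i\<bar> \<le> \<rho>) \<Longrightarrow> P v" unfolding eventually_near_0 by blast
  have "0 < \<rho> / (1 + \<bar>a\<bar> + \<bar>b\<bar>)" using \<rho>(1) by (intro divide_pos_pos) auto
  then show "\<forall>\<^sub>F v in near_0. P (shear a b v)"
    using \<rho> shear_bound[OF \<rho>(1)] unfolding eventually_near_0 by blast
qed

lemma shear_series:
  fixes F :: series3
  assumes "0 < \<rho>" "nm \<rho> F < top"
  shows "\<exists>G :: series3. nm (\<rho> / (1 + \<bar>a\<bar> + \<bar>b\<bar>)) G < top \<and>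
    (\<forall>v. (\<forall>i. \<bar>v i\<bar> \<le> \<rho> / (1 + \<bar>a\<bar> + \<bar>b\<bar>)) \<longrightarrow> ev v G = ev (shear a b v) F)"
proof -
  define r where "r = \<rho> / (1 + \<bar>a\<bar> + \<bar>b\<bar>)"
  note r = shear_radius[OF assms(1), of a b, folded r_def]
  define X Y Z :: series3 where "X = fps_X" and "Y = fps_const fps_X" and "Z = fps_const (fps_const fps_X)"
  have nm_XYZ: "nm r X = ennreal r" "nm r Y = ennreal r" "nm r Z = ennreal r"
    by (simp_all add: X_def Y_def Z_def nm_fps_X nm_fps_const)
  have ev_XYZ: "ev v X = v 0" "ev v Y = v 1" "ev v Z = v 2" for v
    by (simp_all add: X_def Y_def Z_def ev_fps_X ev_fps_const numeral_2_eq_2)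
  define w where "w i = (if i = 0 then X else if i = 1 then Y + cst a * X
      else if i = 2 then Z + cst b * X else 0)" for i :: nat
  have nm_cX: "nm r (cst c * X) \<le> ennreal (\<bar>c\<bar> * r)" for c
    using nm_mult[OF r(1), of "cst c" X] r(1) by (simp add: nm_cst nm_XYZ ennreal_mult)
  have nm_sum: "nm r (T + cst c * X) \<le> ennreal \<rho>"
    if "nm r T = ennreal r" "r + \<bar>c\<bar> * r \<le> \<rho>" for T c
  proof -
    have "nm r (T + cst c * X) \<le> ennreal r + ennreal (\<bar>c\<bar> * r)"
      using nm_add[of r T "cst c * X"] nm_cX[of c] that(1) by (metis add_left_mono order_trans)
    also have "\<dots> = ennreal (r + \<bar>c\<bar> * r)" using r(1) by (simp add: ennreal_plus)
    finally show ?thesis using that(2) by (meson ennreal_leI order_trans)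
  qed
  have nonneg: "0 \<le> \<bar>a\<bar> * r" "0 \<le> \<bar>b\<bar> * r" using r(1) by auto
  have "r \<le> \<rho>" using r(2) nonneg by linarith
  then have "ennreal r \<le> ennreal \<rho>" by (rule ennreal_leI)
  then have w: "nm r (w i) \<le> ennreal \<rho>" for i
    unfolding w_def using nm_sum[of Y a] nm_sum[of Z b] nm_XYZ r nonneg by (auto simp: nm_zero)
  obtain G :: series3 where G: "nm r G \<le> nm \<rho> F"
    "\<And>v. (\<And>i. \<bar>v i\<bar> \<le> r) \<Longrightarrow> ev v G = ev (\<lambda>i. ev v (w i)) F"
    using substitutable_series3[unfolded substitutable_def, rule_format, of r \<rho> w F] r(1) assms w by blast
  have ev_w: "ev v (w i) = shear a b v i" if v: "\<And>i. \<bar>v i\<bar> \<le> r" for v i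
  proof -
    have "nm r (cst c :: series3) < top" for c by (simp add: nm_cst)
    moreover have "nm r (cst c * X) < top" for c using nm_cX[of c] by (rule le_less_trans) simp
    ultimately have "ev v (T + cst c * X) = ev v T + c * v 0" if "nm r T < top" for T c
      using that v r(1) by (simp add: ev_add[of r] ev_mult[of r] nm_XYZ ev_XYZ ev_cst)
    then show ?thesis by (simp add: w_def shear_def ev_XYZ nm_XYZ ev_0)
  qed
  have "nm r G < top" using G(1) assms(2) by (rule le_less_trans)
  moreover have "ev v G = ev (shear a b v) F" if "\<forall>i. \<bar>v i\<bar> \<le> r" for v
    using G(2)[of v] ev_w[of v] that by simp
  ultimately show ?thesis unfolding r_def[symmetric] by blast
qed

definition shear_germ :: "real \<Rightarrow> real \<Rightarrow> series3 germ \<Rightarrow> series3 germ" where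
  "shear_germ a b f = (SOME g. \<forall>\<^sub>F v in near_0. gev v g = gev (shear a b v) f)"

text \<open>The radius is explicit because the choice of a regular direction evaluates the sheared
  germ at one particular point, for which a statement about all sufficiently small points is too
  weak.\<close>

lemma shear_germ_ev_explicit:
  assumes "0 < \<rho>" "nm \<rho> (series f) < top"
  shows "\<forall>v. (\<forall>i. \<bar>v i\<bar> \<le> \<rho> / (1 + \<bar>a\<bar> + \<bar>b\<bar>)) \<longrightarrow> gev v (shear_germ a b f) = gev (shear a b v) f"
proof -
  have r: "0 < \<rho> / (1 + \<bar>a\<bar> + \<bar>b\<bar>)" using assms(1) by (intro divide_pos_pos) auto
  obtain G :: series3 where G: "nm (\<rho> / (1 + \<bar>a\<bar> + \<bar>b\<bar>)) G < top"
    "\<forall>v. (\<forall>i. \<bar>v i\<bar> \<le> \<rho> / (1 + \<bar>a\<bar> + \<bar>b\<bar>)) \<longrightarrow> ev v G = ev (shear a b v) (series f)"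
    using shear_series[OF assms, of a b] by blast
  have series_G: "series (Germ G) = G"
    using convergesI[OF r G(1)] by (simp add: Germ_inverse)
  have near: "\<forall>\<^sub>F v in near_0. gev v (Germ G) = gev (shear a b v) f"
    unfolding eventually_near_0 series_G using r G(2) by blast
  then have "\<forall>\<^sub>F v in near_0. gev v (shear_germ a b f) = gev (shear a b v) f"
    unfolding shear_germ_def by (rule someI)
  with near have "\<forall>\<^sub>F v in near_0. gev v (shear_germ a b f) = gev v (Germ G)"
    by eventually_elim simp
  then have "shear_germ a b f = Germ G" by (rule germ_eqI_near_0)
  then show ?thesis using G(2) series_G by simp
qed

lemma shear_germ_ev: "\<forall>\<^sub>F v in near_0. gev v (shear_germ a b f) = gev (shear a b v) f"
proof -
  obtain \<rho> where \<rho>: "0 < \<rho>" "nm \<rho> (series f) < top"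
    using convergent_series[of f] by (auto simp: converges_def)
  have r: "0 < \<rho> / (1 + \<bar>a\<bar> + \<bar>b\<bar>)" using \<rho>(1) by (intro divide_pos_pos) auto
  show ?thesis
    unfolding eventually_near_0 using shear_germ_ev_explicit[OF \<rho>] r by blast
qed

lemma shear_germ_mult: "shear_germ a b (f * g) = shear_germ a b f * shear_germ a b g"
proof (rule germ_eqI_near_0)
  have "\<forall>\<^sub>F v in near_0. gev (shear a b v) (f * g) = gev (shear a b v) f * gev (shear a b v) g"
    using shear_filterlim[of a b] gev_mult[of f g] unfolding filterlim_iff by blast
  with shear_germ_ev[of a b "f * g"] shear_germ_ev[of a b f] shear_germ_ev[of a b g]
    gev_mult[of "shear_germ a b f" "shear_germ a b g"]
  show "\<forall>\<^sub>F v in near_0. gev v (shear_germ a b (f * g)) = gev v (shear_germ a b f * shear_germ a b g)"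
    by eventually_elim simp
qed

lemma shear_germ_0: "shear_germ a b 0 = 0"
  by (rule germ_eqI_near_0, use shear_germ_ev[of a b 0] in eventually_elim) (simp add: gev_0)

lemma shear_germ_1: "shear_germ a b 1 = 1"
  by (rule germ_eqI_near_0, use shear_germ_ev[of a b 1] in eventually_elim) (simp add: gev_1)

lemma shear_germ_inverse: "shear_germ (- a) (- b) (shear_germ a b f) = f"
proof (rule germ_eqI_near_0)
  have "\<forall>\<^sub>F v in near_0. gev (shear (- a) (- b) v) (shear_germ a b f) = gev (shear a b (shear (- a) (- b) v)) f"
    using shear_filterlim[of "- a" "- b"] shear_germ_ev[of a b f] unfolding filterlim_iff by blast
  with shear_germ_ev[of "- a" "- b" "shear_germ a b f"]
  show "\<forall>\<^sub>F v in near_0. gev v (shear_germ (- a) (- b) (shear_germ a b f)) = gev v f"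
  proof eventually_elim
    case (elim v)
    moreover have "gev (shear a b (shear (- a) (- b) v)) f = gev v f"
      by (rule ev_series3_cong) (simp_all add: shear_def)
    ultimately show ?case by simp
  qed
qed

lemma prime_elem_shear_germ:
  assumes "prime_elem p" shows "prime_elem (shear_germ a b p)"
proof (rule prime_elemI)
  let ?\<phi> = "shear_germ a b" and ?\<psi> = "shear_germ (- a) (- b)"
  have inv: "?\<psi> (?\<phi> f) = f" "?\<phi> (?\<psi> f) = f" for f
    using shear_germ_inverse[of a b f] shear_germ_inverse[of "- a" "- b" f] by simp_all
  have dvd: "?\<psi> f dvd ?\<psi> g" if "f dvd g" for f g
    using that by (elim dvdE) (simp add: shear_germ_mult)
  have dvd': "?\<phi> f dvd ?\<phi> g" if "f dvd g" for f g
    using that by (elim dvdE) (simp add: shear_germ_mult)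
  show "?\<phi> p \<noteq> 0"
    using assms inv(1)[of p] shear_germ_0[of "- a" "- b"] by (auto simp: prime_elem_def)
  show "\<not> ?\<phi> p dvd 1"
    using assms dvd[of "?\<phi> p" 1] by (auto simp: prime_elem_def inv shear_germ_1)
  show "?\<phi> p dvd f \<or> ?\<phi> p dvd g" if "?\<phi> p dvd f * g" for f g
  proof -
    have "p dvd ?\<psi> f * ?\<psi> g" using dvd[OF that] by (simp add: inv shear_germ_mult)
    then have "p dvd ?\<psi> f \<or> p dvd ?\<psi> g" using assms by (simp add: prime_elem_dvd_mult_iff)
    then show ?thesis using dvd'[of p "?\<psi> f"] dvd'[of p "?\<psi> g"] by (auto simp: inv)
  qed
qed

lemma prime_product_shear_germ: "prime_product f \<Longrightarrow> prime_product (shear_germ a b f)"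
proof (induction rule: prime_product.induct)
  case (unit u)
  then obtain k where "1 = u * k" by (rule dvdE)
  then have "1 = shear_germ a b u * shear_germ a b k" by (metis shear_germ_1 shear_germ_mult)
  then show ?case by (intro prime_product.unit) (rule dvdI)
next
  case (step p f)
  then show ?case by (simp add: shear_germ_mult prime_elem_shear_germ prime_product.step)
qed

text \<open>A point \<open>v\<close> with \<open>gev v f \<noteq> 0\<close> and
  \<open>v 0 \<noteq> 0\<close> lies on the image of the outer axis under the shear by
  \<open>v 1 / v 0\<close> and \<open>v 2 / v 0\<close>. The sheared germ does not vanish on the
  axis, so it is regular, and its factorization is sheared back.\<close>

theorem prime_product_series3_germ:
  assumes "(f :: series3 germ) \<noteq> 0" shows "prime_product f"
proof -
  obtain \<rho> where \<rho>: "0 < \<rho>" "nm \<rho> (series f) < top"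
    using convergent_series[of f] by (auto simp: converges_def)
  \<comment> \<open>Three coordinates of size at most \<open>r\<close> add up to at most \<rho>.
    This is exactly what puts the point \<open>e\<close> on the axis inside the polydisc of
    \<open>shear_germ_ev_explicit\<close>.\<close>
  define r where "r = \<rho> / 3"
  have r: "0 < r" "r \<le> \<rho>" using \<rho> by (auto simp: r_def)
  have fin: "nm r (series f) < top" "nm r (fps_X :: series3) < top"
    using nm_finite_mono[OF r \<rho>(2)] by (simp_all add: nm_fps_X)
  \<comment> \<open>The extra factor \<open>fps_X\<close> forces \<open>v 0 \<noteq> 0\<close> at
    the point found next.\<close>
  have "series f * fps_X \<noteq> 0"
    using assms by (metis fps_X_neq_zero mult_eq_0_iff series_inject zero_germ.rep_eq)
  then obtain v where v: "\<And>i. \<bar>v i\<bar> \<le> r" and "ev v (series f * fps_X) \<noteq> 0"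
    using ev_eq_0D[OF r(1) nm_mult_finite[OF r(1) fin]] by blast
  then have nz: "gev v f \<noteq> 0" "v 0 \<noteq> 0"
    using ev_mult[OF r(1) v fin] by (auto simp: ev_fps_X)
  define a b where "a = v 1 / v 0" and "b = v 2 / v 0"
  define e where "e i = (if i = 0 then v 0 else 0)" for i :: nat
  have "\<bar>v 0\<bar> * (1 + \<bar>a\<bar> + \<bar>b\<bar>) = \<bar>v 0\<bar> + \<bar>v 1\<bar> + \<bar>v 2\<bar>"
    using nz(2) by (simp add: a_def b_def distrib_left)
  also have "\<dots> \<le> \<rho>" using v[of 0] v[of 1] v[of 2] by (simp add: r_def)
  finally have "\<bar>v 0\<bar> \<le> \<rho> / (1 + \<bar>a\<bar> + \<bar>b\<bar>)"
    by (subst pos_le_divide_eq) auto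
  then have "\<bar>e i\<bar> \<le> \<rho> / (1 + \<bar>a\<bar> + \<bar>b\<bar>)" for i using \<rho>(1) by (auto simp: e_def)
  then have "gev e (shear_germ a b f) = gev (shear a b e) f"
    using shear_germ_ev_explicit[OF \<rho>] by blast
  also have "\<dots> = gev v f"
    using nz(2) by (intro ev_series3_cong) (simp_all add: shear_def e_def a_def b_def)
  finally have e_nz: "gev e (shear_germ a b f) \<noteq> 0" using nz(1) by simp
  have ex: "\<exists>m. ev0 (series (shear_germ a b f) $ m) \<noteq> 0"
  proof (rule ccontr)
    assume "\<nexists>m. ev0 (series (shear_germ a b f) $ m) \<noteq> 0"
    then have "gev e (shear_germ a b f) = 0" by (simp add: ev_fps_def[of e] e_def)
    with e_nz show False by simp
  qed
  then obtain m where "ev0 (series (shear_germ a b f) $ m) \<noteq> 0" by blast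
  with prime_product_real_fps_fps_germ have "prime_product (shear_germ a b f)"
    by (rule prime_product_regular)
  then have "prime_product (shear_germ (- a) (- b) (shear_germ a b f))"
    by (rule prime_product_shear_germ)
  then show ?thesis by (simp add: shear_germ_inverse)
qed

section \<open>Divisibility by prime factors\<close>

text \<open>The multiplicity is read off the factorization: a prime factor divisible by
  \<open>h\<close> equals \<open>h\<close> up to a unit, and all other factors go into the
  cofactor.\<close>

lemma dvd_power_mult_decomp:
  fixes P :: "'a::idom"
  assumes h: "prime_elem h" and P: "prime_product P"
  shows "\<exists>m u. P = h ^ m * u \<and> \<not> h dvd u"
  using P
proof (induction rule: prime_product.induct)
  case (unit u)
  have "\<not> h dvd u"
  proof
    assume "h dvd u"
    then have "h dvd 1" using unit by (rule dvd_trans)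
    then show False using h by (simp add: prime_elem_def)
  qed
  then show ?case by (intro exI[of _ 0] exI[of _ u]) simp
next
  case (step p a)
  then obtain m u where mu: "a = h ^ m * u" "\<not> h dvd u" by blast
  show ?case
  proof (cases "h dvd p")
    case True
    then obtain c where c: "p = h * c" by (rule dvdE)
    have h0: "h \<noteq> 0" and p0: "p \<noteq> 0" using h step.hyps(1) by (auto simp: prime_elem_def)
    have "p dvd h * c" using c by simp
    then have "p dvd h \<or> p dvd c" using step.hyps(1) by (simp add: prime_elem_dvd_mult_iff)
    then have "c dvd 1"
    proof
      assume "p dvd h"
      then obtain k where "h = p * k" by (rule dvdE)
      then have "h * 1 = h * (c * k)" using c by (metis mult.assoc mult_1_right)
      then have "1 = c * k" using h0 mult_left_cancel[of h 1 "c * k"] by blast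
      then show ?thesis by (rule dvdI)
    next
      assume "p dvd c"
      then obtain k where "c = p * k" by (rule dvdE)
      then have "p * 1 = p * (h * k)" using c by (metis mult.left_commute mult_1_right)
      then have "1 = h * k" using p0 mult_left_cancel[of p 1 "h * k"] by blast
      then have "h dvd 1" by (rule dvdI)
      then show ?thesis using h by (simp add: prime_elem_def)
    qed
    then obtain d where d: "1 = c * d" by (rule dvdE)
    have "\<not> h dvd c * u"
    proof
      assume "h dvd c * u"
      then have "h dvd d * (c * u)" by (rule dvd_mult)
      also have "d * (c * u) = u" using d by (metis mult.assoc mult.commute mult_1)
      finally show False using mu(2) by simp
    qed
    then show ?thesis
      using mu(1) c by (intro exI[of _ "Suc m"] exI[of _ "c * u"]) (simp add: mult_ac)
  next
    case False
    then have "\<not> h dvd p * u" using h mu(2) by (simp add: prime_elem_dvd_mult_iff)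
    then show ?thesis using mu(1) by (intro exI[of _ m] exI[of _ "p * u"]) (simp add: mult_ac)
  qed
qed

locale derivation =
  fixes d :: "'a::idom \<Rightarrow> 'a"
  assumes d_add: "d (a + b) = d a + d b"
    and d_mult: "d (a * b) = d a * b + a * d b"
begin

lemma d_1: "d 1 = 0"
  using d_mult[of 1 1] by (metis add_cancel_right_right mult_1 mult_1_right)

text \<open>The factor \<open>h\<close> on the left avoids the exponent \<open>m - 1\<close> and so
  includes \<open>m = 0\<close>.\<close>

lemma d_power: "h * d (h ^ m) = of_nat m * h ^ m * d h"
  by (induction m) (simp_all add: d_1 d_mult algebra_simps)

lemma d_power_Suc: "d (h ^ Suc m) = of_nat (Suc m) * h ^ m * d h"
  using d_power[of h m] by (simp add: d_mult algebra_simps)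

end

text \<open>If \<open>h\<close> occurs in \<open>P\<close> with multiplicity \<open>m\<close> and does not divide its derivative, then
  the terms \<open>2 P P'' - 3 P'\<^sup>2\<close> have the exact multiplicity \<open>2 m - 2\<close>, because
  \<open>2 m (m - 1) - 3 m\<^sup>2 = - m (m + 2) \<noteq> 0\<close>. All other terms have higher multiplicity.\<close>

lemma prime_dvd_derivation:
  fixes h P Q :: "'a::idom"
  assumes "derivation d" and "derivation d'"
    and char: "\<And>n. 0 < n \<Longrightarrow> (of_nat n :: 'a) dvd 1"
    and h: "prime_elem h" "h dvd P" "\<not> h dvd Q" and P: "prime_product P"
    and eq: "Q ^ 3 * (2 * P * d (d P) - 3 * (d P)\<^sup>2) + P * d P * B + P\<^sup>2 * C + P * d' P * E = 0"
  shows "h dvd d h"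
proof -
  interpret d: derivation d by fact
  interpret d': derivation d' by fact
  obtain m u where mu: "P = h ^ m * u" "\<not> h dvd u" using dvd_power_mult_decomp[OF h(1) P] by blast
  then obtain k where k: "m = Suc k" using h(2) by (cases m) auto
  have h0: "h \<noteq> 0" using h(1) by (simp add: prime_elem_def)
  have not_dvd_nat: "\<not> h dvd of_nat n" if "0 < n" for n
    using char[OF that] h(1) dvd_trans by (auto simp: prime_elem_def)
  \<comment> \<open>\<open>a\<close> is the cofactor of \<open>h ^ k\<close> in \<open>d P\<close>;
    modulo \<open>h\<close> it is \<open>of_nat (Suc k) * d h * u\<close>, where
    \<open>Suc k\<close> is the multiplicity of \<open>h\<close> in \<open>P\<close>.\<close>
  define a where "a = of_nat (Suc k) * d h * u + h * d u"
  have dP: "d P = h ^ k * a"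
    unfolding mu(1) k d.d_mult d.d_power_Suc a_def by (simp add: algebra_simps)
  have d'P: "d' P = h ^ k * (of_nat (Suc k) * d' h * u + h * d' u)"
    unfolding mu(1) k d'.d_mult d'.d_power_Suc by (simp add: algebra_simps)
  define b where "b = of_nat (Suc k) * d' h * u + h * d' u"
  have hddP: "h * d (d P) = h ^ k * (of_nat k * d h * a + h * d a)"
  proof -
    have "h * d (d P) = (h * d (h ^ k)) * a + h * h ^ k * d a"
      unfolding dP d.d_mult by (simp add: algebra_simps)
    then show ?thesis unfolding d.d_power by (simp add: algebra_simps)
  qed
  have PddP: "P * d (d P) = h ^ k * h ^ k * (u * (of_nat k * d h * a + h * d a))"
  proof -
    have "P * d (d P) = h ^ k * u * (h * d (d P))" unfolding mu(1) k by (simp add: mult_ac)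
    then show ?thesis unfolding hddP by (simp add: mult_ac)
  qed
  have P_eq: "P = h ^ k * (h * u)" by (simp add: mu(1) k mult_ac)
  define H where "H = h ^ k"
  define W where "W = of_nat k * d h * a + h * d a"
  define X where "X = P * d (d P)"
  define Y where "Y = d P"
  define Z where "Z = d' P"
  have X: "X = H * H * (u * W)" unfolding X_def PddP H_def W_def ..
  have Y: "Y = H * a" unfolding Y_def dP H_def ..
  have Z: "Z = H * b" unfolding Z_def d'P H_def b_def ..
  have "0 = Q ^ 3 * (2 * X - 3 * Y\<^sup>2) + P * Y * B + P\<^sup>2 * C + P * Z * E"
    using eq by (simp add: X_def Y_def Z_def mult.assoc)
  also have "\<dots> = Q ^ 3 * (2 * (H * H * (u * W)) - 3 * (H * a)\<^sup>2) + (H * (h * u)) * (H * a) * B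
      + (H * (h * u))\<^sup>2 * C + (H * (h * u)) * (H * b) * E"
    unfolding X Y Z P_eq[folded H_def] ..
  also have "\<dots> = H * H * (Q ^ 3 * (2 * (u * W) - 3 * a\<^sup>2)
      + h * (u * a * B) + h * (h * u\<^sup>2 * C) + h * (u * b * E))"
    by algebra
  also have "\<dots> = h ^ k * h ^ k * (Q ^ 3 * (2 * (u * (of_nat k * d h * a + h * d a)) - 3 * a\<^sup>2)
      + h * (u * a * B) + h * (h * u\<^sup>2 * C) + h * (u * b * E))"
    by (simp only: H_def W_def)
  finally have "Q ^ 3 * (2 * (u * (of_nat k * d h * a + h * d a)) - 3 * a\<^sup>2)
      + h * (u * a * B) + h * (h * u\<^sup>2 * C) + h * (u * b * E) = 0"
    using h0 by simp
  moreover have "a = (of_nat k + 1) * d h * u + h * d u" by (simp add: a_def algebra_simps)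
  \<comment> \<open>Multiplied by \<open>k + 1\<close>, the second-derivative term becomes
    \<open>2 * k * a\<^sup>2\<close> modulo \<open>h\<close>, by the congruence for
    \<open>a\<close>. Together with \<open>- 3 * (k + 1) * a\<^sup>2\<close> this gives the
    coefficient \<open>- (k + 3)\<close>.\<close>
  ultimately have "(of_nat k + 3) * (Q ^ 3 * a\<^sup>2) =
      h * ((of_nat k + 1) * (Q ^ 3 * 2 * u * d a + u * a * B + h * u\<^sup>2 * C + u * b * E) - Q ^ 3 * 2 * of_nat k * d u * a)"
    by algebra
  then have "of_nat (k + 3) * (Q ^ 3 * a\<^sup>2) =
      h * ((of_nat k + 1) * (Q ^ 3 * 2 * u * d a + u * a * B + h * u\<^sup>2 * C + u * b * E) - Q ^ 3 * 2 * of_nat k * d u * a)"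
    by simp
  then have "h dvd of_nat (k + 3) * (Q ^ 3 * a\<^sup>2)" by (rule dvdI)
  then have "h dvd a"
    using not_dvd_nat[of "k + 3"] h(3) prime_elem_dvd_power[OF h(1)]
    by (auto simp: prime_elem_dvd_mult_iff[OF h(1)] simp del: of_nat_add)
  then have "h dvd a - h * d u" by simp
  then have "h dvd of_nat (Suc k) * d h * u" by (simp add: a_def)
  then show ?thesis
    using not_dvd_nat[of "Suc k"] mu(2) by (auto simp: prime_elem_dvd_mult_iff[OF h(1)] simp del: of_nat_Suc)
qed

text \<open>By the product rule the property of dividing one's own derivative passes from the prime
  factors to the product, with multiplicities.\<close>

lemma prime_product_dvd_derivation:
  fixes P :: "'a::idom"
  assumes "derivation d" and "prime_product P'"
    and "\<And>h. prime_elem h \<Longrightarrow> h dvd P' \<Longrightarrow> h dvd d h"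
  shows "P' dvd d P'"
  using assms(2,3)
proof (induction rule: prime_product.induct)
  case (unit u)
  then show ?case by (meson dvd_trans one_dvd)
next
  case (step p a)
  interpret derivation d by fact
  have "p dvd d p" using step.prems[of p] step.hyps(1) by simp
  moreover have "a dvd d a"
    by (rule step.IH) (rule step.prems, assumption, erule dvd_mult)
  ultimately show ?case
    unfolding d_mult by (intro dvd_add mult_dvd_mono dvd_refl)
qed

lemma coprime_dvd_derivation:
  fixes P Q :: "'a::idom"
  assumes "derivation d" and "derivation d'"
    and "\<And>n. 0 < n \<Longrightarrow> (of_nat n :: 'a) dvd 1" and "prime_product P"
    and "\<And>h. prime_elem h \<Longrightarrow> h dvd P \<Longrightarrow> \<not> h dvd Q"
    and "Q ^ 3 * (2 * P * d (d P) - 3 * (d P)\<^sup>2) + P * d P * B + P\<^sup>2 * C + P * d' P * E = 0"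
  shows "P dvd d P"
  by (rule prime_product_dvd_derivation[OF assms(1,4)])
     (rule prime_dvd_derivation[OF assms(1-3) _ _ assms(5) assms(4,6)])

section \<open>Germs of analytic functions\<close>

lift_definition gdv :: "nat \<Rightarrow> 'a::analytic_coeff germ \<Rightarrow> 'a germ" is dv
  by (rule converges_dv)

lemma derivation_gdv: "derivation (gdv i)"
  by unfold_locales (transfer, simp add: dv_add dv_mult)+

lemma of_nat_germ_dvd_1: "0 < (n::nat) \<Longrightarrow> (of_nat n :: 'a::analytic_coeff germ) dvd 1"
proof -
  assume n: "0 < n"
  have "series (of_nat n :: 'a germ) = cst (real n)"
    by (induction n) (simp_all add: zero_germ.rep_eq plus_germ.rep_eq one_germ.rep_eq cst_0 cst_1 cst_add)
  then show ?thesis using n by (simp add: germ_dvd_1_iff ev_cst)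
qed

lemma gev_bounded: "\<exists>B. \<forall>\<^sub>F v in near_0. \<bar>gev v f\<bar> \<le> B"
proof -
  obtain r where r: "0 < r" "nm r (series f) < top"
    using convergent_series[of f] by (auto simp: converges_def)
  have "\<bar>gev v f\<bar> \<le> enn2real (nm r (series f))" if "\<forall>i. \<bar>v i\<bar> \<le> r" for v
  proof -
    have "ennreal \<bar>gev v f\<bar> \<le> ennreal (enn2real (nm r (series f)))"
      using ev_le_nm[of r v "series f"] r that by simp
    then show ?thesis by (simp add: ennreal_le_iff)
  qed
  then show ?thesis unfolding eventually_near_0 using r(1) by blast
qed

definition germ_radius :: "'a::analytic_coeff germ \<Rightarrow> real" where
  "germ_radius f = (SOME r. 0 < r \<and> nm r (series f) < top)"

lemma germ_radius: "0 < germ_radius f" "nm (germ_radius f) (series f) < top"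
  using someI_ex[OF convergent_series[of f, unfolded converges_def]] unfolding germ_radius_def by auto

text \<open>One variable is added to the unordered sum over multi-indices, \<open>A\<close> being
  the index set of the inner variables. The bound on finite partial sums travels along because it
  supplies the absolute summability needed to merge an iterated sum into a single one.\<close>

lemma has_sum_fps_step:
  fixes F :: "'a::analytic_coeff fps" and g :: "nat \<Rightarrow> 'b \<Rightarrow> real"
  assumes r: "0 < r" and v: "\<And>i. \<bar>v i\<bar> \<le> r" and F: "nm r F < top"
    and sums: "\<And>n. (g n has_sum ev (\<lambda>i. v (Suc i)) (F $ n)) A"
    and bound: "\<And>n T. finite T \<Longrightarrow> T \<subseteq> A \<Longrightarrow> ennreal (\<Sum>y\<in>T. \<bar>g n y\<bar>) \<le> nm r (F $ n)"
  shows "((\<lambda>(n, y). g n y * v 0 ^ n) has_sum ev v F) (UNIV \<times> A)"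
    and "\<And>T. finite T \<Longrightarrow> T \<subseteq> UNIV \<times> A \<Longrightarrow> ennreal (\<Sum>z\<in>T. \<bar>(\<lambda>(n, y). g n y * v 0 ^ n) z\<bar>) \<le> nm r F"
proof -
  have bd: "ennreal (\<Sum>(n, y)\<in>T. \<bar>g n y * v 0 ^ n\<bar>) \<le> nm r F" if T: "finite T" "T \<subseteq> UNIV \<times> A" for T
  proof -
    have "finite (fst ` T)" using T(1) by simp
    then obtain N where N: "\<forall>n\<in>fst ` T. n < N" using finite_nat_set_iff_bounded by blast
    define S where "S = snd ` T"
    have S: "finite S" "S \<subseteq> A" using T by (auto simp: S_def)
    have "T \<subseteq> {..<N} \<times> S" using N by (force simp: S_def)
    then have "(\<Sum>(n, y)\<in>T. \<bar>g n y * v 0 ^ n\<bar>) \<le> (\<Sum>(n, y)\<in>{..<N} \<times> S. \<bar>g n y * v 0 ^ n\<bar>)"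
      using S by (intro sum_mono2) auto
    also have "\<dots> = (\<Sum>n<N. (\<Sum>y\<in>S. \<bar>g n y\<bar>) * \<bar>v 0\<bar> ^ n)"
      by (simp add: sum.cartesian_product[symmetric] abs_mult power_abs sum_distrib_right)
    finally have "ennreal (\<Sum>(n, y)\<in>T. \<bar>g n y * v 0 ^ n\<bar>) \<le> ennreal (\<Sum>n<N. (\<Sum>y\<in>S. \<bar>g n y\<bar>) * \<bar>v 0\<bar> ^ n)"
      by (rule ennreal_leI)
    also have "\<dots> = (\<Sum>n<N. ennreal (\<Sum>y\<in>S. \<bar>g n y\<bar>) * ennreal (\<bar>v 0\<bar> ^ n))"
    proof -
      have "ennreal (\<Sum>y\<in>S. \<bar>g n y\<bar>) * ennreal (\<bar>v 0\<bar> ^ n) = ennreal ((\<Sum>y\<in>S. \<bar>g n y\<bar>) * \<bar>v 0\<bar> ^ n)" for n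
        by (rule ennreal_mult[symmetric]) (auto intro: sum_nonneg)
      then show ?thesis
        by (simp only:) (rule sum_ennreal[symmetric], auto intro!: mult_nonneg_nonneg sum_nonneg)
    qed
    also have "\<dots> \<le> (\<Sum>n<N. nm r (F $ n) * ennreal r ^ n)"
      using v[of 0] r S by (intro sum_mono mult_mono bound) (auto simp: ennreal_power intro!: ennreal_leI power_mono)
    also have "\<dots> \<le> nm r F"
      unfolding nm_fps_def nm2_def by (rule ennreal_sum_le_suminf)
    finally show ?thesis .
  qed
  then show "ennreal (\<Sum>z\<in>T. \<bar>(\<lambda>(n, y). g n y * v 0 ^ n) z\<bar>) \<le> nm r F"
    if "finite T" "T \<subseteq> UNIV \<times> A" for T
    using that by (simp add: case_prod_unfold)
  have abs: "summable (\<lambda>n. \<bar>ev (\<lambda>i. v (Suc i)) (F $ n) * v 0 ^ n\<bar>)"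
    by (rule ev_fps_summable[OF r _ F]) (rule v)
  have outer: "((\<lambda>n. ev (\<lambda>i. v (Suc i)) (F $ n) * v 0 ^ n) has_sum ev v F) UNIV"
    unfolding ev_fps_def using abs
    by (intro norm_summable_imp_has_sum) (auto intro: summable_sums summable_rabs_cancel)
  have "(\<lambda>z. norm ((\<lambda>(n, y). g n y * v 0 ^ n) z)) summable_on UNIV \<times> A"
  proof (rule nonneg_bdd_above_summable_on)
    show "bdd_above (sum (\<lambda>z. norm ((\<lambda>(n, y). g n y * v 0 ^ n) z)) ` {T. T \<subseteq> UNIV \<times> A \<and> finite T})"
    proof (rule bdd_aboveI2)
      fix T :: "(nat \<times> 'b) set" assume "T \<in> {T. T \<subseteq> UNIV \<times> A \<and> finite T}"
      then have "ennreal (\<Sum>z\<in>T. norm ((\<lambda>(n, y). g n y * v 0 ^ n) z)) \<le> ennreal (enn2real (nm r F))"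
        using bd[of T] F by (simp add: case_prod_unfold)
      then show "(\<Sum>z\<in>T. norm ((\<lambda>(n, y). g n y * v 0 ^ n) z)) \<le> enn2real (nm r F)"
        by (simp add: ennreal_le_iff)
    qed
  qed auto
  then have "(\<lambda>(n, y). g n y * v 0 ^ n) summable_on UNIV \<times> A"
    by (rule abs_summable_summable)
  then show "((\<lambda>(n, y). g n y * v 0 ^ n) has_sum ev v F) (UNIV \<times> A)"
    by (intro has_sum_SigmaI[OF _ outer]) (auto intro: has_sum_cmult_left sums)
qed

text \<open>There is one \<open>nat\<close> per use of \<open>has_sum_fps_step\<close>; the final
  \<open>unit\<close> is the index set for series in no variables, where the iteration
  starts.\<close>

definition exponent3 :: "nat \<times> nat \<times> nat \<times> unit \<Rightarrow> 3 \<Rightarrow> nat" where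
  "exponent3 = (\<lambda>(i, j, k, _) a. if a = 1 then i else if a = 2 then j else k)"

lemma exponent3_simps [simp]:
  "exponent3 (i, j, k, u) 1 = i" "exponent3 (i, j, k, u) 2 = j" "exponent3 (i, j, k, u) 3 = k"
  by (simp_all add: exponent3_def)

lemma bij_exponent3: "bij exponent3"
proof (rule bijI)
  show "inj exponent3"
  proof (rule injI)
    fix x y assume "exponent3 x = exponent3 y"
    then have "exponent3 x 1 = exponent3 y 1" "exponent3 x 2 = exponent3 y 2" "exponent3 x 3 = exponent3 y 3" by simp_all
    then show "x = y" by (cases x; cases y) simp
  qed
  have "\<alpha> = exponent3 (\<alpha> 1, \<alpha> 2, \<alpha> 3, ())" for \<alpha>
  proof
    show "\<alpha> a = exponent3 (\<alpha> 1, \<alpha> 2, \<alpha> 3, ()) a" for a :: 3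
      using exhaust_3[of a] by auto
  qed
  then show "surj exponent3" by (rule surjI[OF sym])
qed

definition coeff3 :: "series3 \<Rightarrow> (3 \<Rightarrow> nat) \<Rightarrow> real" where
  "coeff3 F \<alpha> = F $ \<alpha> 1 $ \<alpha> 2 $ \<alpha> 3"

definition series_of_coeff3 :: "((3 \<Rightarrow> nat) \<Rightarrow> real) \<Rightarrow> series3" where
  "series_of_coeff3 c = Abs_fps (\<lambda>i. Abs_fps (\<lambda>j. Abs_fps (\<lambda>k. c (exponent3 (i, j, k, ())))))"

lemma coeff3_series_of_coeff3: "coeff3 (series_of_coeff3 c) = c"
proof
  fix \<alpha> :: "3 \<Rightarrow> nat"
  have "exponent3 (\<alpha> 1, \<alpha> 2, \<alpha> 3, ()) = \<alpha>"
  proof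
    show "exponent3 (\<alpha> 1, \<alpha> 2, \<alpha> 3, ()) a = \<alpha> a" for a :: 3
      using exhaust_3[of a] by auto
  qed
  then show "coeff3 (series_of_coeff3 c) \<alpha> = c \<alpha>"
    by (simp add: coeff3_def series_of_coeff3_def)
qed

lemma has_sum_series3:
  fixes F :: series3
  assumes r: "0 < r" and v: "\<And>i. \<bar>v i\<bar> \<le> r" and F: "nm r F < top"
  shows "((\<lambda>\<alpha>. coeff3 F \<alpha> * (v 0 ^ \<alpha> 1 * v 1 ^ \<alpha> 2 * v 2 ^ \<alpha> 3)) has_sum ev v F) UNIV"
proof -
  let ?v1 = "\<lambda>i. v (Suc i)" and ?v2 = "\<lambda>i. v (Suc (Suc i))" and ?v3 = "\<lambda>i. v (Suc (Suc (Suc i)))"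
  have F1: "nm r (F $ i) < top" for i by (rule nm_fps_nth_finite[OF r F])
  have F2: "nm r (F $ i $ j) < top" for i j by (rule nm_fps_nth_finite[OF r F1])
  have s0: "((\<lambda>_::unit. F $ i $ j $ k) has_sum ev ?v3 (F $ i $ j $ k)) UNIV" for i j k
    using has_sum_finite[of "UNIV :: unit set" "\<lambda>_. F $ i $ j $ k"] by (simp add: ev_real_def UNIV_unit)
  have b0: "ennreal (\<Sum>y\<in>T. \<bar>F $ i $ j $ k\<bar>) \<le> nm r (F $ i $ j $ k)" for i j k and T :: "unit set"
  proof -
    have "T = {} \<or> T = {()}" by (cases "() \<in> T") auto
    then show ?thesis by (auto simp: nm_real_def)
  qed
  note step1 = has_sum_fps_step[where v = ?v2, OF r v F2 s0 b0]
  note step2 = has_sum_fps_step[where v = ?v1, OF r v F1 step1]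
  note step3 = has_sum_fps_step(1)[where v = v, OF r v F step2]
  have "((\<lambda>(i, j, k, u::unit). F $ i $ j $ k * v 2 ^ k * v 1 ^ j * v 0 ^ i) has_sum ev v F) UNIV"
    using step3 by (simp add: case_prod_unfold numeral_2_eq_2)
  also have "(\<lambda>(i, j, k, u::unit). F $ i $ j $ k * v 2 ^ k * v 1 ^ j * v 0 ^ i) =
      (\<lambda>\<alpha>. coeff3 F \<alpha> * (v 0 ^ \<alpha> 1 * v 1 ^ \<alpha> 2 * v 2 ^ \<alpha> 3)) \<circ> exponent3"
    by (auto simp: fun_eq_iff coeff3_def)
  finally show ?thesis
    unfolding has_sum_reindex[OF bij_is_inj[OF bij_exponent3], symmetric] bij_is_surj[OF bij_exponent3] .
qed

text \<open>The bound holds on finite boxes of multi-indices and passes to the infinite sums one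
  variable at a time, the innermost first.\<close>

lemma nm_series3_le:
  fixes F :: series3
  assumes r: "0 < r" and B: "\<And>T. finite T \<Longrightarrow> (\<Sum>\<alpha>\<in>T. \<bar>coeff3 F \<alpha>\<bar> * r ^ (\<alpha> 1 + \<alpha> 2 + \<alpha> 3)) \<le> B"
  shows "nm r F \<le> ennreal B"
proof -
  define a where "a i j k = ennreal (\<bar>F $ i $ j $ k\<bar> * r ^ (i + j + k))" for i j k
  have nm_eq: "nm r F = (\<Sum>i. \<Sum>j. \<Sum>k. a i j k)"
    unfolding nm_fps_def nm2_def nm_real_def a_def ennreal_suminf_multc[symmetric] using r
    by (simp add: ennreal_mult ennreal_power power_add mult_ac)
  have "(\<Sum>i<L. \<Sum>j<M. \<Sum>k<N. a i j k) \<le> ennreal B" for L M N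
  proof -
    have "(\<Sum>i<L. \<Sum>j<M. \<Sum>k<N. a i j k) =
        (\<Sum>x\<in>{..<L} \<times> {..<M} \<times> {..<N}. ennreal (\<bar>F $ fst x $ fst (snd x) $ snd (snd x)\<bar> * r ^ (fst x + fst (snd x) + snd (snd x))))"
      by (simp add: a_def sum.cartesian_product case_prod_unfold)
    also have "\<dots> = ennreal (\<Sum>x\<in>{..<L} \<times> {..<M} \<times> {..<N}. \<bar>F $ fst x $ fst (snd x) $ snd (snd x)\<bar> * r ^ (fst x + fst (snd x) + snd (snd x)))"
      using r by (intro sum_ennreal) auto
    also have "(\<Sum>x\<in>{..<L} \<times> {..<M} \<times> {..<N}. \<bar>F $ fst x $ fst (snd x) $ snd (snd x)\<bar> * r ^ (fst x + fst (snd x) + snd (snd x)))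
        = (\<Sum>\<alpha>\<in>(\<lambda>(i, j, k). exponent3 (i, j, k, ())) ` ({..<L} \<times> {..<M} \<times> {..<N}). \<bar>coeff3 F \<alpha>\<bar> * r ^ (\<alpha> 1 + \<alpha> 2 + \<alpha> 3))"
      using bij_is_inj[OF bij_exponent3]
      by (subst sum.reindex) (auto simp: inj_on_def coeff3_def case_prod_unfold)
    also have "ennreal \<dots> \<le> ennreal B" by (intro ennreal_leI B) auto
    finally show ?thesis .
  qed
  then have "(\<Sum>k. \<Sum>i<L. \<Sum>j<M. a i j k) \<le> ennreal B" for L M
    by (intro ennreal_suminf_le) (subst sum.swap, subst sum.swap[of _ "{..<M}"], simp)
  then have "(\<Sum>i<L. \<Sum>j<M. \<Sum>k. a i j k) \<le> ennreal B" for L M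
    by (simp add: suminf_sum summableI)
  then have "(\<Sum>j. \<Sum>i<L. \<Sum>k. a i j k) \<le> ennreal B" for L
    by (intro ennreal_suminf_le) (subst sum.swap, simp)
  then have "(\<Sum>i<L. \<Sum>j. \<Sum>k. a i j k) \<le> ennreal B" for L
    by (simp add: suminf_sum summableI)
  then show ?thesis unfolding nm_eq by (rule ennreal_suminf_le)
qed

section \<open>Functions on \<open>real^3\<close> and their germs\<close>

unbundle no fps_syntax
unbundle vec_syntax

text \<open>Indices above 2 get the value 0, so that a bound on the norm bounds all indices.\<close>

definition coord :: "real^3 \<Rightarrow> nat \<Rightarrow> real" where
  "coord x = (\<lambda>i. if i = 0 then x $ 1 else if i = 1 then x $ 2 else if i = 2 then x $ 3 else 0)"

definition point :: "(nat \<Rightarrow> real) \<Rightarrow> real^3" where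
  "point v = vector [v 0, v 1, v 2]"

definition index :: "3 \<Rightarrow> nat" where
  "index i = (if i = 1 then 0 else if i = 2 then 1 else 2)"

lemma coord_simps: "coord x 0 = x $ 1" "coord x 1 = x $ 2" "coord x 2 = x $ 3"
  by (simp_all add: coord_def)

lemma coord_le_norm: "\<bar>coord x i\<bar> \<le> norm x"
  by (simp add: coord_def component_le_norm_cart)

lemma filterlim_coord: "filterlim (\<lambda>x. coord (x - p)) near_0 (nhds p)"
  unfolding filterlim_iff
proof (intro allI impI)
  fix P assume "eventually P near_0"
  then obtain r where r: "0 < r" "\<And>v. (\<And>i. \<bar>v i\<bar> \<le> r) \<Longrightarrow> P v" unfolding eventually_near_0 by blast
  have "P (coord (x - p))" if "dist x p < r" for x
    using that order_trans[OF coord_le_norm, of "x - p" r] by (intro r(2)) (simp add: dist_norm)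
  then show "\<forall>\<^sub>F x in nhds p. P (coord (x - p))"
    unfolding eventually_nhds_metric using r(1) by blast
qed

lemma norm_point_le: "norm (point v) \<le> \<bar>v 0\<bar> + \<bar>v 1\<bar> + \<bar>v 2\<bar>"
  using norm_le_l1_cart[of "point v"] by (simp add: point_def sum_3)

lemma filterlim_point: "filterlim (\<lambda>v. p + point v) (nhds p) near_0"
  unfolding filterlim_iff
proof (intro allI impI)
  fix P assume "eventually P (nhds p)"
  then obtain d where d: "0 < d" "\<And>x. dist x p < d \<Longrightarrow> P x" unfolding eventually_nhds_metric by blast
  have "P (p + point v)" if v: "\<forall>i. \<bar>v i\<bar> \<le> d / 4" for v
  proof (rule d(2))
    have "\<bar>v 0\<bar> \<le> d / 4" "\<bar>v 1\<bar> \<le> d / 4" "\<bar>v 2\<bar> \<le> d / 4" using v by auto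
    then show "dist (p + point v) p < d"
      using norm_point_le[of v] d(1) unfolding dist_norm by simp
  qed
  then show "\<forall>\<^sub>F v in near_0. P (p + point v)"
    unfolding eventually_near_0 using d(1) by (intro exI[of _ "d / 4"]) auto
qed

lemma gev_coord_point: "gev (coord (point v)) F = gev v (F :: series3 germ)"
  by (rule ev_series3_cong) (simp_all add: coord_def point_def)

definition has_germ :: "(real^3 \<Rightarrow> real) \<Rightarrow> real^3 \<Rightarrow> series3 germ \<Rightarrow> bool" where
  "has_germ f p F \<longleftrightarrow> (\<forall>\<^sub>F x in nhds p. f x = gev (coord (x - p)) F)"

lemma has_germ_unique:
  assumes "has_germ f p F" "has_germ f p G" shows "F = G"
proof (rule germ_eqI_near_0)
  have "\<forall>\<^sub>F x in nhds p. gev (coord (x - p)) F = gev (coord (x - p)) G"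
    using assms unfolding has_germ_def by eventually_elim simp
  then have "\<forall>\<^sub>F v in near_0. gev (coord (p + point v - p)) F = gev (coord (p + point v - p)) G"
    using filterlim_point[of p] unfolding filterlim_iff by blast
  then show "\<forall>\<^sub>F v in near_0. gev v F = gev v G" by (simp add: gev_coord_point)
qed

lemma has_germ_cong: "has_germ f p F \<Longrightarrow> \<forall>\<^sub>F x in nhds p. f x = g x \<Longrightarrow> has_germ g p F"
  unfolding has_germ_def by (erule (1) eventually_elim2) simp

lemma has_germ_gev: "has_germ (\<lambda>x. gev (coord (x - p)) F) p F"
  by (simp add: has_germ_def)

lemma has_germ_add:
  assumes "has_germ f p F" "has_germ g p G" shows "has_germ (\<lambda>x. f x + g x) p (F + G)"
proof -
  have "\<forall>\<^sub>F x in nhds p. gev (coord (x - p)) (F + G) = gev (coord (x - p)) F + gev (coord (x - p)) G"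
    using filterlim_coord[of p] gev_add[of F G] unfolding filterlim_iff by blast
  then show ?thesis using assms unfolding has_germ_def by eventually_elim simp
qed

lemma has_germ_mult:
  assumes "has_germ f p F" "has_germ g p G" shows "has_germ (\<lambda>x. f x * g x) p (F * G)"
proof -
  have "\<forall>\<^sub>F x in nhds p. gev (coord (x - p)) (F * G) = gev (coord (x - p)) F * gev (coord (x - p)) G"
    using filterlim_coord[of p] gev_mult[of F G] unfolding filterlim_iff by blast
  then show ?thesis using assms unfolding has_germ_def by eventually_elim simp
qed

lemma has_germ_minus:
  assumes "has_germ f p F" shows "has_germ (\<lambda>x. - f x) p (- F)"
proof -
  have "\<forall>\<^sub>F x in nhds p. gev (coord (x - p)) (- F) = - gev (coord (x - p)) F"
    using filterlim_coord[of p] gev_minus[of F] unfolding filterlim_iff by blast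
  then show ?thesis using assms unfolding has_germ_def by eventually_elim simp
qed

lemma has_germ_diff:
  "has_germ f p F \<Longrightarrow> has_germ g p G \<Longrightarrow> has_germ (\<lambda>x. f x - g x) p (F - G)"
  using has_germ_add[of f p F "\<lambda>x. - g x" "- G"] has_germ_minus[of g p G] by simp

lemma has_germ_of_nat: "has_germ (\<lambda>_. of_nat n) p (of_nat n)"
proof (induction n)
  case (Suc n)
  have "has_germ (\<lambda>_. 1) p 1" by (simp add: has_germ_def gev_1)
  from has_germ_add[OF this Suc] show ?case by simp
qed (simp add: has_germ_def gev_0)

lemma has_germ_numeral: "has_germ (\<lambda>_. numeral n) p (numeral n)"
  using has_germ_of_nat[of "numeral n"] by simp

lemma has_germ_power: "has_germ f p F \<Longrightarrow> has_germ (\<lambda>x. f x ^ n) p (F ^ n)"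
  by (induction n) (use has_germ_of_nat[of 1] in \<open>auto intro: has_germ_mult\<close>)

lemmas has_germ_intros = has_germ_add has_germ_mult has_germ_minus has_germ_diff has_germ_numeral has_germ_power

text \<open>The expansion is used at one point whose three offsets from \<open>p\<close> all equal
  \<open>r\<close>. Unordered real sums converge absolutely, so its summability there is finiteness
  of the norm of radius \<open>r\<close>.\<close>

lemma real_analytic_at_imp_has_germ:
  assumes "real_analytic_at f p"
  obtains F where "has_germ f p F"
proof -
  obtain c where "\<forall>\<^sub>F x in nhds p. ((\<lambda>\<alpha>. c \<alpha> * (\<Prod>i\<in>UNIV. (x $ i - p $ i) ^ \<alpha> i)) has_sum f x) UNIV"
    using assms unfolding real_analytic_at_def by blast
  then obtain d where d: "0 < d" "\<And>x. dist x p < d \<Longrightarrow>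
      ((\<lambda>\<alpha>. c \<alpha> * (\<Prod>i\<in>UNIV. (x $ i - p $ i) ^ \<alpha> i)) has_sum f x) UNIV"
    unfolding eventually_nhds_metric by blast
  have prod3: "(\<Prod>i\<in>UNIV. g i) = g 1 * g 2 * g 3" for g :: "3 \<Rightarrow> real"
    unfolding UNIV_3 by simp
  \<comment> \<open>The point with all offsets \<open>r\<close> has distance at most
    \<open>3 * r\<close> from \<open>p\<close>, which is less than \<open>d\<close>.\<close>
  define r where "r = d / 4"
  have r: "0 < r" using d by (simp add: r_def)
  define y where "y = p + point (\<lambda>_. r)"
  have "dist y p < d"
    using norm_point_le[of "\<lambda>_. r"] r d(1) unfolding y_def dist_norm r_def by simp
  from d(2)[OF this] have "((\<lambda>\<alpha>. c \<alpha> * (r ^ \<alpha> 1 * r ^ \<alpha> 2 * r ^ \<alpha> 3)) has_sum f y) UNIV"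
    by (simp add: prod3 y_def point_def)
  then have "(\<lambda>\<alpha>. c \<alpha> * (r ^ \<alpha> 1 * r ^ \<alpha> 2 * r ^ \<alpha> 3)) summable_on UNIV"
    by (rule has_sum_imp_summable)
  then have "(\<lambda>\<alpha>. \<bar>c \<alpha> * (r ^ \<alpha> 1 * r ^ \<alpha> 2 * r ^ \<alpha> 3)\<bar>) summable_on UNIV"
    using summable_on_iff_abs_summable_on_real by fastforce
  then have abs: "(\<lambda>\<alpha>. \<bar>c \<alpha>\<bar> * r ^ (\<alpha> 1 + \<alpha> 2 + \<alpha> 3)) summable_on UNIV"
    using r by (simp add: abs_mult power_add)
  define F where "F = series_of_coeff3 c"
  define B where "B = (\<Sum>\<^sub>\<infinity>\<alpha>. \<bar>c \<alpha>\<bar> * r ^ (\<alpha> 1 + \<alpha> 2 + \<alpha> 3))"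
  have "nm r F \<le> ennreal B"
  proof (rule nm_series3_le[OF r])
    fix T :: "(3 \<Rightarrow> nat) set" assume "finite T"
    then show "(\<Sum>\<alpha>\<in>T. \<bar>coeff3 F \<alpha>\<bar> * r ^ (\<alpha> 1 + \<alpha> 2 + \<alpha> 3)) \<le> B"
      unfolding F_def coeff3_series_of_coeff3 B_def using r
      by (intro finite_sum_le_infsum abs) auto
  qed
  then have fin: "nm r F < top" by (rule le_less_trans) simp
  have series: "series (Germ F) = F" using convergesI[OF r fin] by (simp add: Germ_inverse)
  have "f x = gev (coord (x - p)) (Germ F)" if "dist x p < r" for x
  proof -
    have bound: "\<bar>coord (x - p) i\<bar> \<le> r" for i
      using that order_trans[OF coord_le_norm, of "x - p" r] by (simp add: dist_norm)
    have "((\<lambda>\<alpha>. c \<alpha> * (\<Prod>i\<in>UNIV. (x $ i - p $ i) ^ \<alpha> i)) has_sum ev (coord (x - p)) F) UNIV"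
      using has_sum_series3[of r "coord (x - p)" F, OF r bound fin]
      unfolding coord_simps by (simp add: F_def coeff3_series_of_coeff3 prod3)
    moreover have "dist x p < d" using that d(1) by (simp add: r_def)
    ultimately have "ev (coord (x - p)) F = f x" using d(2) by (intro has_sum_unique)
    then show ?thesis by (simp add: series)
  qed
  then have "has_germ f p (Germ F)"
    unfolding has_germ_def eventually_nhds_metric using r by blast
  then show thesis by (rule that)
qed

lemma real_analytic_at_gev:
  fixes F :: "series3 germ"
  shows "real_analytic_at (\<lambda>x. gev (coord (x - p)) F) p"
proof -
  obtain r where r: "0 < r" "nm r (series F) < top"
    using convergent_series[of F] by (auto simp: converges_def)
  have prod3: "(\<Prod>i\<in>UNIV. g i) = g 1 * g 2 * g 3" for g :: "3 \<Rightarrow> real"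
    unfolding UNIV_3 by simp
  have "((\<lambda>\<alpha>. coeff3 (series F) \<alpha> * (\<Prod>i\<in>UNIV. (x $ i - p $ i) ^ \<alpha> i)) has_sum gev (coord (x - p)) F) UNIV"
    if "dist x p < r" for x
  proof -
    have bound: "\<bar>coord (x - p) i\<bar> \<le> r" for i
      using that order_trans[OF coord_le_norm, of "x - p" r] by (simp add: dist_norm)
    show ?thesis
      using has_sum_series3[of r "coord (x - p)" "series F", OF r(1) bound r(2)]
      unfolding coord_simps by (simp add: prod3)
  qed
  then show ?thesis
    unfolding real_analytic_at_def eventually_nhds_metric using r(1) by blast
qed

text \<open>The curve stays within half the radius of finite norm, since the chain rule pays for
  derivatives with a loss of radius.\<close>

lemma gev_curve:
  fixes F :: "series3 germ"
  assumes J: "convex J" and close: "\<And>t. t \<in> J \<Longrightarrow> dist (\<gamma> t) p < germ_radius F / 2"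
    and M: "\<And>t. t \<in> J \<Longrightarrow> norm (\<gamma>' t) \<le> M"
    and der: "\<And>t. t \<in> J \<Longrightarrow> (\<gamma> has_vector_derivative \<gamma>' t) (at t within J)" and t: "t \<in> J"
  shows "((\<lambda>t. gev (coord (\<gamma> t - p)) F) has_field_derivative
    (\<Sum>i\<in>UNIV. \<gamma>' t $ i * gev (coord (\<gamma> t - p)) (gdv (index i) F))) (at t within J)"
proof -
  have "((\<lambda>t. gev (coord (\<gamma> t - p)) F) has_field_derivative
    (\<Sum>i<nvars TYPE(series3). coord (\<gamma>' t) i * ev (coord (\<gamma> t - p)) (dv i (series F)))) (at t within J)"
  proof (rule ev_curve[OF _ _ germ_radius(2) J _ _ _ t])
    show "0 < germ_radius F / 2" "germ_radius F / 2 < germ_radius F" using germ_radius(1)[of F] by simp_all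
    fix i s assume s: "s \<in> J"
    show "\<bar>coord (\<gamma> s - p) i\<bar> \<le> germ_radius F / 2"
      using close[OF s] coord_le_norm[of "\<gamma> s - p" i] by (simp add: dist_norm)
    show "\<bar>coord (\<gamma>' s) i\<bar> \<le> M"
      using M[OF s] coord_le_norm[of "\<gamma>' s" i] by simp
    have comp: "((\<lambda>t. (\<gamma> t - p) $ k) has_field_derivative \<gamma>' s $ k) (at s within J)" for k
    proof -
      have "((\<lambda>t. \<gamma> t $ k) has_field_derivative \<gamma>' s $ k) (at s within J)"
        using bounded_linear.has_vector_derivative[OF bounded_linear_vec_nth der[OF s]]
        by (simp add: has_real_derivative_iff_has_vector_derivative)
      then show ?thesis by (auto intro!: derivative_eq_intros)
    qed
    show "((\<lambda>t. coord (\<gamma> t - p) i) has_field_derivative coord (\<gamma>' s) i) (at s within J)"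
      unfolding coord_def using comp by (cases "i = 0"; cases "i = 1"; cases "i = 2") auto
  qed
  then show ?thesis
    by (simp add: nvars_fps_def nvars_real_def sum_3 coord_def index_def gdv.rep_eq numeral_2_eq_2)
qed

abbreviation has_partial :: "3 \<Rightarrow> (real^3 \<Rightarrow> real) \<Rightarrow> real^3 \<Rightarrow> real \<Rightarrow> bool" where
  "has_partial i f x D \<equiv> ((\<lambda>t. f (x + t *\<^sub>R axis i 1)) has_field_derivative D) (at 0)"

lemma gev_has_partial:
  fixes F :: "series3 germ"
  assumes x: "dist x p < germ_radius F / 2"
  shows "has_partial i (\<lambda>x. gev (coord (x - p)) F) x (gev (coord (x - p)) (gdv (index i) F))"
proof -
  define \<eta> where "\<eta> = germ_radius F / 2 - dist x p"
  have J: "0 \<in> {- \<eta><..<\<eta>}" using x by (simp add: \<eta>_def)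
  have "has_partial i (\<lambda>x. gev (coord (x - p)) F) x
    (\<Sum>k\<in>UNIV. axis i 1 $ k * gev (coord (x + 0 *\<^sub>R axis i 1 - p)) (gdv (index k) F))"
    unfolding at_within_open[OF J open_greaterThanLessThan, symmetric]
  proof (rule gev_curve[OF _ _ _ _ J, where M = 1])
    fix t assume t: "t \<in> {- \<eta><..<\<eta>}"
    have "dist (x + t *\<^sub>R axis i 1) p \<le> dist x p + \<bar>t\<bar>"
      using norm_triangle_ineq[of "x - p" "t *\<^sub>R axis i 1"] by (simp add: dist_norm algebra_simps)
    then show "dist (x + t *\<^sub>R axis i 1) p < germ_radius F / 2" using t by (auto simp: \<eta>_def)
    show "((\<lambda>t. x + t *\<^sub>R axis i 1) has_vector_derivative axis i 1) (at t within {- \<eta><..<\<eta>})"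
      by (auto intro!: derivative_eq_intros)
  qed simp_all
  moreover have "(\<Sum>k\<in>UNIV. axis i (1::real) $ k * g k) = g i" for g :: "3 \<Rightarrow> real"
    by (simp add: axis_def if_distrib[of "\<lambda>x. x * _"] cong: if_cong)
  ultimately show ?thesis by simp
qed

lemma eventually_line:
  assumes "\<forall>\<^sub>F x in nhds y. P x" shows "\<forall>\<^sub>F t in nhds 0. P (y + t *\<^sub>R axis i (1::real))"
proof -
  have "((\<lambda>t. y + t *\<^sub>R axis i 1) \<longlongrightarrow> y + 0 *\<^sub>R axis i (1::real)) (nhds 0)"
    by (intro tendsto_intros filterlim_ident)
  then show ?thesis using assms by (simp add: filterlim_iff)
qed

lemma has_germ_partial_deriv:
  assumes "has_germ f p F"
  shows "\<forall>\<^sub>F x in nhds p. has_partial i f x (gev (coord (x - p)) (gdv (index i) F))"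
proof -
  have "\<forall>\<^sub>F x in nhds p. dist x p < germ_radius F / 2"
    unfolding eventually_nhds_metric using germ_radius(1)[of F] by (intro exI[of _ "germ_radius F / 2"]) simp
  \<comment> \<open>Equality with the series must hold around each nearby \<open>x\<close>, not only
    at \<open>x\<close>, before derivatives at \<open>x\<close> can be compared.\<close>
  moreover have "\<forall>\<^sub>F x in nhds p. \<forall>\<^sub>F y in nhds x. f y = gev (coord (y - p)) F"
    using assms unfolding has_germ_def by (simp add: eventually_eventually)
  ultimately show ?thesis
    by eventually_elim (subst DERIV_cong_ev[OF refl eventually_line refl], assumption, rule gev_has_partial)
qed

lemma has_germ_partial:
  assumes "has_germ f p F" shows "has_germ (partial i f) p (gdv (index i) F)"
  unfolding has_germ_def partial_def using has_germ_partial_deriv[OF assms, of i]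
  by eventually_elim (rule DERIV_imp_deriv)

lemma has_germ_has_partial:
  assumes "has_germ f p F"
  shows "\<forall>\<^sub>F x in nhds p. has_partial i f x (partial i f x)"
  using has_germ_partial_deriv[OF assms, of i] unfolding partial_def
  by eventually_elim (simp add: DERIV_imp_deriv)

lemma has_germ_bounded:
  assumes "has_germ f p F" shows "\<exists>B. \<forall>\<^sub>F x in nhds p. \<bar>f x\<bar> \<le> B"
proof -
  obtain B where B: "\<forall>\<^sub>F v in near_0. \<bar>gev v F\<bar> \<le> B" using gev_bounded[of F] by blast
  then have "\<forall>\<^sub>F x in nhds p. \<bar>gev (coord (x - p)) F\<bar> \<le> B"
    using filterlim_coord[of p] unfolding filterlim_iff by blast
  then have "\<forall>\<^sub>F x in nhds p. \<bar>f x\<bar> \<le> B"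
    using assms unfolding has_germ_def by eventually_elim simp
  then show ?thesis by blast
qed

text \<open>Carries divisibility in the ring of germs over to the notion used by genericity. A
  non-unit stays non-invertible because a function determines its germ.\<close>

lemma has_germ_dvd_share_factor:
  assumes "has_germ f p F" "has_germ g p G" "h dvd F" "h dvd G" "\<not> h dvd 1"
  shows "share_noninvertible_factor p f g"
proof -
  let ?h = "\<lambda>x. gev (coord (x - p)) h"
  have dvd: "germ_dvd p ?h f'" if f': "has_germ f' p F'" and F': "h dvd F'" for f' F'
  proof -
    obtain k where k: "F' = h * k" using F' by (rule dvdE)
    have "has_germ (\<lambda>x. ?h x * gev (coord (x - p)) k) p F'"
      unfolding k by (intro has_germ_mult has_germ_gev)
    then have "\<forall>\<^sub>F x in nhds p. f' x = ?h x * gev (coord (x - p)) k"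
      using f' unfolding has_germ_def by eventually_elim simp
    then show ?thesis unfolding germ_dvd_def using real_analytic_at_gev by blast
  qed
  have "\<not> germ_invertible p ?h"
  proof
    assume "germ_invertible p ?h"
    then obtain k where k: "real_analytic_at k p" "\<forall>\<^sub>F x in nhds p. ?h x * k x = 1"
      unfolding germ_invertible_def by blast
    obtain K where K: "has_germ k p K" using real_analytic_at_imp_has_germ[OF k(1)] .
    have "has_germ (\<lambda>x. 1) p (h * K)"
      using has_germ_mult[OF has_germ_gev K] k(2) by (rule has_germ_cong)
    moreover have "has_germ (\<lambda>x. 1) p 1" using has_germ_of_nat[of 1 p] by simp
    ultimately have "h * K = 1" by (rule has_germ_unique)
    then show False using assms(5) by (metis dvdI)
  qed
  then show ?thesis
    unfolding share_noninvertible_factor_def using dvd assms(1-4) real_analytic_at_gev by blast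
qed

section \<open>The Ricci tensor of a diagonal metric\<close>

lemma partial_eqI:
  assumes "\<forall>\<^sub>F t in nhds 0. f (y + t *\<^sub>R axis i 1) = g (y + t *\<^sub>R axis i 1)"
    and "has_partial i g y D"
  shows "partial i f y = D"
proof -
  have "has_partial i f y D"
    using assms by (subst DERIV_cong_ev[OF refl _ refl]) auto
  then show ?thesis unfolding partial_def by (rule DERIV_imp_deriv)
qed

lemma matrix_inv_diagonal:
  fixes a :: "3 \<Rightarrow> real"
  assumes "\<And>i. a i \<noteq> 0"
  shows "matrix_inv (\<chi> i j. if i = j then a i else 0) = (\<chi> i j. if i = j then 1 / a i else 0)"
proof -
  let ?A = "\<chi> i j. if i = j then a i else (0::real)" and ?B = "\<chi> i j. if i = j then 1 / a i else (0::real)"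
  have AB: "?A ** ?B = mat 1" and BA: "?B ** ?A = mat 1"
    using assms by (simp_all add: matrix_matrix_mult_def mat_def vec_eq_iff if_distrib[of "\<lambda>x. x * _"] cong: if_cong)
  have "?A ** matrix_inv ?A = mat 1 \<and> matrix_inv ?A ** ?A = mat 1"
    unfolding matrix_inv_def by (rule someI[of _ ?B]) (use AB BA in blast)
  then have "matrix_inv ?A = matrix_inv ?A ** (?A ** ?B)" "matrix_inv ?A ** ?A = mat 1"
    using AB by (simp_all add: matrix_mul_rid)
  then show ?thesis by (simp add: matrix_mul_assoc matrix_mul_lid)
qed

text \<open>Here \<open>p1 i j\<close> is the derivative of \<open>p i\<close> in direction
  \<open>j\<close>, and \<open>p2 i j k\<close> that of \<open>p1 i j\<close> in direction
  \<open>k\<close>. With these as parameters the curvature is a rational expression in numbers.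
  Partial derivatives see only coordinate lines, so \<open>W\<close> need only contain short pieces
  of these.\<close>

locale diagonal_metric =
  fixes p :: "3 \<Rightarrow> real^3 \<Rightarrow> real" and p1 :: "3 \<Rightarrow> 3 \<Rightarrow> real^3 \<Rightarrow> real"
    and p2 :: "3 \<Rightarrow> 3 \<Rightarrow> 3 \<Rightarrow> real^3 \<Rightarrow> real" and W :: "(real^3) set" and G :: "real^3 \<Rightarrow> real^3^3"
  assumes G: "G y = (\<chi> i j. if i = j then p i y else 0)"
    and line: "y \<in> W \<Longrightarrow> \<forall>\<^sub>F t in nhds 0. y + t *\<^sub>R axis i 1 \<in> W"
    and nz: "y \<in> W \<Longrightarrow> p i y \<noteq> 0"
    and d1: "y \<in> W \<Longrightarrow> has_partial j (p i) y (p1 i j y)"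
    and d2: "y \<in> W \<Longrightarrow> has_partial k (p1 i j) y (p2 i j k y)"
begin

text \<open>The covariant metric has the diagonal entries \<open>1 / p a y\<close>;
  \<open>cog a b i\<close> is its first derivative in direction \<open>i\<close>, and
  \<open>dcog a b i l\<close> the further derivative in direction \<open>l\<close>. Likewise
  \<open>gam\<close> is the Christoffel symbol and \<open>dgam\<close> its derivative.\<close>

definition "cog a b i y = (if a = b then - p1 a i y / (p a y)\<^sup>2 else 0)"
definition "dcog a b i l y = (if a = b then - p2 a i l y / (p a y)\<^sup>2 + 2 * p1 a i y * p1 a l y / (p a y) ^ 3 else 0)"
definition "gam k i j y = 1 / 2 * (p k y * (cog j k i y + cog i k j y - cog i j k y))"
definition "dgam k i j l y = 1 / 2 * (p1 k l y * (cog j k i y + cog i k j y - cog i j k y)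
    + p k y * (dcog j k i l y + dcog i k j l y - dcog i j k l y))"

lemma cometric_inv: "y \<in> W \<Longrightarrow> matrix_inv (G y) $ a $ b = (if a = b then 1 / p a y else 0)"
  unfolding G using matrix_inv_diagonal[of "\<lambda>i. p i y"] nz by simp

lemma partial_metric:
  assumes "y \<in> W" shows "partial i (\<lambda>y. matrix_inv (G y) $ a $ b) y = cog a b i y"
proof (rule partial_eqI)
  show "\<forall>\<^sub>F t in nhds 0. matrix_inv (G (y + t *\<^sub>R axis i 1)) $ a $ b =
      (\<lambda>y. if a = b then 1 / p a y else 0) (y + t *\<^sub>R axis i 1)"
    using line[OF assms, of i] by eventually_elim (rule cometric_inv)
  show "((\<lambda>t. (\<lambda>y. if a = b then 1 / p a y else 0) (y + t *\<^sub>R axis i 1)) has_field_derivative cog a b i y) (at 0)"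
    using nz[OF assms, of a] by (cases "a = b")
      (auto simp: cog_def power2_eq_square intro!: derivative_eq_intros d1[OF assms])
qed

lemma christoffel_eq:
  assumes "y \<in> W" shows "christoffel G k i j y = gam k i j y"
proof -
  have "G y $ k $ l = (if k = l then p k y else 0)" for l by (simp add: G)
  then show ?thesis
    unfolding christoffel_def Let_def partial_metric[OF assms] gam_def
    by (simp add: if_distrib[of "\<lambda>x. x * _"] cong: if_cong)
qed

lemma cog_deriv:
  assumes "y \<in> W"
  shows "has_partial l (cog a b i) y (dcog a b i l y)"
  using nz[OF assms, of a] by (cases "a = b")
    (auto simp: cog_def dcog_def power2_eq_square power3_eq_cube field_simps
      intro!: derivative_eq_intros d1[OF assms] d2[OF assms])

lemma partial_christoffel:
  assumes "y \<in> W" shows "partial l (christoffel G k i j) y = dgam k i j l y"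
proof (rule partial_eqI)
  show "\<forall>\<^sub>F t in nhds 0. christoffel G k i j (y + t *\<^sub>R axis l 1) = gam k i j (y + t *\<^sub>R axis l 1)"
    using line[OF assms, of l] by eventually_elim (rule christoffel_eq)
  show "has_partial l (gam k i j) y (dgam k i j l y)"
    unfolding gam_def dgam_def
    by (auto intro!: derivative_eq_intros d1[OF assms] cog_deriv[OF assms])
qed

lemma ricci_eq:
  assumes "y \<in> W"
  shows "ricci G i j y = (\<Sum>k\<in>UNIV. dgam k i j k y - dgam k i k j y)
     + (\<Sum>k\<in>UNIV. \<Sum>l\<in>UNIV. gam k k l y * gam l i j y - gam k j l y * gam l i k y)"
  unfolding ricci_def partial_christoffel[OF assms] christoffel_eq[OF assms] ..

text \<open>Up to a sign, the sectional curvature of the coordinate plane of \<open>i\<close> and \<open>j\<close>.\<close>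

definition "sect i j k y =
    - 1 / 2 * p j y * (p2 i j j y / p i y - 3 / 2 * (p1 i j y / p i y)\<^sup>2 + 1 / 2 * (p1 i j y / p i y) * (p1 j j y / p j y))
    - 1 / 2 * p i y * (p2 j i i y / p j y - 3 / 2 * (p1 j i y / p j y)\<^sup>2 + 1 / 2 * (p1 j i y / p j y) * (p1 i i y / p i y))
    + 1 / 4 * p k y * (p1 i k y / p i y) * (p1 j k y / p j y)"

lemma sect_commute: "sect i j k y = sect j i k y"
  by (simp add: sect_def mult_ac)

lemma ricci_diagonal:
  assumes "y \<in> W"
  shows "p 1 y * ricci G 1 1 y = - (sect 1 2 3 y + sect 1 3 2 y)"
    and "p 2 y * ricci G 2 2 y = - (sect 1 2 3 y + sect 2 3 1 y)"
    and "p 3 y * ricci G 3 3 y = - (sect 1 3 2 y + sect 2 3 1 y)"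
  using nz[OF assms, of 1] nz[OF assms, of 2] nz[OF assms, of 3]
  unfolding ricci_eq[OF assms] sum_3 gam_def dgam_def cog_def dcog_def sect_def
  by (simp_all add: field_simps power2_eq_square power3_eq_cube)

end

text \<open>Three numbers whose pairwise sums all vanish are zero.\<close>

lemma (in diagonal_metric) sect_eq_0:
  assumes y: "y \<in> W" and ric: "\<And>i. ricci G i i y = 0"
    and ijk: "i \<noteq> j" "i \<noteq> k" "j \<noteq> k"
  shows "sect i j k y = 0"
proof -
  have "sect 1 2 3 y = 0" "sect 1 3 2 y = 0" "sect 2 3 1 y = 0"
    using ricci_diagonal[OF y] ric by simp_all
  then show ?thesis
    using exhaust_3[of i] exhaust_3[of j] exhaust_3[of k] ijk sect_commute by metis
qed

text \<open>This is \<open>sect i j k y\<close> times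
  \<open>- 4 * (p i y)\<^sup>2 * (p j y)\<^sup>2\<close>, grouped as in
  \<open>prime_dvd_derivation\<close>: \<open>p i\<close> and \<open>p j\<close> stand for
  \<open>P\<close> and \<open>Q\<close> there, and the directions \<open>j\<close> and
  \<open>k\<close> for \<open>d\<close> and \<open>d'\<close>.\<close>

lemma (in diagonal_metric) cleared_sect_eq_0:
  assumes "y \<in> W" and "\<And>i. ricci G i i y = 0"
    and "i \<noteq> j" "i \<noteq> k" "j \<noteq> k"
  shows "p j y ^ 3 * (2 * p i y * p2 i j j y - 3 * (p1 i j y)\<^sup>2)
    + p i y * p1 i j y * (p1 j j y * (p j y)\<^sup>2)
    + (p i y)\<^sup>2 * (2 * p j y * p2 j i i y * p i y - 3 * (p1 j i y)\<^sup>2 * p i y + p j y * p1 j i y * p1 i i y)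
    + p i y * p1 i k y * (- (p j y * p k y * p1 j k y)) = 0" (is "?E = 0")
proof -
  have "?E = - 4 * (p i y)\<^sup>2 * (p j y)\<^sup>2 * sect i j k y"
    using nz[OF assms(1), of i] nz[OF assms(1), of j]
    unfolding sect_def by (simp add: field_simps power2_eq_square power3_eq_cube)
  then show ?thesis using sect_eq_0[OF assms] by simp
qed

section \<open>From vanishing curvature to divisibility of germs\<close>

lemma eventually_all_3: "(\<And>i. eventually (P i) F) \<Longrightarrow> \<forall>\<^sub>F x in F. \<forall>i::3. P i x"
  by (rule eventually_all_finite)

text \<open>The cleared curvature equation becomes the identity \<open>EG = 0\<close> between germs.
  Genericity enters through primes: one dividing both \<open>F i\<close> and \<open>F j\<close>
  would be a shared non-invertible factor.\<close>

lemma germ_dvd_partial: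
  fixes q :: "3 \<Rightarrow> real^3 \<Rightarrow> real"
  defines "G \<equiv> \<lambda>x. \<chi> i j. if i = j then q i x else 0"
  assumes U: "open U" "p0 \<in> U" and F: "\<And>i. has_germ (q i) p0 (F i)" and F0: "\<And>i. F i \<noteq> 0"
    and coprime: "\<And>i j. i \<noteq> j \<Longrightarrow> \<not> share_noninvertible_factor p0 (q i) (q j)"
    and ric: "\<And>x i. x \<in> U \<Longrightarrow> (\<And>i. q i x \<noteq> 0) \<Longrightarrow> ricci G i i x = 0"
    and ij: "i \<noteq> j"
  shows "F i dvd gdv (index j) (F i)"
proof -
  have "card {i, j} < card (UNIV :: 3 set)" using ij by simp
  then have "\<exists>k. k \<notin> {i, j}" by (metis UNIV_eq_I order_less_irrefl)
  then obtain k where "k \<notin> {i, j}" ..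
  then have ijk: "i \<noteq> k" "j \<noteq> k" by auto
  define q1 where "q1 i j = partial j (q i)" for i j
  define q2 where "q2 i j k = partial k (q1 i j)" for i j k
  have F1: "has_germ (q1 i j) p0 (gdv (index j) (F i))" for i j
    unfolding q1_def by (rule has_germ_partial[OF F])
  have F2: "has_germ (q2 i j k) p0 (gdv (index k) (gdv (index j) (F i)))" for i j k
    unfolding q2_def by (rule has_germ_partial[OF F1])
  have "\<forall>\<^sub>F x in nhds p0. x \<in> U" using U by (rule eventually_nhds_in_open)
  moreover have "\<forall>\<^sub>F x in nhds p0. \<forall>i j. has_partial j (q i) x (q1 i j x)"
    unfolding q1_def by (intro eventually_all_3 has_germ_has_partial[OF F])
  moreover have "\<forall>\<^sub>F x in nhds p0. \<forall>i j k. has_partial k (q1 i j) x (q2 i j k x)"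
    unfolding q2_def by (intro eventually_all_3 has_germ_has_partial[OF F1])
  moreover define good where "good x \<longleftrightarrow> x \<in> U \<and>
      (\<forall>i j. has_partial j (q i) x (q1 i j x)) \<and>
      (\<forall>i j k. has_partial k (q1 i j) x (q2 i j k x))" for x
  ultimately have "eventually good (nhds p0)"
    unfolding good_def by (intro eventually_conj)
  then obtain N where N: "open N" "p0 \<in> N" and good: "\<And>x. x \<in> N \<Longrightarrow> good x"
    unfolding eventually_nhds by blast
  have inN: "x \<in> U"
    "has_partial j (q i) x (q1 i j x)"
    "has_partial k (q1 i j) x (q2 i j k x)"
    if "x \<in> N" for x i j k
    using good[OF that] unfolding good_def by simp_all
  define W where "W = {x \<in> N. \<forall>i. q i x \<noteq> 0}"
  interpret diagonal_metric q q1 q2 W G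
  proof
    show "G y = (\<chi> i j. if i = j then q i y else 0)" for y by (simp add: G_def)
    show "\<forall>\<^sub>F t in nhds 0. y + t *\<^sub>R axis l 1 \<in> W" if y: "y \<in> W" for y l
    proof -
      have "\<forall>\<^sub>F t in nhds 0. y + t *\<^sub>R axis l 1 \<in> N"
        using y N(1) by (intro eventually_line eventually_nhds_in_open) (auto simp: W_def)
      moreover have "\<forall>\<^sub>F t in nhds 0. \<forall>i. q i (y + t *\<^sub>R axis l 1) \<noteq> 0"
      proof (rule eventually_all_3)
        fix i
        have "isCont (\<lambda>t. q i (y + t *\<^sub>R axis l 1)) 0"
          using inN(2)[of y i l] y by (auto simp: W_def intro: DERIV_isCont)
        then have "((\<lambda>t. q i (y + t *\<^sub>R axis l 1)) \<longlongrightarrow> q i (y + 0 *\<^sub>R axis l 1)) (nhds 0)"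
          by (simp add: isCont_def tendsto_at_iff_tendsto_nhds[where g = "\<lambda>t. q i (y + t *\<^sub>R axis l 1)" and l = 0, simplified])
        moreover have "q i (y + 0 *\<^sub>R axis l 1) \<noteq> 0" using y by (simp add: W_def)
        ultimately show "\<forall>\<^sub>F t in nhds 0. q i (y + t *\<^sub>R axis l 1) \<noteq> 0"
          by (rule tendsto_imp_eventually_ne)
      qed
      ultimately show ?thesis by eventually_elim (simp add: W_def)
    qed
  qed (use inN in \<open>auto simp: W_def\<close>)
  let ?E = "\<lambda>x. q j x ^ 3 * (2 * q i x * q2 i j j x - 3 * (q1 i j x)\<^sup>2)
    + q i x * q1 i j x * (q1 j j x * (q j x)\<^sup>2)
    + (q i x)\<^sup>2 * (2 * q j x * q2 j i i x * q i x - 3 * (q1 j i x)\<^sup>2 * q i x + q j x * q1 j i x * q1 i i x)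
    + q i x * q1 i k x * (- (q j x * q k x * q1 j k x))"
  define EG where "EG = F j ^ 3 * (2 * F i * gdv (index j) (gdv (index j) (F i)) - 3 * (gdv (index j) (F i))\<^sup>2)
    + F i * gdv (index j) (F i) * (gdv (index j) (F j) * (F j)\<^sup>2)
    + (F i)\<^sup>2 * (2 * F j * gdv (index i) (gdv (index i) (F j)) * F i - 3 * (gdv (index i) (F j))\<^sup>2 * F i
        + F j * gdv (index i) (F j) * gdv (index i) (F i))
    + F i * gdv (index k) (F i) * (- (F j * F k * gdv (index k) (F j)))"
  have "has_germ ?E p0 EG"
    unfolding EG_def by (intro has_germ_intros F F1 F2)
  then have "has_germ (\<lambda>x. ?E x * (q 1 x * q 2 x * q 3 x)) p0 (EG * (F 1 * F 2 * F 3))"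
    by (intro has_germ_mult F)
  moreover have "?E x * (q 1 x * q 2 x * q 3 x) = 0" if x: "x \<in> N" for x
  proof (cases "q 1 x * q 2 x * q 3 x = 0")
    case False
    then have nz: "q l x \<noteq> 0" for l using exhaust_3[of l] by auto
    then have "x \<in> W" using x by (simp add: W_def)
    then have "?E x = 0"
      using ric[OF inN(1)[OF x] nz] ij ijk by (intro cleared_sect_eq_0) auto
    then show ?thesis by simp
  qed simp
  then have "\<forall>\<^sub>F x in nhds p0. ?E x * (q 1 x * q 2 x * q 3 x) = 0"
    using N unfolding eventually_nhds by blast
  ultimately have "has_germ (\<lambda>_. 0) p0 (EG * (F 1 * F 2 * F 3))"
    by (rule has_germ_cong)
  moreover have "has_germ (\<lambda>_. 0) p0 0" using has_germ_of_nat[of 0 p0] by simp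
  ultimately have "EG * (F 1 * F 2 * F 3) = 0" by (rule has_germ_unique)
  then have "EG = 0" using F0 by simp
  have "\<not> h dvd F j" if h: "prime_elem h" "h dvd F i" for h
  proof
    assume "h dvd F j"
    then have "share_noninvertible_factor p0 (q i) (q j)"
      using h by (intro has_germ_dvd_share_factor[OF F F]) (auto simp: prime_elem_def)
    then show False using coprime[OF ij] by simp
  qed
  then show ?thesis
    using \<open>EG = 0\<close> F0 unfolding EG_def
    by (rule_tac coprime_dvd_derivation[where P = "F i" and Q = "F j" and d' = "gdv (index k)"])
       (rule derivation_gdv of_nat_germ_dvd_1 prime_product_series3_germ | blast)+
qed

section \<open>Degeneracy along a trajectory\<close>

lemma has_germ_nonzero:
  assumes F: "has_germ f p F" and "f p \<noteq> 0"
  shows "\<forall>\<^sub>F x in nhds p. f x \<noteq> 0"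
proof -
  have "coord 0 = (\<lambda>_. 0)" by (simp add: coord_def fun_eq_iff)
  moreover have "f p = gev (coord (p - p)) F"
    using F unfolding has_germ_def by (rule eventually_nhds_x_imp_x)
  ultimately have "F dvd 1" using assms(2) by (simp add: germ_dvd_1_iff)
  then obtain K where "1 = F * K" by (rule dvdE)
  then have "has_germ (\<lambda>x. f x * gev (coord (x - p)) K) p 1"
    using has_germ_mult[OF F has_germ_gev[of p K]] by simp
  then show ?thesis
    unfolding has_germ_def by eventually_elim (auto simp: gev_1)
qed

text \<open>The square of \<phi> times \<open>exp (- 2 * C * \<sigma> * s)\<close>, with \<sigma>
  the sign of \<open>t - t0\<close>, does not increase when \<open>s\<close> moves away from
  \<open>t0\<close>. It is nonnegative and starts at zero. The sign treats both time directions at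
  once.\<close>

lemma gronwall_zero:
  fixes \<phi> :: "real \<Rightarrow> real"
  assumes J: "convex J" "t0 \<in> J" "t \<in> J" and \<phi>0: "\<phi> t0 = 0"
    and der: "\<And>s. s \<in> J \<Longrightarrow> (\<phi> has_field_derivative \<phi>' s) (at s within J)"
    and le: "\<And>s. s \<in> J \<Longrightarrow> \<bar>\<phi>' s\<bar> \<le> C * \<bar>\<phi> s\<bar>"
  shows "\<phi> t = 0"
proof -
  have deriv: "((\<lambda>s. (\<phi> s)\<^sup>2 * exp (c * s)) has_derivative
      (\<lambda>h. h * ((2 * \<phi> s * \<phi>' s + c * (\<phi> s)\<^sup>2) * exp (c * s)))) (at s within S)" if "s \<in> J" "S \<subseteq> J" for c s S
    using DERIV_subset[OF der[OF that(1)] that(2)] unfolding has_field_derivative_def[symmetric]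
    by (auto intro!: derivative_eq_intros simp: has_field_derivative_def[symmetric] algebra_simps
        mult_commute_abs)
  have bound: "\<bar>\<phi> s * \<phi>' s\<bar> \<le> C * (\<phi> s)\<^sup>2" if "s \<in> J" for s
  proof -
    have "\<bar>\<phi> s\<bar> * \<bar>\<phi>' s\<bar> \<le> \<bar>\<phi> s\<bar> * (C * \<bar>\<phi> s\<bar>)"
      using le[OF that] by (intro mult_left_mono) auto
    then show ?thesis by (simp add: abs_mult power2_eq_square mult_ac)
  qed
  show ?thesis
  proof (cases "t = t0")
    case False
    define \<sigma> u v where "\<sigma> = sgn (t - t0)" and "u = min t0 t" and "v = max t0 t"
    have uv: "u < v" and \<sigma>: "\<sigma> * \<sigma> = 1" using False by (auto simp: u_def v_def \<sigma>_def sgn_if)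
    have seg: "{u..v} \<subseteq> J"
      using J closed_segment_subset[of t0 J t] by (simp add: closed_segment_eq_real_ivl u_def v_def split: if_splits)
    define \<psi>' where "\<psi>' x = 2 * \<phi> x * \<phi>' x + (- 2 * C * \<sigma>) * (\<phi> x)\<^sup>2" for x
    obtain x where x: "x \<in> {u<..<v}" "(\<phi> v)\<^sup>2 * exp (- 2 * C * \<sigma> * v) - (\<phi> u)\<^sup>2 * exp (- 2 * C * \<sigma> * u)
        = (v - u) * (\<psi>' x * exp (- 2 * C * \<sigma> * x))"
      using mvt_simple[OF uv deriv[of _ "{u..v}" "- 2 * C * \<sigma>"]] seg unfolding \<psi>'_def by (auto simp: subset_iff)
    have "x \<in> J" using x(1) seg by auto
    then have "\<sigma> * (\<phi> x * \<phi>' x) \<le> C * (\<phi> x)\<^sup>2" using bound[of x] by (auto simp: \<sigma>_def sgn_if)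
    moreover have "\<sigma> * \<psi>' x = 2 * (\<sigma> * (\<phi> x * \<phi>' x)) - 2 * C * (\<sigma> * \<sigma>) * (\<phi> x)\<^sup>2"
      by (simp add: \<psi>'_def algebra_simps)
    ultimately have le0: "\<sigma> * \<psi>' x \<le> 0" by (simp add: \<sigma>)
    have "(v - u) * exp (- 2 * C * \<sigma> * x) * (\<sigma> * \<psi>' x) \<le> 0"
      by (rule mult_nonneg_nonpos[OF _ le0]) (use uv in simp)
    also have "(v - u) * exp (- 2 * C * \<sigma> * x) * (\<sigma> * \<psi>' x) = (\<phi> t)\<^sup>2 * exp (- 2 * C * \<sigma> * t)"
      using arg_cong[OF x(2), of "(*) \<sigma>"] \<phi>0 False
      by (auto simp: u_def v_def \<sigma>_def sgn_if min_def max_def mult_ac split: if_splits)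
    finally show ?thesis by (simp add: mult_le_0_iff not_le[symmetric])
  qed (use \<phi>0 in simp)
qed

lemma degenerate_near:
  fixes q :: "3 \<Rightarrow> real^3 \<Rightarrow> real" and \<gamma> :: "real \<Rightarrow> real^3"
  assumes F: "\<And>i. has_germ (q i) (\<gamma> t0) (F i)" and H: "has_germ f (\<gamma> t0) H"
    and dvd: "\<And>i j. (\<And>i. F i \<noteq> 0) \<Longrightarrow> i \<noteq> j \<Longrightarrow> F i dvd gdv (index j) (F i)"
    and I: "convex I" "t0 \<in> I"
    and der: "\<And>t. t \<in> I \<Longrightarrow> (\<gamma> has_vector_derivative (\<chi> j. q j (\<gamma> t) * partial j f (\<gamma> t))) (at t within I)"
    and deg: "q 1 (\<gamma> t0) * q 2 (\<gamma> t0) * q 3 (\<gamma> t0) = 0"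
  shows "\<exists>\<eta>>0. \<forall>t\<in>I. \<bar>t - t0\<bar> < \<eta> \<longrightarrow> q 1 (\<gamma> t) * q 2 (\<gamma> t) * q 3 (\<gamma> t) = 0"
proof -
  let ?p = "\<gamma> t0"
  have near: "\<exists>\<eta>>0. \<forall>t\<in>I. \<bar>t - t0\<bar> < \<eta> \<longrightarrow> P (\<gamma> t)" if P: "\<forall>\<^sub>F x in nhds ?p. P x" for P
  proof -
    obtain d where d: "0 < d" "\<And>x. dist x ?p < d \<Longrightarrow> P x"
      using P unfolding eventually_nhds_metric by blast
    have "continuous (at t0 within I) \<gamma>"
      using der[OF I(2)] by (rule has_vector_derivative_continuous)
    then show ?thesis
      using d unfolding continuous_within_eps_delta by (metis dist_real_def)
  qed
  show ?thesis
  proof (cases "\<forall>i. F i \<noteq> 0")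
    case False
    then obtain i where "F i = 0" by blast
    then have "\<forall>\<^sub>F x in nhds ?p. q i x = 0" using F[of i] by (simp add: has_germ_def gev_0)
    then have "\<forall>\<^sub>F x in nhds ?p. q 1 x * q 2 x * q 3 x = 0"
      by eventually_elim (use exhaust_3[of i] in auto)
    then show ?thesis by (rule near)
  next
    case True
    define D where "D x = q 1 x * q 2 x * q 3 x" for x
    define DG where "DG = F 1 * F 2 * F 3"
    have D: "has_germ D ?p DG" unfolding D_def DG_def by (intro has_germ_mult F)
    have "\<exists>K. F j * gdv (index j) DG = DG * K" for j
    proof -
      interpret derivation "gdv (index j)" by (rule derivation_gdv)
      \<comment> \<open>For \<open>i = j\<close> the divisor is the factor \<open>F j\<close>
        itself, contributed by the gradient; for other \<open>i\<close> it divides the derivative by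
        \<open>dvd\<close>.\<close>
      have F_dvd: "F i dvd F j * gdv (index j) (F i)" for i
        using dvd[of i j] True by (cases "i = j") (auto intro: dvd_mult)
      have "F j * gdv (index j) DG = F j * gdv (index j) (F 1) * (F 2 * F 3)
          + F j * gdv (index j) (F 2) * (F 1 * F 3) + F j * gdv (index j) (F 3) * (F 1 * F 2)"
        unfolding DG_def d_mult by (simp add: algebra_simps)
      moreover have "DG = F 1 * (F 2 * F 3)" "DG = F 2 * (F 1 * F 3)" "DG = F 3 * (F 1 * F 2)"
        by (simp_all add: DG_def mult_ac)
      ultimately have "DG dvd F j * gdv (index j) DG"
        using F_dvd by (metis dvd_add mult_dvd_mono dvd_refl)
      then show ?thesis by (auto elim: dvdE)
    qed
    then obtain K where K: "\<And>j. F j * gdv (index j) DG = DG * K j" by metis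
    have "\<forall>\<^sub>F x in nhds ?p. q j x * gev (coord (x - ?p)) (gdv (index j) DG) = D x * gev (coord (x - ?p)) (K j)" for j
    proof -
      have "has_germ (\<lambda>x. q j x * gev (coord (x - ?p)) (gdv (index j) DG)) ?p (DG * K j)"
        unfolding K[symmetric] by (intro has_germ_mult F has_germ_gev)
      moreover have "has_germ (\<lambda>x. D x * gev (coord (x - ?p)) (K j)) ?p (DG * K j)"
        by (intro has_germ_mult D has_germ_gev)
      ultimately show ?thesis unfolding has_germ_def by eventually_elim simp
    qed
    moreover have "\<forall>j. \<exists>B. \<forall>\<^sub>F x in nhds ?p. \<bar>gev (coord (x - ?p)) (K j)\<bar> \<le> B"
      by (intro allI has_germ_bounded[OF has_germ_gev])
    from choice[OF this] obtain BK where "\<forall>j. \<forall>\<^sub>F x in nhds ?p. \<bar>gev (coord (x - ?p)) (K j)\<bar> \<le> BK j" ..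
    note this[rule_format]
    moreover have "\<forall>j. \<exists>B. \<forall>\<^sub>F x in nhds ?p. \<bar>q j x\<bar> \<le> B"
      by (intro allI has_germ_bounded[OF F])
    from choice[OF this] obtain Bq where "\<forall>j. \<forall>\<^sub>F x in nhds ?p. \<bar>q j x\<bar> \<le> Bq j" ..
    note this[rule_format]
    moreover have "\<forall>j. \<exists>B. \<forall>\<^sub>F x in nhds ?p. \<bar>partial j f x\<bar> \<le> B"
      by (intro allI has_germ_bounded[OF has_germ_partial[OF H]])
    from choice[OF this] obtain Bf where "\<forall>j. \<forall>\<^sub>F x in nhds ?p. \<bar>partial j f x\<bar> \<le> Bf j" ..
    note this[rule_format]
    ultimately have ev: "\<forall>\<^sub>F x in nhds ?p.
        (\<forall>j. q j x * gev (coord (x - ?p)) (gdv (index j) DG) = D x * gev (coord (x - ?p)) (K j)) \<and>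
        (\<forall>j. \<bar>gev (coord (x - ?p)) (K j)\<bar> \<le> BK j) \<and> (\<forall>j. \<bar>q j x\<bar> \<le> Bq j) \<and> (\<forall>j. \<bar>partial j f x\<bar> \<le> Bf j)"
      by (intro eventually_conj eventually_all_3)
    have "\<forall>\<^sub>F x in nhds ?p. dist x ?p < germ_radius DG / 2"
      unfolding eventually_nhds_metric using germ_radius(1)[of DG] by (intro exI[of _ "germ_radius DG / 2"]) simp
    note this D[unfolded has_germ_def] ev
    from near[OF eventually_conj[OF this(1) eventually_conj[OF this(2,3)]]] obtain \<eta> where \<eta>: "0 < \<eta>"
      and close: "\<And>t. t \<in> I \<Longrightarrow> \<bar>t - t0\<bar> < \<eta> \<Longrightarrow> dist (\<gamma> t) ?p < germ_radius DG / 2"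
      and D_eq: "\<And>t. t \<in> I \<Longrightarrow> \<bar>t - t0\<bar> < \<eta> \<Longrightarrow> D (\<gamma> t) = gev (coord (\<gamma> t - ?p)) DG"
      and rel: "\<And>t j. t \<in> I \<Longrightarrow> \<bar>t - t0\<bar> < \<eta> \<Longrightarrow>
        q j (\<gamma> t) * gev (coord (\<gamma> t - ?p)) (gdv (index j) DG) = D (\<gamma> t) * gev (coord (\<gamma> t - ?p)) (K j)"
      and BK: "\<And>t j. t \<in> I \<Longrightarrow> \<bar>t - t0\<bar> < \<eta> \<Longrightarrow> \<bar>gev (coord (\<gamma> t - ?p)) (K j)\<bar> \<le> BK j"
      and Bq: "\<And>t j. t \<in> I \<Longrightarrow> \<bar>t - t0\<bar> < \<eta> \<Longrightarrow> \<bar>q j (\<gamma> t)\<bar> \<le> Bq j"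
      and Bf: "\<And>t j. t \<in> I \<Longrightarrow> \<bar>t - t0\<bar> < \<eta> \<Longrightarrow> \<bar>partial j f (\<gamma> t)\<bar> \<le> Bf j"
      by blast
    \<comment> \<open>\<open>J\<close> may lie on one side of \<open>t0\<close> only, when
      \<open>t0\<close> is an endpoint of \<open>I\<close>.\<close>
    define J where "J = I \<inter> {t0 - \<eta><..<t0 + \<eta>}"
    have J: "convex J" "t0 \<in> J" using I \<eta> by (auto simp: J_def intro: convex_Int)
    have J_iff: "t \<in> J \<longleftrightarrow> t \<in> I \<and> \<bar>t - t0\<bar> < \<eta>" for t by (auto simp: J_def abs_less_iff)
    define c' where "c' t = (\<chi> j. q j (\<gamma> t) * partial j f (\<gamma> t))" for t
    define \<phi>' where "\<phi>' t = (\<Sum>i\<in>UNIV. c' t $ i * gev (coord (\<gamma> t - ?p)) (gdv (index i) DG))" for t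
    have \<phi>_der: "((\<lambda>t. gev (coord (\<gamma> t - ?p)) DG) has_field_derivative \<phi>' t) (at t within J)" if t: "t \<in> J" for t
      unfolding \<phi>'_def
    proof (rule gev_curve[OF J(1) _ _ _ t, where M = "\<Sum>j\<in>UNIV. Bq j * Bf j"])
      fix s assume "s \<in> J"
      then have s: "s \<in> I" "\<bar>s - t0\<bar> < \<eta>" by (auto simp: J_iff)
      show "dist (\<gamma> s) ?p < germ_radius DG / 2" by (rule close[OF s])
      have "norm (c' s) \<le> (\<Sum>j\<in>UNIV. \<bar>c' s $ j\<bar>)" by (rule norm_le_l1_cart)
      also have "\<dots> \<le> (\<Sum>j\<in>UNIV. Bq j * Bf j)"
      proof (rule sum_mono)
        fix j
        have "\<bar>q j (\<gamma> s)\<bar> * \<bar>partial j f (\<gamma> s)\<bar> \<le> Bq j * Bf j"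
          using Bq[OF s, of j] Bf[OF s, of j] by (intro mult_mono) auto
        then show "\<bar>c' s $ j\<bar> \<le> Bq j * Bf j" by (simp add: c'_def abs_mult)
      qed
      finally show "norm (c' s) \<le> (\<Sum>j\<in>UNIV. Bq j * Bf j)" .
      show "(\<gamma> has_vector_derivative c' s) (at s within J)"
        unfolding c'_def by (rule has_vector_derivative_within_subset[OF der[OF s(1)]]) (auto simp: J_def)
    qed
    have \<phi>_le: "\<bar>\<phi>' t\<bar> \<le> (\<Sum>j\<in>UNIV. Bf j * BK j) * \<bar>gev (coord (\<gamma> t - ?p)) DG\<bar>" if "t \<in> J" for t
    proof -
      have t: "t \<in> I" "\<bar>t - t0\<bar> < \<eta>" using that by (auto simp: J_iff)
      have "\<phi>' t = (\<Sum>j\<in>UNIV. partial j f (\<gamma> t) * gev (coord (\<gamma> t - ?p)) (K j) * D (\<gamma> t))"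
        unfolding \<phi>'_def
      proof (rule sum.cong[OF refl])
        fix j
        have "c' t $ j * gev (coord (\<gamma> t - ?p)) (gdv (index j) DG)
            = partial j f (\<gamma> t) * (q j (\<gamma> t) * gev (coord (\<gamma> t - ?p)) (gdv (index j) DG))"
          by (simp add: c'_def)
        then show "c' t $ j * gev (coord (\<gamma> t - ?p)) (gdv (index j) DG)
            = partial j f (\<gamma> t) * gev (coord (\<gamma> t - ?p)) (K j) * D (\<gamma> t)"
          unfolding rel[OF t] by (simp only: mult_ac)
      qed
      also have "\<bar>\<dots>\<bar> \<le> (\<Sum>j\<in>UNIV. \<bar>partial j f (\<gamma> t) * gev (coord (\<gamma> t - ?p)) (K j) * D (\<gamma> t)\<bar>)"
        by (rule sum_abs)
      also have "\<dots> \<le> (\<Sum>j\<in>UNIV. Bf j * BK j * \<bar>D (\<gamma> t)\<bar>)"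
        unfolding abs_mult
      proof (rule sum_mono)
        fix j
        have "\<bar>partial j f (\<gamma> t)\<bar> * \<bar>gev (coord (\<gamma> t - ?p)) (K j)\<bar> \<le> Bf j * BK j"
          using Bf[OF t, of j] BK[OF t, of j] by (intro mult_mono) auto
        then show "\<bar>partial j f (\<gamma> t)\<bar> * \<bar>gev (coord (\<gamma> t - ?p)) (K j)\<bar> * \<bar>D (\<gamma> t)\<bar> \<le> Bf j * BK j * \<bar>D (\<gamma> t)\<bar>"
          by (rule mult_right_mono) simp
      qed
      finally show ?thesis by (simp only: sum_distrib_right D_eq[OF t])
    qed
    have "D (\<gamma> t) = 0" if "t \<in> J" for t
      using gronwall_zero[OF J that _ \<phi>_der \<phi>_le] D_eq J_iff J(2) that deg by (simp add: D_def)
    then show ?thesis using \<eta> unfolding D_def by (auto simp: J_iff)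
  qed
qed

theorem theorem3p2:
  fixes P Q R f :: "real^3 \<Rightarrow> real" and U :: "(real^3) set"
    and I :: "real set" and \<gamma> :: "real \<Rightarrow> real^3"
  defines "G \<equiv> diag_metric P Q R"
  assumes "open U"
    and "real_analytic_on P U" and "real_analytic_on Q U" and "real_analytic_on R U"
    and "\<exists>x\<in>U. det (G x) \<noteq> 0"
    and "generic_on G U"
    and "\<forall>x \<in> U - degeneracy_locus G U. \<forall>i. ricci_frame G i i x = 0"
    and "real_analytic_on f U"
    and "trajectory_in U (grad G f) I \<gamma>"
  shows "\<gamma> ` I \<subseteq> degeneracy_locus G U \<or> \<gamma> ` I \<inter> degeneracy_locus G U = {}"
proof -
  define q where "q i x = G x $ i $ i" for i x
  have q_fun: "q i = (\<lambda>x. G x $ i $ i)" for i by (simp add: q_def fun_eq_iff)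
  have G_nth: "G x $ i $ j = (if i = j then q i x else 0)" for x i j
    by (simp add: q_def G_def diag_metric_def)
  have G_eq: "G = (\<lambda>x. \<chi> i j. if i = j then q i x else 0)"
    by (simp add: fun_eq_iff vec_eq_iff G_nth)
  have q123: "q 1 = P" "q 2 = Q" "q 3 = R"
    by (simp_all add: fun_eq_iff q_def G_def diag_metric_def)
  have det_G: "det (G x) = q 1 x * q 2 x * q 3 x" for x
  proof -
    have "det (G x) = (\<Prod>i\<in>UNIV. q i x)"
      unfolding q_def by (rule det_diagonal) (simp add: G_nth)
    also have "\<dots> = q 1 x * q 2 x * q 3 x" unfolding UNIV_3 by simp
    finally show ?thesis .
  qed
  have ana: "real_analytic_at (q i) x" if "x \<in> U" for i x
    using assms(3-5) that exhaust_3[of i] by (auto simp: real_analytic_on_def q123)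
  have I: "convex I" and \<gamma>U: "\<And>t. t \<in> I \<Longrightarrow> \<gamma> t \<in> U"
    and der: "\<And>t. t \<in> I \<Longrightarrow> (\<gamma> has_vector_derivative grad G f (\<gamma> t)) (at t within I)"
    using assms(10) by (auto simp: trajectory_in_def is_interval_convex)
  have grad_G: "grad G f x = (\<chi> j. q j x * partial j f x)" for x
    by (simp add: grad_def G_nth vec_eq_iff if_distrib[of "\<lambda>x. x * _"] cong: if_cong)
  \<comment> \<open>The frame rescales each diagonal component by the square of the diagonal
    element, so off the locus both versions vanish together.\<close>
  have frame: "ricci_frame G i i x = (q i x)\<^sup>2 * ricci G i i x" for i x
    by (simp add: ricci_frame_def G_nth if_distrib[of "\<lambda>x. x * _"] if_distrib[of "\<lambda>x. _ * x"] power2_eq_square cong: if_cong)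
  have ric: "ricci G i i x = 0" if "x \<in> U" "\<And>i. q i x \<noteq> 0" for x i
    using assms(8) that frame[of i x] by (auto simp: degeneracy_locus_def det_G)
  have germs: "\<exists>F. \<forall>i. has_germ (q i) x (F i)" if "x \<in> U" for x
  proof (intro choice allI)
    show "\<exists>F. has_germ (q i) x F" for i
      by (rule real_analytic_at_imp_has_germ[OF ana[OF that, of i]]) blast
  qed
  have zero: "\<forall>\<^sub>F t in at t0 within I. det (G (\<gamma> t)) = 0" if t0: "t0 \<in> I" "det (G (\<gamma> t0)) = 0" for t0
  proof -
    obtain F where F: "\<And>i. has_germ (q i) (\<gamma> t0) (F i)"
      using germs[OF \<gamma>U[OF t0(1)]] by blast
    have "real_analytic_at f (\<gamma> t0)"
      using assms(9) \<gamma>U[OF t0(1)] unfolding real_analytic_on_def by blast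
    then obtain H where H: "has_germ f (\<gamma> t0) H" by (rule real_analytic_at_imp_has_germ)
    have "\<gamma> t0 \<in> degeneracy_locus G U" using t0 \<gamma>U by (simp add: degeneracy_locus_def)
    then have coprime: "\<not> share_noninvertible_factor (\<gamma> t0) (q i) (q j)" if "i \<noteq> j" for i j
      using assms(7) that unfolding generic_on_def q_fun by blast
    have dvd: "F i dvd gdv (index j) (F i)" if "\<And>i. F i \<noteq> 0" "i \<noteq> j" for i j
      using assms(2) \<gamma>U[OF t0(1)] F that(1) coprime ric[unfolded G_eq] that(2) by (rule germ_dvd_partial)
    have "\<exists>\<eta>>0. \<forall>t\<in>I. \<bar>t - t0\<bar> < \<eta> \<longrightarrow> q 1 (\<gamma> t) * q 2 (\<gamma> t) * q 3 (\<gamma> t) = 0"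
      using F H dvd I t0(1) der[unfolded grad_G] t0(2)[unfolded det_G] by (rule degenerate_near)
    then show ?thesis unfolding det_G eventually_at dist_real_def by blast
  qed
  have nonzero: "\<forall>\<^sub>F t in at t0 within I. det (G (\<gamma> t)) \<noteq> 0" if t0: "t0 \<in> I" "det (G (\<gamma> t0)) \<noteq> 0" for t0
  proof -
    obtain F where F: "\<And>i. has_germ (q i) (\<gamma> t0) (F i)"
      using germs[OF \<gamma>U[OF t0(1)]] by blast
    have "has_germ (\<lambda>x. q 1 x * q 2 x * q 3 x) (\<gamma> t0) (F 1 * F 2 * F 3)" by (intro has_germ_mult F)
    then have "\<forall>\<^sub>F x in nhds (\<gamma> t0). det (G x) \<noteq> 0"
      unfolding det_G by (rule has_germ_nonzero) (use t0(2) in \<open>simp add: det_G\<close>)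
    moreover have "(\<gamma> \<longlongrightarrow> \<gamma> t0) (at t0 within I)"
      using has_vector_derivative_continuous[OF der[OF t0(1)]] by (simp add: continuous_within)
    ultimately show ?thesis unfolding filterlim_iff by blast
  qed
  show ?thesis
  proof (rule ccontr)
    assume "\<not> ?thesis"
    then obtain a b where ab: "a \<in> I" "b \<in> I" "det (G (\<gamma> a)) = 0" "det (G (\<gamma> b)) \<noteq> 0"
      using \<gamma>U by (auto simp: degeneracy_locus_def)
    \<comment> \<open>The truth value of degeneracy is locally constant in time: \<open>zero\<close>
      makes the degenerate times relatively open in \<open>I\<close>, and \<open>nonzero\<close> the
      others. On the connected set \<open>I\<close> it is therefore constant.\<close>
    have "(det (G (\<gamma> a)) = 0) = (det (G (\<gamma> b)) = 0)"
    proof (rule connected_local_const[OF convex_connected[OF I] ab(1,2)], intro ballI)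
      fix t assume t: "t \<in> I"
      show "\<forall>\<^sub>F s in at t within I. (det (G (\<gamma> t)) = 0) = (det (G (\<gamma> s)) = 0)"
      proof (cases "det (G (\<gamma> t)) = 0")
        case True
        from zero[OF t True] show ?thesis by eventually_elim (simp add: True)
      next
        case False
        from nonzero[OF t False] show ?thesis by eventually_elim (simp add: False)
      qed
    qed
    then show False using ab by simp
  qed
qed

end
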